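(* Let $M^n$ be a smooth closed manifold, let $f\colon M^n\to M^n$ be an $A$-endomorphism, and let $\Lambda$ be a basic set of $f$ which is a codimension one topological submanifold of $M^n$. If $\Lambda$ is of type $(n,0)$, then: 1) $\Lambda$ is a repeller of $f$; 2) the restriction of $f$ to $\Lambda$ is an expanding endomorphism in the metric sense with respect to the metric $\rho$ on $M^n$ induced by the adapted Riemannian metric $\langle\cdot,\cdot\rangle_\Lambda$; that is, there exist $\varepsilon>0$ and $\mu>1$ such that $\rho(f(x),f(y))>\mu\,\rho(x,y)$ for all $x,y\in\Lambda$ with $x\ne y$ and $\rho(x,y)<\varepsilon$.
   Context: A $C^r$-endomorphism ($r\ge 1$) of a smooth closed manifold $M^n$ is a $C^r$-smooth surjective map $f\colon M^n\to M^n$ (not necessarily injective). A point $x$ is regular if $Df(x)\colon T_xM^n\to T_{f(x)}M^n$ has rank $n$, and singular otherwise. Orbits. $\hat M=\{\{x_i\}_{i\in\mathbb Z}\in\prod_{i\in\mathbb Z}M^n : f(x_i)=x_{i+1}\ \forall i\in\mathbb Z\}$. For $x\in M^n$, $\hat x=\{\{x_i\}\in\hat M : x_0=x\}$; $\bar x$ denotes an element $\{x_i\}_{i\in\mathbb Z}$ of $\hat x$. For an $f$-invariant set $\Lambda$ (i.e. $f(\Lambda)=\Lambda$), $\hat\Lambda=\{\{x_i\}\in\hat M : x_i\in\Lambda\ \forall i\}$. The shift is $\hat f(\{x_i\})=\{x_{i+1}\}$, with inverse $\hat f^{-1}(\{x_i\})=\{x_{i-1}\}$. Hyperbolicity. Fix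 a smooth Riemannian metric on $M^n$ with norm $\|\cdot\|$. A closed $f$-invariant set $\Lambda\subset M^n$ is hyperbolic if there are $C>0$, $0<\lambda<1$ such that for every $x\in\Lambda$ and every $\bar x=\{x_i\}\in\hat x\cap\hat\Lambda$ there is a continuous splitting $\bigcup_{i\in\mathbb Z}T_{x_i}M^n=\bigcup_{i\in\mathbb Z}E^s_{x_i,\hat f^i(\bar x)}\oplus E^u_{x_i,\hat f^i(\bar x)}$ with (1) $Df(E^s_{x_i,\hat f^i(\bar x)})=E^s_{x_{i+1},\hat f^{i+1}(\bar x)}$ and $Df(E^u_{x_i,\hat f^i(\bar x)})=E^u_{x_{i+1},\hat f^{i+1}(\bar x)}$; (2) $\|Df^k(v)\|\le C\lambda^k\|v\|$ for all $k\ge0$, $i\in\mathbb Z$, $v\in E^s_{x_i,\hat f^i(\bar x)}$; (3) $\|Df^k(v)\|\ge(1/C)\lambda^{-k}\|v\|$ for all $k\ge0$, $i\in\mathbb Z$, $v\in E^u_{x_i,\hat f^i(\bar x)}$. $A$-endomorphisms and basic sets. An endomorphism $f$ is an $A$-endomorphism (satisfies axiom $A$) if its nonwandering set $\Omega_f$ is hyperbolic and contains no singular points of $f$, and the periodic points of $f$ are dense in $\Omega_f$. By the known spectral decomposition theorem (Przytycki), $\Omega_f$ then decomposes uniquely into a finite union of closed $f$-invariant sets $\Lambda_1,\dots,\Lambda_l$, called basic sets, such that the restriction of $f$ to each is topologically transitive. The type of a basic set $\Lambda$ is the pair $(\dim E^u_{x_0,\bar x},\dim E^s_{x_0,\bar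 x})$, which does not depend on $\bar x\in\hat\Lambda$. Repeller. A basic set $\Lambda$ is a repeller if it has an open neighborhood $U$ such that $\operatorname{cl}(U)\subset f(U)$ and $\bigcap_{n=0}^\infty f^{-n}(U)=\Lambda$. Adapted metric. It is known (Przytycki) that for a hyperbolic set $\Lambda$ there exist a smooth Riemannian metric $\langle\cdot,\cdot\rangle_\Lambda$ on $TM^n$, equivalent to the original one, and $0<\lambda<1$ such that for all $\bar x=\{x_i\}\in\hat\Lambda$ and $i\in\mathbb Z$: $\|Df_{x_i}(v)\|_\Lambda\le\lambda\|v\|_\Lambda$ for $v\in E^s_{x_i,\hat f^i(\bar x)}$ and $\|Df_{x_i}(v)\|_\Lambda\ge(1/\lambda)\|v\|_\Lambda$ for $v\in E^u_{x_i,\hat f^i(\bar x)}$. Such a metric $\langle\cdot,\cdot\rangle_\Lambda$ is fixed, and $\rho$ is the distance on $M^n$ it induces. *)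

theory Defs
  imports "HOL-Analysis.Analysis" "HOL-Library.Function_Algebras"
begin

section \<open>Differentiability classes on open subsets of Euclidean space\<close>

text \<open>The set is meant to be open. In finite dimension, being differentiable with all directional
  derivatives of class \<open>C\<^sup>k\<close> is the same as being of class \<open>C\<^sup>k\<^sup>+\<^sup>1\<close>.\<close>

primrec Ck_on :: "nat \<Rightarrow> ('a::euclidean_space \<Rightarrow> 'b::real_normed_vector) \<Rightarrow> 'a set \<Rightarrow> bool" where
  "Ck_on 0 h S \<longleftrightarrow> continuous_on S h"
| "Ck_on (Suc k) h S \<longleftrightarrow> (\<forall>x\<in>S. h differentiable (at x)) \<and>
     (\<forall>v. Ck_on k (\<lambda>x. frechet_derivative h (at x) v) S)"

definition Cr_on :: "enat \<Rightarrow> ('a::euclidean_space \<Rightarrow> 'b::real_normed_vector) \<Rightarrow> 'a set \<Rightarrow> bool" where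
  "Cr_on r h S \<longleftrightarrow> (\<forall>k. enat k \<le> r \<longrightarrow> Ck_on k h S)"

abbreviation smooth_on :: "('a::euclidean_space \<Rightarrow> 'b::real_normed_vector) \<Rightarrow> 'a set \<Rightarrow> bool" where
  "smooth_on \<equiv> Cr_on \<infinity>"


section \<open>Smooth closed manifolds\<close>

text \<open>The points of the manifold are all elements of the type \<open>'m\<close>; its dimension is the
  dimension of the model space \<open>'e\<close>. A chart is a pair of its domain and its coordinate map; the
  values of the coordinate map outside the domain are irrelevant.\<close>

type_synonym ('m, 'e) chart = "'m set \<times> ('m \<Rightarrow> 'e)"

definition chart_inv :: "('m, 'e) chart \<Rightarrow> 'e \<Rightarrow> 'm" where
  "chart_inv c = inv_into (fst c) (snd c)"

definition is_chart :: "('m::topological_space, 'e::euclidean_space) chart \<Rightarrow> bool" where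
  "is_chart c \<longleftrightarrow> open (fst c) \<and> open (snd c ` fst c) \<and>
     homeomorphism (fst c) (snd c ` fst c) (snd c) (chart_inv c)"

definition smooth_atlas :: "('m::topological_space, 'e::euclidean_space) chart set \<Rightarrow> bool" where
  "smooth_atlas A \<longleftrightarrow> (\<forall>c\<in>A. is_chart c) \<and> (\<Union>c\<in>A. fst c) = UNIV \<and>
     (\<forall>c\<in>A. \<forall>d\<in>A. smooth_on (snd d \<circ> chart_inv c) (snd c ` (fst c \<inter> fst d)))"

definition smooth_closed_manifold ::
    "('m::{t2_space,second_countable_topology}, 'e::euclidean_space) chart set \<Rightarrow> bool" where
  "smooth_closed_manifold A \<longleftrightarrow> smooth_atlas A \<and> compact (UNIV :: 'm set)"

definition Cr_map :: "('m::topological_space, 'e::euclidean_space) chart set \<Rightarrow> enat \<Rightarrow> ('m \<Rightarrow> 'm) \<Rightarrow> bool" where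
  "Cr_map A r f \<longleftrightarrow> continuous_on UNIV f \<and>
     (\<forall>c\<in>A. \<forall>d\<in>A. Cr_on r (snd d \<circ> f \<circ> chart_inv c) (snd c ` (fst c \<inter> f -` fst d)))"

text \<open>A \<open>k\<close>-dimensional topological submanifold is a subset which, with the subspace topology, is a
  topological manifold without boundary; no local flatness is required. (Hausdorffness and second
  countability are inherited from the ambient type.)\<close>

definition topological_submanifold :: "nat \<Rightarrow> 'm::{t2_space,second_countable_topology} set \<Rightarrow> bool" where
  "topological_submanifold k S \<longleftrightarrow>
     (\<forall>x\<in>S. \<exists>U V. x \<in> U \<and> openin (top_of_set S) U \<and> openin (Euclidean_space k) V \<and>
        top_of_set U homeomorphic_space subtopology (Euclidean_space k) V)"


section \<open>Tangent vectors\<close>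

text \<open>The pointwise real vector space structure on functions.\<close>

instantiation "fun" :: (type, real_vector) real_vector
begin

definition scaleR_fun :: "real \<Rightarrow> ('a \<Rightarrow> 'b) \<Rightarrow> 'a \<Rightarrow> 'b" where
  "scaleR_fun a v = (\<lambda>i. a *\<^sub>R v i)"

instance
  by standard (auto simp: scaleR_fun_def fun_eq_iff scaleR_add_right scaleR_add_left)

end

text \<open>A tangent vector at \<open>x\<close> is the family of its coordinate vectors in the charts around \<open>x\<close>,
  which transform by the derivatives of the transition maps. The family is \<open>0\<close> on everything that
  is not a chart around \<open>x\<close>. Thus tangent spaces are linear subspaces of the space of all functions
  from charts to \<open>'e\<close>, and the library notions \<open>subspace\<close>, \<open>span\<close>, \<open>dim\<close> apply to them.\<close>

type_synonym ('m, 'e) tvec = "('m, 'e) chart \<Rightarrow> 'e"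

definition charts_at :: "('m, 'e) chart set \<Rightarrow> 'm \<Rightarrow> ('m, 'e) chart set" where
  "charts_at A x = {c \<in> A. x \<in> fst c}"

definition tangent_space ::
    "('m::topological_space, 'e::euclidean_space) chart set \<Rightarrow> 'm \<Rightarrow> ('m, 'e) tvec set" where
  "tangent_space A x = {v.
     (\<forall>c\<in>charts_at A x. \<forall>d\<in>charts_at A x.
        v d = frechet_derivative (snd d \<circ> chart_inv c) (at (snd c x)) (v c)) \<and>
     (\<forall>c. c \<notin> charts_at A x \<longrightarrow> v c = 0)}"

text \<open>The tangent vector at \<open>x\<close> with coordinates \<open>u\<close> in the chart \<open>c\<close> around \<open>x\<close>.\<close>

definition coord_vec :: "('m::topological_space, 'e::euclidean_space) chart set \<Rightarrow>
    ('m, 'e) chart \<Rightarrow> 'm \<Rightarrow> 'e \<Rightarrow> ('m, 'e) tvec" where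
  "coord_vec A c x u = (\<lambda>d. if d \<in> charts_at A x
     then frechet_derivative (snd d \<circ> chart_inv c) (at (snd c x)) u else 0)"

text \<open>The derivative of \<open>f\<close> at \<open>x\<close> as a map between tangent spaces. By the chain rule the chosen
  chart at \<open>x\<close> does not matter.\<close>

definition tangent_map :: "('m::topological_space, 'e::euclidean_space) chart set \<Rightarrow>
    ('m \<Rightarrow> 'm) \<Rightarrow> 'm \<Rightarrow> ('m, 'e) tvec \<Rightarrow> ('m, 'e) tvec" where
  "tangent_map A f x v = (let c = (SOME c. c \<in> charts_at A x) in
     (\<lambda>d. if d \<in> charts_at A (f x)
        then frechet_derivative (snd d \<circ> f \<circ> chart_inv c) (at (snd c x)) (v c) else 0))"

definition regular_point :: "('m::topological_space, 'e::euclidean_space) chart set \<Rightarrow> ('m \<Rightarrow> 'm) \<Rightarrow> 'm \<Rightarrow> bool" where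
  "regular_point A f x \<longleftrightarrow> dim (tangent_map A f x ` tangent_space A x) = DIM('e)"


section \<open>Riemannian metrics and the induced distance\<close>

definition riemannian_metric :: "('m::topological_space, 'e::euclidean_space) chart set \<Rightarrow>
    ('m \<Rightarrow> ('m, 'e) tvec \<Rightarrow> ('m, 'e) tvec \<Rightarrow> real) \<Rightarrow> bool" where
  "riemannian_metric A g \<longleftrightarrow>
     (\<forall>x. \<forall>u\<in>tangent_space A x. \<forall>v\<in>tangent_space A x. \<forall>w\<in>tangent_space A x. \<forall>a.
        g x u v = g x v u \<and> g x (u + v) w = g x u w + g x v w \<and> g x (a *\<^sub>R u) w = a * g x u w) \<and>
     (\<forall>x. \<forall>v\<in>tangent_space A x. v \<noteq> 0 \<longrightarrow> g x v v > 0) \<and>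
     (\<forall>c\<in>A. \<forall>u w. smooth_on
        (\<lambda>p. g (chart_inv c p) (coord_vec A c (chart_inv c p) u) (coord_vec A c (chart_inv c p) w))
        (snd c ` fst c))"

definition tnorm :: "('m \<Rightarrow> ('m, 'e) tvec \<Rightarrow> ('m, 'e) tvec \<Rightarrow> real) \<Rightarrow> 'm \<Rightarrow> ('m, 'e) tvec \<Rightarrow> real" where
  "tnorm g x v = sqrt (g x v v)"

definition velocity :: "('m, 'e::euclidean_space) chart set \<Rightarrow> (real \<Rightarrow> 'm) \<Rightarrow> real \<Rightarrow> ('m, 'e) tvec" where
  "velocity A \<gamma> t = (\<lambda>c. if c \<in> charts_at A (\<gamma> t) then vector_derivative (snd c \<circ> \<gamma>) (at t) else 0)"

text \<open>Curves \<open>[0,1] \<rightarrow> M\<close> that are of class \<open>C\<^sup>1\<close> (one-sidedly at the end points) on every closed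
  subinterval having no break point in its interior.\<close>

definition piecewise_C1_curve ::
    "('m::topological_space, 'e::euclidean_space) chart set \<Rightarrow> (real \<Rightarrow> 'm) \<Rightarrow> bool" where
  "piecewise_C1_curve A \<gamma> \<longleftrightarrow> continuous_on {0..1} \<gamma> \<and>
     (\<exists>P. finite P \<and>
       (\<forall>a b. 0 \<le> a \<and> a < b \<and> b \<le> 1 \<and> {a<..<b} \<inter> P = {} \<longrightarrow>
         (\<forall>c\<in>A. \<exists>D. continuous_on ({a..b} \<inter> \<gamma> -` fst c) D \<and>
            (\<forall>t\<in>{a..b} \<inter> \<gamma> -` fst c. (snd c \<circ> \<gamma> has_vector_derivative D t) (at t within {a..b})))))"

definition curve_length :: "('m, 'e::euclidean_space) chart set \<Rightarrow>
    ('m \<Rightarrow> ('m, 'e) tvec \<Rightarrow> ('m, 'e) tvec \<Rightarrow> real) \<Rightarrow> (real \<Rightarrow> 'm) \<Rightarrow> ennreal" where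
  "curve_length A g \<gamma> = (\<integral>\<^sup>+t\<in>{0..1}. ennreal (tnorm g (\<gamma> t) (velocity A \<gamma> t)) \<partial>lborel)"

text \<open>The distance takes values in \<open>[0,\<infinity>]\<close> because the manifold need not be connected: it is \<open>\<infinity>\<close>
  exactly between points of different components.\<close>

definition riemannian_dist :: "('m::topological_space, 'e::euclidean_space) chart set \<Rightarrow>
    ('m \<Rightarrow> ('m, 'e) tvec \<Rightarrow> ('m, 'e) tvec \<Rightarrow> real) \<Rightarrow> 'm \<Rightarrow> 'm \<Rightarrow> ennreal" where
  "riemannian_dist A g x y =
     (INF \<gamma> \<in> {\<gamma>. piecewise_C1_curve A \<gamma> \<and> \<gamma> 0 = x \<and> \<gamma> 1 = y}. curve_length A g \<gamma>)"


section \<open>Orbits and hyperbolicity\<close>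

definition endomorphism :: "('m::topological_space, 'e::euclidean_space) chart set \<Rightarrow> enat \<Rightarrow> ('m \<Rightarrow> 'm) \<Rightarrow> bool" where
  "endomorphism A r f \<longleftrightarrow> 1 \<le> r \<and> Cr_map A r f \<and> surj f"

definition orbits :: "('m \<Rightarrow> 'm) \<Rightarrow> (int \<Rightarrow> 'm) set" where
  "orbits f = {\<xi>. \<forall>i. f (\<xi> i) = \<xi> (i + 1)}"

definition orbits_in :: "('m \<Rightarrow> 'm) \<Rightarrow> 'm set \<Rightarrow> (int \<Rightarrow> 'm) set" where
  "orbits_in f \<Lambda> = {\<xi> \<in> orbits f. \<forall>i. \<xi> i \<in> \<Lambda>}"

text \<open>The \<open>i\<close>-th iterate of the shift homeomorphism on the space of orbits.\<close>

definition shift :: "int \<Rightarrow> (int \<Rightarrow> 'm) \<Rightarrow> (int \<Rightarrow> 'm)" where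
  "shift i \<xi> = (\<lambda>j. \<xi> (j + i))"

text \<open>A field \<open>E\<close> of subspaces, where \<open>E \<xi>\<close> is a subspace of the tangent space at \<open>\<xi> 0\<close>, is
  continuous over a set \<open>X\<close> of orbits (with the product topology) if it has local continuous frames.\<close>

definition continuous_subspace_field :: "('m::topological_space, 'e::euclidean_space) chart set \<Rightarrow>
    (int \<Rightarrow> 'm) set \<Rightarrow> ((int \<Rightarrow> 'm) \<Rightarrow> ('m, 'e) tvec set) \<Rightarrow> bool" where
  "continuous_subspace_field A X E \<longleftrightarrow>
     (\<forall>\<xi>\<in>X. \<exists>W (k::nat) e. \<xi> \<in> W \<and> openin (top_of_set X) W \<and>
        (\<forall>\<eta>\<in>W. E \<eta> = span ((\<lambda>j. e j \<eta>) ` {..<k}) \<and> dim (E \<eta>) = k) \<and>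
        (\<forall>j<k. \<forall>c\<in>A. continuous_on {\<eta>\<in>W. \<eta> 0 \<in> fst c} (\<lambda>\<eta>. e j \<eta> c)))"

text \<open>The fields \<open>Es\<close>, \<open>Eu\<close> are only constrained at the orbits \<open>shift i \<xi>\<close>: the subspaces
  \<open>Es (shift i \<xi>)\<close> and \<open>Eu (shift i \<xi>)\<close> of the tangent space at \<open>\<xi> i\<close> form the hyperbolic splitting
  along the orbit \<open>\<xi>\<close>.\<close>

definition hyperbolic_splitting_const :: "('m::topological_space, 'e::euclidean_space) chart set \<Rightarrow>
    ('m \<Rightarrow> ('m, 'e) tvec \<Rightarrow> ('m, 'e) tvec \<Rightarrow> real) \<Rightarrow> ('m \<Rightarrow> 'm) \<Rightarrow> real \<Rightarrow> real \<Rightarrow> (int \<Rightarrow> 'm) \<Rightarrow>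
    ((int \<Rightarrow> 'm) \<Rightarrow> ('m, 'e) tvec set) \<Rightarrow> ((int \<Rightarrow> 'm) \<Rightarrow> ('m, 'e) tvec set) \<Rightarrow> bool" where
  "hyperbolic_splitting_const A g f C \<kappa> \<xi> Es Eu \<longleftrightarrow>
     continuous_subspace_field A (range (\<lambda>i. shift i \<xi>)) Es \<and>
     continuous_subspace_field A (range (\<lambda>i. shift i \<xi>)) Eu \<and>
     (\<forall>i. subspace (Es (shift i \<xi>)) \<and> subspace (Eu (shift i \<xi>)) \<and>
        Es (shift i \<xi>) \<inter> Eu (shift i \<xi>) = {0} \<and>
        {u + v | u v. u \<in> Es (shift i \<xi>) \<and> v \<in> Eu (shift i \<xi>)} = tangent_space A (\<xi> i) \<and>
        tangent_map A f (\<xi> i) ` Es (shift i \<xi>) = Es (shift (i + 1) \<xi>) \<and>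
        tangent_map A f (\<xi> i) ` Eu (shift i \<xi>) = Eu (shift (i + 1) \<xi>) \<and>
        (\<forall>k. \<forall>v\<in>Es (shift i \<xi>).
           tnorm g ((f ^^ k) (\<xi> i)) (tangent_map A (f ^^ k) (\<xi> i) v) \<le> C * \<kappa> ^ k * tnorm g (\<xi> i) v) \<and>
        (\<forall>k. \<forall>v\<in>Eu (shift i \<xi>).
           tnorm g ((f ^^ k) (\<xi> i)) (tangent_map A (f ^^ k) (\<xi> i) v) \<ge> (1 / C) * (1 / \<kappa>) ^ k * tnorm g (\<xi> i) v))"

text \<open>On a compact manifold the splitting along a given orbit, if it exists, is uniquely determined
  and does not depend on the constants.\<close>

definition hyperbolic_splitting :: "('m::topological_space, 'e::euclidean_space) chart set \<Rightarrow>
    ('m \<Rightarrow> ('m, 'e) tvec \<Rightarrow> ('m, 'e) tvec \<Rightarrow> real) \<Rightarrow> ('m \<Rightarrow> 'm) \<Rightarrow> (int \<Rightarrow> 'm) \<Rightarrow>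
    ((int \<Rightarrow> 'm) \<Rightarrow> ('m, 'e) tvec set) \<Rightarrow> ((int \<Rightarrow> 'm) \<Rightarrow> ('m, 'e) tvec set) \<Rightarrow> bool" where
  "hyperbolic_splitting A g f \<xi> Es Eu \<longleftrightarrow>
     (\<exists>C \<kappa>. C > 0 \<and> 0 < \<kappa> \<and> \<kappa> < 1 \<and> hyperbolic_splitting_const A g f C \<kappa> \<xi> Es Eu)"

definition hyperbolic_set :: "('m::topological_space, 'e::euclidean_space) chart set \<Rightarrow>
    ('m \<Rightarrow> ('m, 'e) tvec \<Rightarrow> ('m, 'e) tvec \<Rightarrow> real) \<Rightarrow> ('m \<Rightarrow> 'm) \<Rightarrow> 'm set \<Rightarrow> bool" where
  "hyperbolic_set A g f \<Lambda> \<longleftrightarrow> closed \<Lambda> \<and> f ` \<Lambda> = \<Lambda> \<and>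
     (\<exists>C \<kappa>. C > 0 \<and> 0 < \<kappa> \<and> \<kappa> < 1 \<and>
        (\<forall>\<xi>\<in>orbits_in f \<Lambda>. \<exists>Es Eu. hyperbolic_splitting_const A g f C \<kappa> \<xi> Es Eu))"


section \<open>A-endomorphisms, basic sets, repellers\<close>

definition nonwandering_set :: "('m::topological_space \<Rightarrow> 'm) \<Rightarrow> 'm set" where
  "nonwandering_set f = {x. \<forall>U. open U \<and> x \<in> U \<longrightarrow> (\<exists>k\<ge>1. (f ^^ k) ` U \<inter> U \<noteq> {})}"

definition periodic_points :: "('m \<Rightarrow> 'm) \<Rightarrow> 'm set" where
  "periodic_points f = {x. \<exists>k\<ge>1. (f ^^ k) x = x}"

definition A_endomorphism :: "('m::topological_space, 'e::euclidean_space) chart set \<Rightarrow>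
    ('m \<Rightarrow> ('m, 'e) tvec \<Rightarrow> ('m, 'e) tvec \<Rightarrow> real) \<Rightarrow> enat \<Rightarrow> ('m \<Rightarrow> 'm) \<Rightarrow> bool" where
  "A_endomorphism A g r f \<longleftrightarrow> endomorphism A r f \<and>
     hyperbolic_set A g f (nonwandering_set f) \<and>
     (\<forall>x\<in>nonwandering_set f. regular_point A f x) \<and>
     nonwandering_set f \<subseteq> closure (periodic_points f)"

definition transitive_on :: "('m::topological_space \<Rightarrow> 'm) \<Rightarrow> 'm set \<Rightarrow> bool" where
  "transitive_on f \<Lambda> \<longleftrightarrow>
     (\<forall>U V. openin (top_of_set \<Lambda>) U \<and> openin (top_of_set \<Lambda>) V \<and> U \<noteq> {} \<and> V \<noteq> {} \<longrightarrow>
        (\<exists>k. (f ^^ k) ` U \<inter> V \<noteq> {}))"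

text \<open>Without disjointness of the members the decomposition would not be unique.\<close>

definition spectral_decomposition :: "('m::topological_space \<Rightarrow> 'm) \<Rightarrow> 'm set set \<Rightarrow> bool" where
  "spectral_decomposition f \<B> \<longleftrightarrow> finite \<B> \<and> \<Union>\<B> = nonwandering_set f \<and> disjoint \<B> \<and>
     (\<forall>\<Lambda>\<in>\<B>. \<Lambda> \<noteq> {} \<and> closed \<Lambda> \<and> f ` \<Lambda> = \<Lambda> \<and> transitive_on f \<Lambda>)"

definition basic_set :: "('m::topological_space \<Rightarrow> 'm) \<Rightarrow> 'm set \<Rightarrow> bool" where
  "basic_set f \<Lambda> \<longleftrightarrow> (\<exists>\<B>. spectral_decomposition f \<B> \<and> \<Lambda> \<in> \<B>)"

definition has_type :: "('m::topological_space, 'e::euclidean_space) chart set \<Rightarrow>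
    ('m \<Rightarrow> ('m, 'e) tvec \<Rightarrow> ('m, 'e) tvec \<Rightarrow> real) \<Rightarrow> ('m \<Rightarrow> 'm) \<Rightarrow> 'm set \<Rightarrow> nat \<times> nat \<Rightarrow> bool" where
  "has_type A g f \<Lambda> p \<longleftrightarrow>
     (\<forall>\<xi>\<in>orbits_in f \<Lambda>. \<forall>Es Eu. hyperbolic_splitting A g f \<xi> Es Eu \<longrightarrow> (dim (Eu \<xi>), dim (Es \<xi>)) = p)"

definition repeller :: "('m::topological_space \<Rightarrow> 'm) \<Rightarrow> 'm set \<Rightarrow> bool" where
  "repeller f \<Lambda> \<longleftrightarrow> basic_set f \<Lambda> \<and>
     (\<exists>U. open U \<and> \<Lambda> \<subseteq> U \<and> closure U \<subseteq> f ` U \<and> (\<Inter>k. (f ^^ k) -` U) = \<Lambda>)"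

text \<open>In \<open>adapted_metric A g f \<Lambda> h\<close>, \<open>g\<close> is the original metric and \<open>h\<close> the adapted one.\<close>

definition adapted_metric :: "('m::topological_space, 'e::euclidean_space) chart set \<Rightarrow>
    ('m \<Rightarrow> ('m, 'e) tvec \<Rightarrow> ('m, 'e) tvec \<Rightarrow> real) \<Rightarrow> ('m \<Rightarrow> 'm) \<Rightarrow> 'm set \<Rightarrow>
    ('m \<Rightarrow> ('m, 'e) tvec \<Rightarrow> ('m, 'e) tvec \<Rightarrow> real) \<Rightarrow> bool" where
  "adapted_metric A g f \<Lambda> h \<longleftrightarrow> riemannian_metric A h \<and>
     (\<exists>K>0. \<forall>x. \<forall>v\<in>tangent_space A x. tnorm h x v \<le> K * tnorm g x v \<and> tnorm g x v \<le> K * tnorm h x v) \<and>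
     (\<exists>\<kappa>. 0 < \<kappa> \<and> \<kappa> < 1 \<and>
        (\<forall>\<xi>\<in>orbits_in f \<Lambda>. \<forall>Es Eu. hyperbolic_splitting A g f \<xi> Es Eu \<longrightarrow>
           (\<forall>i. (\<forall>v\<in>Es (shift i \<xi>). tnorm h (\<xi> (i + 1)) (tangent_map A f (\<xi> i) v) \<le> \<kappa> * tnorm h (\<xi> i) v) \<and>
                (\<forall>v\<in>Eu (shift i \<xi>). tnorm h (\<xi> (i + 1)) (tangent_map A f (\<xi> i) v) \<ge> (1 / \<kappa>) * tnorm h (\<xi> i) v))))"

definition metrically_expanding_on :: "('m \<Rightarrow> 'm \<Rightarrow> ennreal) \<Rightarrow> ('m \<Rightarrow> 'm) \<Rightarrow> 'm set \<Rightarrow> bool" where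
  "metrically_expanding_on \<rho> f \<Lambda> \<longleftrightarrow>
     (\<exists>\<epsilon> \<mu> :: real. \<epsilon> > 0 \<and> \<mu> > 1 \<and>
        (\<forall>x\<in>\<Lambda>. \<forall>y\<in>\<Lambda>. x \<noteq> y \<and> \<rho> x y < ennreal \<epsilon> \<longrightarrow> \<rho> (f x) (f y) > ennreal \<mu> * \<rho> x y))"

end

(* On a basic set of type (n,0) the stable spaces vanish, so the adapted metric is expanded by Df on
   all of T_x M for x in Lambda, by a factor 1/kappa > 1; by continuity it is expanded by a smaller
   factor mu > 1 near Lambda, where f is a local diffeomorphism.  Short curves stay in small
   neighbourhoods, hence a short curve through f(y), with y near Lambda, lifts through the local inverse
   of f to a curve through y that is shorter by the factor mu.  Lifting almost minimal curves between
   f(x) and f(y) gives the metric expansion on Lambda.  For the repeller, U is the s-neighbourhood of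
   Lambda.  Lifting curves that start in Lambda gives cl U <= f(U).  By invariance of domain f restricted
   to the submanifold Lambda is open, so Lambda = f^{-1}(Lambda) near Lambda; lifting a curve from Lambda
   to f(y) backwards from its end point therefore gives a curve that starts in Lambda again, and
   dist(y, Lambda) <= dist(f(y), Lambda) / mu.  So only points of Lambda can stay in U for ever. *)

theory Submission
  imports Defs "HOL-Homology.Invariance_of_Domain"
begin

text \<open>The distance is an infimum of lengths of piecewise C1 curves, so every metric claim is
  reduced to lifting one curve at a time. A lift is never continued along the curve: a curve through
  f(y) that is shorter than a uniform \<delta> stays inside the image f(W) of one injective branch,
  and the inverse of that branch is applied to the whole curve. What shapes the constants is that
  lifting must be possible at every point of U, while the lifted curves must remain where only
  points of \<Lambda> are mapped into \<Lambda>. Hence two nested neighbourhoods: V, on which f(y)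
  in \<Lambda> forces y in \<Lambda>, and N, at whose points short curves lift into V. The radius s
  is so small that U lies in N and that curves of length \<mu> s, long enough to reach every closure
  point of U, still lift. Two strict gaps are spent: \<mu> lies below 1/\<kappa> so that expansion
  on \<Lambda> survives on a neighbourhood, and the final metric rate lies below \<mu> because an
  infimum yields only a weak inequality.\<close>

section \<open>Derivatives and lifts in Euclidean space\<close>

text \<open>If the right-hand side is infinite there is nothing to show. Otherwise the derivative is
  Lebesgue integrable, and its integral agrees with the gauge integral for which the fundamental
  theorem of calculus tolerates finitely many exceptional points.\<close>

lemma norm_diff_le_nn_integral:
  fixes \<sigma> :: "real \<Rightarrow> 'e::euclidean_space"
  assumes "a \<le> b" and cont: "continuous_on {a..b} \<sigma>" and P: "finite P"
    and der: "\<And>t. t \<in> {a<..<b} - P \<Longrightarrow> (\<sigma> has_vector_derivative D t) (at t)"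
    and contD: "continuous_on ({a<..<b} - P) D"
  shows "ennreal (norm (\<sigma> b - \<sigma> a)) \<le> (\<integral>\<^sup>+t\<in>{a<..<b} - P. ennreal (norm (D t)) \<partial>lborel)"
proof -
  define S where "S = {a<..<b} - P"
  define F where "F t = indicator S t *\<^sub>R D t" for t
  have opS: "open S"
    unfolding S_def using P by (intro open_Diff finite_imp_closed) auto
  have meas: "F \<in> borel_measurable lborel"
    unfolding F_def using borel_measurable_continuous_on_indicator[of S D] opS contD
    by (simp add: S_def)
  have eq: "(\<integral>\<^sup>+t\<in>{a<..<b} - P. ennreal (norm (D t)) \<partial>lborel) = (\<integral>\<^sup>+t. ennreal (norm (F t)) \<partial>lborel)"
    unfolding F_def S_def by (intro nn_integral_cong) (auto simp: indicator_def)
  show ?thesis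
  proof (cases "(\<integral>\<^sup>+t. ennreal (norm (F t)) \<partial>lborel) = \<infinity>")
    case True
    then show ?thesis by (simp add: eq)
  next
    case False
    then have int: "integrable lborel F"
      using meas by (intro integrableI_bounded) (auto simp: top.not_eq_extremum)
    have "(D has_integral (\<sigma> b - \<sigma> a)) {a..b}"
      using P \<open>a \<le> b\<close> der cont by (intro fundamental_theorem_of_calculus_interior_strong[of P]) auto
    then have "(F has_integral (\<sigma> b - \<sigma> a)) {a..b}"
      using P by (rule_tac has_integral_spike_finite[of "P \<union> {a,b}" _ _ D])
        (auto simp: F_def S_def indicator_def)
    then have "(F has_integral (\<sigma> b - \<sigma> a)) UNIV"
      by (rule has_integral_on_superset) (auto simp: F_def S_def)
    then have "integral\<^sup>L lborel F = \<sigma> b - \<sigma> a"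
      using has_integral_integral_lborel[OF int] has_integral_unique by blast
    then show ?thesis
      using integral_norm_bound_ennreal[OF int] by (simp add: eq)
  qed
qed

text \<open>Expanding \<open>u\<close> in the basis writes \<open>L x u\<close> as a finite sum of
  products of continuous functions, so continuity in \<open>x\<close> for each fixed vector is
  already joint continuity.\<close>

lemma continuous_on_linear_family:
  fixes L :: "'a::topological_space \<Rightarrow> 'e::euclidean_space \<Rightarrow> 'b::real_normed_vector"
  assumes "\<And>v. continuous_on S (\<lambda>x. L x v)" and "\<And>x. x \<in> S \<Longrightarrow> linear (L x)"
  shows "continuous_on (S \<times> UNIV) (\<lambda>(x, u). L x u)"
proof -
  have "L x u = (\<Sum>b\<in>Basis. (u \<bullet> b) *\<^sub>R L x b)" if "x \<in> S" for x u
  proof -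
    interpret linear "L x" using assms(2) that .
    have "L x u = L x (\<Sum>b\<in>Basis. (u \<bullet> b) *\<^sub>R b)"
      by (simp add: euclidean_representation)
    then show ?thesis by (simp add: sum scale)
  qed
  then have "continuous_on (S \<times> UNIV) (\<lambda>p. L (fst p) (snd p)) \<longleftrightarrow>
    continuous_on (S \<times> UNIV) (\<lambda>p. \<Sum>b\<in>Basis. (snd p \<bullet> b) *\<^sub>R L (fst p) b)"
    by (intro continuous_on_cong) auto
  moreover have "continuous_on (S \<times> (UNIV::'e set)) (\<lambda>p. L (fst p) v)" for v
    by (rule continuous_on_compose2[OF assms(1)]) (auto intro: continuous_on_fst continuous_on_id)
  ultimately show ?thesis
    by (auto simp: case_prod_unfold intro!: continuous_intros)
qed

text \<open>The tube lemma. It spreads strict inequalities, known on the unit sphere of one tangent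
  space, to all nearby base points.\<close>

lemma eventually_pos_on_compact:
  fixes \<Phi> :: "'a::topological_space \<Rightarrow> 'b::topological_space \<Rightarrow> real"
  assumes cont: "continuous_on (S \<times> UNIV) (\<lambda>(x, u). \<Phi> x u)"
    and "open S" "a \<in> S" "compact K" and pos: "\<And>u. u \<in> K \<Longrightarrow> \<Phi> a u > 0"
  obtains U where "open U" "a \<in> U" "U \<subseteq> S" "\<And>x u. x \<in> U \<Longrightarrow> u \<in> K \<Longrightarrow> \<Phi> x u > 0"
proof -
  have "open (S \<times> (UNIV::'b set))" using \<open>open S\<close> by (simp add: open_Times)
  then have op: "open ((\<lambda>(x, u). \<Phi> x u) -` {0<..} \<inter> S \<times> UNIV)"
    using cont by (simp add: continuous_on_open_vimage)
  have "{a} \<times> K \<subseteq> (\<lambda>(x, u). \<Phi> x u) -` {0<..} \<inter> S \<times> UNIV"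
    using pos \<open>a \<in> S\<close> by auto
  from Elementary_Topology.tube_lemma[OF \<open>compact K\<close> op this] obtain X where
    "a \<in> X" "open X" "X \<times> K \<subseteq> (\<lambda>(x, u). \<Phi> x u) -` {0<..} \<inter> S \<times> UNIV" by blast
  then show ?thesis
    using that[of "X \<inter> S"] \<open>open S\<close> \<open>a \<in> S\<close> by (auto simp: subset_iff)
qed

text \<open>In finite dimension the operator norm is bounded by the sum of the norms of the images
  of the basis vectors, so pointwise continuity of the derivative is continuity in operator
  norm.\<close>

lemma onorm_derivative_continuous:
  fixes F' :: "'a::euclidean_space \<Rightarrow> 'b::euclidean_space \<Rightarrow> 'c::real_normed_vector"
  assumes "open S" "a \<in> S"
    and cont: "\<And>v. continuous_on S (\<lambda>x. F' x v)" and lin: "\<And>x. x \<in> S \<Longrightarrow> bounded_linear (F' x)"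
    and "e > 0"
  shows "\<exists>d>0. \<forall>x. dist a x < d \<longrightarrow> x \<in> S \<and> onorm (\<lambda>v. F' x v - F' a v) < e"
proof -
  have "continuous_on S (\<lambda>x. \<Sum>b\<in>Basis. norm (F' x b - F' a b))"
    by (intro continuous_intros cont)
  then have "isCont (\<lambda>x. \<Sum>b\<in>Basis. norm (F' x b - F' a b)) a"
    using assms(1,2) continuous_on_eq_continuous_at by blast
  then have "((\<lambda>x. \<Sum>b\<in>Basis. norm (F' x b - F' a b)) \<longlongrightarrow> 0) (at a)"
    by (simp add: isCont_def)
  then have "\<forall>\<^sub>F x in at a. (\<Sum>b\<in>Basis. norm (F' x b - F' a b)) < e"
    using \<open>e > 0\<close> by (rule order_tendstoD)
  then obtain d where "d > 0" and d: "\<And>x. x \<noteq> a \<Longrightarrow> dist x a < d \<Longrightarrow> (\<Sum>b\<in>Basis. norm (F' x b - F' a b)) < e"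
    by (auto simp: eventually_at)
  obtain d' where "d' > 0" and d': "ball a d' \<subseteq> S"
    using assms(1,2) open_contains_ball by blast
  have "x \<in> S \<and> onorm (\<lambda>v. F' x v - F' a v) < e" if "dist a x < min d d'" for x
  proof -
    have "x \<in> S" using that d' by auto
    then have "onorm (\<lambda>v. F' x v - F' a v) \<le> (\<Sum>b\<in>Basis. norm (F' x b - F' a b))"
      using lin \<open>a \<in> S\<close> by (intro onorm_componentwise bounded_linear_sub) auto
    also have "\<dots> < e" using d[of x] that \<open>e > 0\<close> by (cases "x = a") (auto simp: dist_commute)
    finally show ?thesis using \<open>x \<in> S\<close> by simp
  qed
  then show ?thesis using \<open>d > 0\<close> \<open>d' > 0\<close> by (intro exI[of _ "min d d'"]) simp
qed

text \<open>Only the injectivity part of the inverse function theorem is taken from the derivative;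
  openness of images and continuity of inverses come from invariance of domain.\<close>

lemma locally_injective_C1:
  fixes F :: "'e::euclidean_space \<Rightarrow> 'e"
  assumes "open S" "a \<in> S" and der: "\<And>x. x \<in> S \<Longrightarrow> (F has_derivative F' x) (at x)"
    and cont: "\<And>v. continuous_on S (\<lambda>x. F' x v)" and inj: "\<And>u. F' a u = 0 \<Longrightarrow> u = 0"
  obtains r where "r > 0" "ball a r \<subseteq> S" "inj_on F (ball a r)"
proof -
  have lin: "linear (F' a)" using der[OF \<open>a \<in> S\<close>] has_derivative_linear by blast
  then have "inj (F' a)" using inj by (simp add: linear_injective_0)
  then obtain g where g: "linear g" "g \<circ> F' a = id" using lin linear_injective_left_inverse by blast
  have bl: "bounded_linear (F' x)" if "x \<in> S" for x
    using der[OF that] has_derivative_bounded_linear by blast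
  show ?thesis
  proof (rule has_derivative_locally_injective[OF \<open>a \<in> S\<close> \<open>open S\<close> _ g(2) der])
    show "bounded_linear g" using g(1) by (simp add: linear_conv_bounded_linear)
    show "\<exists>d>0. \<forall>x. dist a x < d \<longrightarrow> onorm (\<lambda>v. F' x v - F' a v) < e" if "e > 0" for e
      using onorm_derivative_continuous[OF assms(1,2) cont bl that] by blast
  qed (use that in auto)
qed

text \<open>Near \<open>t\<close> the curve \<tau> is the local inverse of \<open>F\<close> applied
  to \<open>F \<circ> \<tau>\<close>, and the local inverse is differentiable because
  \<open>L\<close> is invertible. The derivative is taken within \<open>I\<close> so that end points
  of intervals are included.\<close>

lemma lift_has_vector_derivative:
  fixes F :: "'e::euclidean_space \<Rightarrow> 'e"
  assumes "open W" and contF: "continuous_on W F" and injF: "inj_on F W"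
    and der: "(F has_derivative L) (at (\<tau> t))" and inj: "\<And>u. L u = 0 \<Longrightarrow> u = 0"
    and \<tau>: "continuous (at t within I) \<tau>" "\<tau> t \<in> W" "t \<in> I"
    and D: "((F \<circ> \<tau>) has_vector_derivative D) (at t within I)"
  obtains w where "L w = D" "(\<tau> has_vector_derivative w) (at t within I)"
proof -
  have lin: "linear L" using der has_derivative_linear by blast
  have injL: "inj L" using inj lin by (simp add: linear_injective_0)
  then obtain g' where g': "linear g'" "g' \<circ> L = id" using lin linear_injective_left_inverse by blast
  have surj: "L (g' v) = v" for v
  proof -
    obtain u where "v = L u" using linear_injective_imp_surjective[OF lin injL] by (auto simp: surj_def)
    then show ?thesis using g'(2) by (simp add: fun_eq_iff)
  qed
  obtain g where g: "homeomorphism W (F ` W) F g"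
    by (rule invariance_of_domain_homeomorphism[OF \<open>open W\<close> contF order_refl injF])
  have opF: "open (F ` W)" using invariance_of_domain[OF contF \<open>open W\<close> injF] .
  have gF: "g (F x) = x" if "x \<in> W" for x using g that by (simp add: homeomorphism_def)
  have Fg: "F (g y) = y" if "y \<in> F ` W" for y using g that by (auto simp: homeomorphism_def)
  have contg: "isCont g (F (\<tau> t))"
    using homeomorphism_cont2[OF g] opF \<tau>(2) continuous_on_eq_continuous_at by blast
  have dg': "(g has_derivative g') (at (F (\<tau> t)))"
    by (rule has_derivative_inverse_basic_x[OF der g'(1)[unfolded linear_conv_bounded_linear]
          g'(2) contg gF[OF \<tau>(2)] opF imageI[OF \<tau>(2)] Fg])
  have dg: "((g \<circ> (F \<circ> \<tau>)) has_vector_derivative g' D) (at t within I)"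
    by (rule vector_derivative_diff_chain_within[OF D]) (simp add: has_derivative_at_withinI[OF dg'])
  have "\<forall>\<^sub>F s in at t within I. \<tau> s \<in> W"
    using topological_tendstoD[OF \<tau>(1)[unfolded continuous_within] \<open>open W\<close> \<tau>(2)] .
  then have "\<forall>\<^sub>F s in at t within I. (g \<circ> (F \<circ> \<tau>)) s = \<tau> s"
    by eventually_elim (auto simp: gF)
  moreover have "(g \<circ> (F \<circ> \<tau>)) t = \<tau> t" using \<tau>(2) gF by simp
  ultimately have "(\<tau> has_vector_derivative g' D) (at t within I)"
    unfolding has_vector_derivative_def
    by (rule has_derivative_transform_eventually[OF dg[unfolded has_vector_derivative_def]])
      (use \<open>t \<in> I\<close> in simp)
  then show ?thesis using that surj by blast
qed

text \<open>Near \<open>\<tau> t\<close> the maps \<open>L\<close> are uniformly bounded below, which turns the continuity of \<open>D\<close>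
  into that of \<open>w\<close>.\<close>

lemma lift_derivative_continuous:
  fixes L :: "'e::euclidean_space \<Rightarrow> 'e \<Rightarrow> 'e" and T :: "real set"
  assumes "open S" and \<tau>: "continuous_on T \<tau>" "\<tau> ` T \<subseteq> S"
    and contL: "\<And>v. continuous_on S (\<lambda>x. L x v)" and lin: "\<And>x. x \<in> S \<Longrightarrow> linear (L x)"
    and inj: "\<And>x u. x \<in> S \<Longrightarrow> L x u = 0 \<Longrightarrow> u = 0"
    and w: "\<And>t. t \<in> T \<Longrightarrow> L (\<tau> t) (w t) = D t" and contD: "continuous_on T D"
  shows "continuous_on T w"
proof (clarsimp simp: continuous_on_eq_continuous_within)
  fix t assume "t \<in> T"
  have "\<tau> t \<in> S" using \<open>t \<in> T\<close> \<tau>(2) by blast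
  have bl: "bounded_linear (L x)" if "x \<in> S" for x
    using lin[OF that] by (simp add: linear_conv_bounded_linear)
  have "inj (L (\<tau> t))"
    using inj[OF \<open>\<tau> t \<in> S\<close>] linear_injective_0[OF lin[OF \<open>\<tau> t \<in> S\<close>]] by blast
  then obtain B where "B > 0" and B: "\<And>v. B * norm v \<le> norm (L (\<tau> t) v)"
    using linear_inj_bounded_below_pos[OF lin[OF \<open>\<tau> t \<in> S\<close>]] by blast
  \<comment> \<open>A perturbation of operator norm less than \<open>B / 2\<close> leaves the lower
    bound \<open>B / 2\<close> for the maps \<open>L x\<close>.\<close>
  obtain d where "d > 0" and
    d: "\<And>x. dist (\<tau> t) x < d \<Longrightarrow> x \<in> S \<and> onorm (\<lambda>v. L x v - L (\<tau> t) v) < B / 2"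
    using onorm_derivative_continuous[OF \<open>open S\<close> \<open>\<tau> t \<in> S\<close> contL bl, of "B / 2"] \<open>B > 0\<close> by auto
  have lb: "B / 2 * norm v \<le> norm (L x v)" if "dist (\<tau> t) x < d" for x v
  proof -
    have "x \<in> S" using d[OF that] by blast
    have "norm (L x v - L (\<tau> t) v) \<le> onorm (\<lambda>v. L x v - L (\<tau> t) v) * norm v"
      using onorm[OF bounded_linear_sub[OF bl[OF \<open>x \<in> S\<close>] bl[OF \<open>\<tau> t \<in> S\<close>]]] .
    also have "\<dots> \<le> B / 2 * norm v"
      using d[OF that] by (intro mult_right_mono) auto
    finally show ?thesis
      using B[of v] norm_triangle_ineq2[of "L (\<tau> t) v" "L x v"] by (simp add: norm_minus_commute)
  qed
  have \<tau>t: "(\<tau> \<longlongrightarrow> \<tau> t) (at t within T)"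
    using \<tau>(1) \<open>t \<in> T\<close> by (simp add: continuous_on)
  have "\<forall>\<^sub>F s in at t within T. dist (\<tau> t) (\<tau> s) < d"
    using tendstoD[OF \<tau>t \<open>d > 0\<close>] by (simp add: dist_commute)
  moreover have "\<forall>\<^sub>F s in at t within T. s \<in> T" by (simp add: eventually_at_filter)
  \<comment> \<open>By linearity \<open>L (\<tau> s) (w s - w t)\<close> equals
    \<open>D s - L (\<tau> s) (w t)\<close>; this tends to
    \<open>D t - L (\<tau> t) (w t) = 0\<close>, and the lower bound carries the limit over to
    \<open>w s - w t\<close>.\<close>
  ultimately have ev: "\<forall>\<^sub>F s in at t within T. norm (w s - w t) \<le> 2 / B * norm (D s - L (\<tau> s) (w t))"
  proof eventually_elim
    case (elim s)
    interpret linear "L (\<tau> s)" using lin d[OF elim(1)] by blast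
    have "B / 2 * norm (w s - w t) \<le> norm (D s - L (\<tau> s) (w t))"
      using lb[OF elim(1), of "w s - w t"] w[OF elim(2)] by (simp add: diff)
    then show ?case using \<open>B > 0\<close> by (simp add: field_simps)
  qed
  have "((\<lambda>x. L x (w t)) \<longlongrightarrow> L (\<tau> t) (w t)) (at (\<tau> t))"
    using contL \<open>open S\<close> \<open>\<tau> t \<in> S\<close> by (auto simp: continuous_on_eq_continuous_at isCont_def)
  then have "((\<lambda>s. L (\<tau> s) (w t)) \<longlongrightarrow> L (\<tau> t) (w t)) (at t within T)"
    using \<tau>t isCont_tendsto_compose[of "\<tau> t" "\<lambda>x. L x (w t)"] by (simp add: isCont_def)
  then have "((\<lambda>s. D s - L (\<tau> s) (w t)) \<longlongrightarrow> 0) (at t within T)"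
    using tendsto_diff[of D "D t" "at t within T" "\<lambda>s. L (\<tau> s) (w t)" "D t"] contD \<open>t \<in> T\<close> w[OF \<open>t \<in> T\<close>]
    by (simp add: continuous_on)
  then have "((\<lambda>s. 2 / B * norm (D s - L (\<tau> s) (w t))) \<longlongrightarrow> 0) (at t within T)"
    by (intro tendsto_mult_right_zero tendsto_norm_zero)
  then have "((\<lambda>s. w s - w t) \<longlongrightarrow> 0) (at t within T)"
    using ev by (rule Lim_null_comparison[rotated])
  then show "continuous (at t within T) w"
    unfolding continuous_within by (rule LIM_zero_cancel)
qed

section \<open>Charts, tangent vectors and speed of curves\<close>

lemma Cr_on_continuous: "Cr_on r h S \<Longrightarrow> continuous_on S h"
  unfolding Cr_on_def by (metis Ck_on.simps(1) zero_enat_def zero_le)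

lemma Cr_on_C1:
  assumes "Cr_on r h S" "1 \<le> r"
  shows "x \<in> S \<Longrightarrow> h differentiable (at x)"
    and "continuous_on S (\<lambda>x. frechet_derivative h (at x) v)"
proof -
  have "Ck_on (Suc 0) h S" using assms unfolding Cr_on_def by (simp only: one_enat_def One_nat_def)
  then show "x \<in> S \<Longrightarrow> h differentiable (at x)"
    and "continuous_on S (\<lambda>x. frechet_derivative h (at x) v)" by simp_all
qed

lemma frechet_derivative_linear:
  "h differentiable (at x) \<Longrightarrow> linear (frechet_derivative h (at x))"
  using frechet_derivative_works has_derivative_linear by blast

locale atlas =
  fixes A :: "('m::t2_space, 'e::euclidean_space) chart set"
  assumes atlas: "smooth_atlas A"
begin

lemma is_chart: "c \<in> A \<Longrightarrow> is_chart c"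
  using atlas by (simp add: smooth_atlas_def)

lemma open_chart_domain: "c \<in> A \<Longrightarrow> open (fst c)"
  using is_chart by (auto simp: is_chart_def)

lemma open_chart_image: "c \<in> A \<Longrightarrow> open (snd c ` fst c)"
  using is_chart by (auto simp: is_chart_def)

lemma chart_homeomorphism: "c \<in> A \<Longrightarrow> homeomorphism (fst c) (snd c ` fst c) (snd c) (chart_inv c)"
  using is_chart by (auto simp: is_chart_def)

lemma chart_inv_chart [simp]: "c \<in> A \<Longrightarrow> x \<in> fst c \<Longrightarrow> chart_inv c (snd c x) = x"
  using chart_homeomorphism homeomorphism_apply1 by fastforce

lemma chart_chart_inv: "c \<in> A \<Longrightarrow> q \<in> snd c ` fst c \<Longrightarrow> snd c (chart_inv c q) = q"
  using chart_homeomorphism homeomorphism_apply2 by fastforce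

lemma chart_inv_in: "c \<in> A \<Longrightarrow> q \<in> snd c ` fst c \<Longrightarrow> chart_inv c q \<in> fst c"
  by auto

lemma continuous_on_chart: "c \<in> A \<Longrightarrow> continuous_on (fst c) (snd c)"
  using chart_homeomorphism homeomorphism_cont1 by blast

lemma continuous_on_chart_inv: "c \<in> A \<Longrightarrow> continuous_on (snd c ` fst c) (chart_inv c)"
  using chart_homeomorphism homeomorphism_cont2 by blast

lemma open_image_chart:
  assumes "c \<in> A" "open U" "U \<subseteq> fst c"
  shows "open (snd c ` U)"
proof -
  have "snd c ` U = chart_inv c -` U \<inter> snd c ` fst c"
    using assms by (auto simp: image_iff)
  then show ?thesis
    using assms continuous_on_open_vimage[OF open_chart_image] continuous_on_chart_inv by metis
qed

lemma open_vimage_chart: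
  assumes "c \<in> A" "open V"
  shows "open (fst c \<inter> snd c -` V)"
  using assms continuous_on_open_vimage[OF open_chart_domain] continuous_on_chart by (metis inf_commute)

lemma chart_around: obtains c where "c \<in> A" "x \<in> fst c"
  using atlas unfolding smooth_atlas_def by blast

lemma charts_at_iff: "c \<in> charts_at A x \<longleftrightarrow> c \<in> A \<and> x \<in> fst c"
  by (simp add: charts_at_def)

lemma smooth_transition:
  "c \<in> A \<Longrightarrow> d \<in> A \<Longrightarrow> smooth_on (snd d \<circ> chart_inv c) (snd c ` (fst c \<inter> fst d))"
  using atlas by (simp add: smooth_atlas_def)

abbreviation transition_derivative :: "('m, 'e) chart \<Rightarrow> ('m, 'e) chart \<Rightarrow> 'm \<Rightarrow> 'e \<Rightarrow> 'e" where
  "transition_derivative c d x \<equiv> frechet_derivative (snd d \<circ> chart_inv c) (at (snd c x))"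

lemma transition_has_derivative:
  assumes "c \<in> A" "d \<in> A" "x \<in> fst c" "x \<in> fst d"
  shows "((snd d \<circ> chart_inv c) has_derivative transition_derivative c d x) (at (snd c x))"
proof -
  have "(snd d \<circ> chart_inv c) differentiable (at (snd c x))"
    by (rule Cr_on_C1(1)[OF smooth_transition]) (use assms in auto)
  then show ?thesis by (simp add: frechet_derivative_works[symmetric])
qed

lemma linear_transition_derivative:
  assumes "c \<in> A" "d \<in> A" "x \<in> fst c" "x \<in> fst d"
  shows "linear (transition_derivative c d x)"
  using transition_has_derivative[OF assms] has_derivative_linear by blast

text \<open>The cocycle identity, by the chain rule on the open overlap of the three charts. It is
  what makes \<open>coord_vec\<close> satisfy the transformation law of tangent vectors.\<close>

lemma transition_derivative_chain:
  assumes "c \<in> A" "d \<in> A" "e \<in> A" "x \<in> fst c" "x \<in> fst d" "x \<in> fst e"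
  shows "transition_derivative d e x (transition_derivative c d x u) = transition_derivative c e x u"
proof -
  have eq: "(snd d \<circ> chart_inv c) (snd c x) = snd d x" using assms by simp
  have "((snd e \<circ> chart_inv d) \<circ> (snd d \<circ> chart_inv c) has_derivative
     transition_derivative d e x \<circ> transition_derivative c d x) (at (snd c x))"
    by (rule diff_chain_at) (use assms eq transition_has_derivative in auto)
  moreover have "open (snd c ` (fst c \<inter> fst d \<inter> fst e))"
    by (intro open_image_chart open_Int open_chart_domain) (use assms in auto)
  ultimately have "((snd e \<circ> chart_inv c) has_derivative
     transition_derivative d e x \<circ> transition_derivative c d x) (at (snd c x))"
    by (rule has_derivative_transform_within_open) (use assms in auto)
  then show ?thesis using frechet_derivative_at by (metis comp_apply)
qed

lemma transition_derivative_self: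
  assumes "c \<in> A" "x \<in> fst c"
  shows "transition_derivative c c x u = u"
proof -
  have "((snd c \<circ> chart_inv c) has_derivative (\<lambda>u. u)) (at (snd c x))"
    by (rule has_derivative_transform_within_open[OF has_derivative_ident open_chart_image[OF assms(1)]])
      (use assms in auto)
  then show ?thesis using frechet_derivative_at by metis
qed

lemma coord_vec_in_tangent_space:
  assumes "c \<in> A" "x \<in> fst c"
  shows "coord_vec A c x u \<in> tangent_space A x"
  using assms by (simp add: tangent_space_def coord_vec_def charts_at_iff transition_derivative_chain)

lemma coord_vec_apply:
  assumes "c \<in> A" "x \<in> fst c"
  shows "coord_vec A c x u c = u"
  using assms transition_derivative_self by (simp add: coord_vec_def charts_at_iff)

lemma linear_coord_vec:
  assumes "c \<in> A" "x \<in> fst c"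
  shows "linear (coord_vec A c x)"
proof (rule linearI)
  fix u w :: 'e and a :: real
  show "coord_vec A c x (u + w) = coord_vec A c x u + coord_vec A c x w"
    by (rule ext) (use assms in \<open>simp add: coord_vec_def charts_at_iff
        linear_add[OF linear_transition_derivative]\<close>)
  show "coord_vec A c x (a *\<^sub>R u) = a *\<^sub>R coord_vec A c x u"
    by (rule ext) (use assms in \<open>simp add: coord_vec_def charts_at_iff scaleR_fun_def
        linear_scale[OF linear_transition_derivative]\<close>)
qed

abbreviation map_derivative ::
    "('m \<Rightarrow> 'm) \<Rightarrow> ('m, 'e) chart \<Rightarrow> ('m, 'e) chart \<Rightarrow> 'e \<Rightarrow> 'e \<Rightarrow> 'e" where
  "map_derivative f c d q \<equiv> frechet_derivative (snd d \<circ> f \<circ> chart_inv c) (at q)"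

lemma Cr_map_local:
  assumes "Cr_map A r f" "1 \<le> r" "c \<in> A" "d \<in> A"
  shows "open (snd c ` (fst c \<inter> f -` fst d))"
    and "continuous_on (snd c ` (fst c \<inter> f -` fst d)) (snd d \<circ> f \<circ> chart_inv c)"
    and "q \<in> snd c ` (fst c \<inter> f -` fst d) \<Longrightarrow>
      ((snd d \<circ> f \<circ> chart_inv c) has_derivative map_derivative f c d q) (at q)"
    and "q \<in> snd c ` (fst c \<inter> f -` fst d) \<Longrightarrow> linear (map_derivative f c d q)"
    and "continuous_on (snd c ` (fst c \<inter> f -` fst d)) (\<lambda>q. map_derivative f c d q v)"
proof -
  have *: "Cr_on r (snd d \<circ> f \<circ> chart_inv c) (snd c ` (fst c \<inter> f -` fst d))"
    and cont: "continuous_on UNIV f"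
    using assms by (auto simp: Cr_map_def)
  have "open (f -` fst d)"
    using cont open_chart_domain[OF assms(4)] by (simp add: continuous_on_open_vimage)
  then show "open (snd c ` (fst c \<inter> f -` fst d))"
    using assms open_chart_domain by (intro open_image_chart open_Int) simp_all
  show "continuous_on (snd c ` (fst c \<inter> f -` fst d)) (snd d \<circ> f \<circ> chart_inv c)"
    using * by (rule Cr_on_continuous)
  show der: "((snd d \<circ> f \<circ> chart_inv c) has_derivative map_derivative f c d q) (at q)"
    if "q \<in> snd c ` (fst c \<inter> f -` fst d)" for q
    using Cr_on_C1(1)[OF * assms(2) that] by (simp add: frechet_derivative_works[symmetric])
  show "linear (map_derivative f c d q)" if "q \<in> snd c ` (fst c \<inter> f -` fst d)"
    using der[OF that] has_derivative_linear by blast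
  show "continuous_on (snd c ` (fst c \<inter> f -` fst d)) (\<lambda>q. map_derivative f c d q v)"
    by (rule Cr_on_C1(2)[OF * assms(2)])
qed

text \<open>\<open>tangent_map\<close> computes in an arbitrarily chosen chart \<open>b\<close> at
  \<open>x\<close>. Passing from \<open>c\<close> through \<open>b\<close>, or through
  \<open>d\<close> at the image point, differentiates the same local representative of
  \<open>f\<close> in two ways, and derivatives are unique.\<close>

lemma tangent_map_coord_vec:
  assumes f: "Cr_map A r f" "1 \<le> r" and c: "c \<in> A" "x \<in> fst c" and d: "d \<in> A" "f x \<in> fst d"
  shows "tangent_map A f x (coord_vec A c x u) =
    coord_vec A d (f x) (map_derivative f c d (snd c x) u)"
proof
  fix e
  define b where "b = (SOME c. c \<in> charts_at A x)"
  have "b \<in> charts_at A x" unfolding b_def by (rule someI[of _ c]) (use c in \<open>simp add: charts_at_iff\<close>)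
  then have b: "b \<in> A" "x \<in> fst b" by (auto simp: charts_at_iff)
  show "tangent_map A f x (coord_vec A c x u) e = coord_vec A d (f x) (map_derivative f c d (snd c x) u) e"
  proof (cases "e \<in> charts_at A (f x)")
    case True
    then have e: "e \<in> A" "f x \<in> fst e" by (auto simp: charts_at_iff)
    have fbe: "((snd e \<circ> f \<circ> chart_inv b) has_derivative map_derivative f b e (snd b x)) (at (snd b x))"
      using b e by (intro Cr_map_local(3)[OF f]) auto
    have fcd: "((snd d \<circ> f \<circ> chart_inv c) has_derivative map_derivative f c d (snd c x)) (at (snd c x))"
      using c d by (intro Cr_map_local(3)[OF f]) auto
    have of: "open (f -` U)" if "open U" for U
      using f(1) that by (simp add: Cr_map_def continuous_on_open_vimage)
    have "((snd e \<circ> f \<circ> chart_inv b) \<circ> (snd b \<circ> chart_inv c) has_derivative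
        map_derivative f b e (snd b x) \<circ> transition_derivative c b x) (at (snd c x))"
      by (rule diff_chain_at[OF transition_has_derivative]) (use b c fbe in auto)
    moreover have "open (snd c ` (fst c \<inter> fst b \<inter> f -` fst d))"
      using b c d open_chart_domain of by (intro open_image_chart open_Int) auto
    ultimately have "((snd e \<circ> f \<circ> chart_inv c) has_derivative
        map_derivative f b e (snd b x) \<circ> transition_derivative c b x) (at (snd c x))"
      by (rule has_derivative_transform_within_open) (use b c d in \<open>auto simp del: split_paired_All\<close>)
    moreover have "((snd e \<circ> f \<circ> chart_inv c) has_derivative
        transition_derivative d e (f x) \<circ> map_derivative f c d (snd c x)) (at (snd c x))"
    proof -
      have "((snd e \<circ> chart_inv d) \<circ> (snd d \<circ> f \<circ> chart_inv c) has_derivative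
        transition_derivative d e (f x) \<circ> map_derivative f c d (snd c x)) (at (snd c x))"
        by (rule diff_chain_at[OF fcd]) (use c d e transition_has_derivative in auto)
      moreover have "open (snd c ` (fst c \<inter> f -` fst d))"
        using c d open_chart_domain of by (intro open_image_chart open_Int) auto
      ultimately show ?thesis
        by (rule has_derivative_transform_within_open) (use c d in auto)
    qed
    ultimately have "map_derivative f b e (snd b x) \<circ> transition_derivative c b x =
        transition_derivative d e (f x) \<circ> map_derivative f c d (snd c x)"
      by (rule has_derivative_unique)
    from fun_cong[OF this, of u]
    have "map_derivative f b e (snd b x) (transition_derivative c b x u) =
        transition_derivative d e (f x) (map_derivative f c d (snd c x) u)"
      by (simp only: comp_apply)
    then show ?thesis
      using True \<open>b \<in> charts_at A x\<close>
      by (simp only: tangent_map_def Let_def coord_vec_def b_def[symmetric] if_True)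
  next
    case False
    then show ?thesis by (simp add: tangent_map_def Let_def coord_vec_def)
  qed
qed

section \<open>Curves that are C1 off a finite set\<close>

text \<open>A weakening of piecewise C1 that forgets the one-sided derivatives at break points. It
  keeps what integration of the speed uses: a two-sided, continuous derivative on an open set of
  full measure in the interval, with the exceptional set named explicitly.\<close>

definition C1_except :: "real set \<Rightarrow> (real \<Rightarrow> 'm) \<Rightarrow> bool" where
  "C1_except P \<gamma> \<longleftrightarrow> finite P \<and> continuous_on {0..1} \<gamma> \<and>
    (\<forall>c\<in>A. (\<forall>t\<in>({0<..<1} - P) \<inter> \<gamma> -` fst c.
         (snd c \<circ> \<gamma> has_vector_derivative vector_derivative (snd c \<circ> \<gamma>) (at t)) (at t)) \<and>
       continuous_on (({0<..<1} - P) \<inter> \<gamma> -` fst c) (\<lambda>t. vector_derivative (snd c \<circ> \<gamma>) (at t)))"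

lemma C1_exceptD:
  assumes "C1_except P \<gamma>"
  shows "finite P" "continuous_on {0..1} \<gamma>"
    and "\<And>c t. c \<in> A \<Longrightarrow> t \<in> {0<..<1} - P \<Longrightarrow> \<gamma> t \<in> fst c \<Longrightarrow>
       (snd c \<circ> \<gamma> has_vector_derivative vector_derivative (snd c \<circ> \<gamma>) (at t)) (at t)"
    and "\<And>c. c \<in> A \<Longrightarrow>
       continuous_on (({0<..<1} - P) \<inter> \<gamma> -` fst c) (\<lambda>t. vector_derivative (snd c \<circ> \<gamma>) (at t))"
  using assms by (auto simp: C1_except_def)

lemma open_Ioo_minus_finite: "finite P \<Longrightarrow> open ({a<..<b::real} - P)"
  by (intro open_Diff finite_imp_closed) auto

lemma open_curve_vimage:
  assumes "continuous_on {0..1::real} \<gamma>" "finite P" "open (U :: 'm set)"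
  shows "open (({0<..<1} - P) \<inter> \<gamma> -` U)"
proof -
  have "continuous_on ({0<..<1} - P) \<gamma>" using assms(1) by (rule continuous_on_subset) auto
  then show ?thesis
    using continuous_on_open_vimage[OF open_Ioo_minus_finite[OF assms(2)]] assms(3) by (metis inf_commute)
qed

text \<open>A time off the break points lies inside a closed interval that avoids them; in the
  interior of that interval the derivative within it is two-sided. The function \<open>D\<close>
  depends on chart and interval, but there it coincides with
  \<open>vector_derivative\<close>.\<close>

lemma piecewise_C1_curve_C1_except:
  assumes "piecewise_C1_curve A \<gamma>"
  obtains P where "C1_except P \<gamma>"
proof -
  obtain P where P: "finite P" and cont: "continuous_on {0..1} \<gamma>" and
    D: "\<And>a b c. 0 \<le> a \<Longrightarrow> a < b \<Longrightarrow> b \<le> 1 \<Longrightarrow> {a<..<b} \<inter> P = {} \<Longrightarrow> c \<in> A \<Longrightarrow>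
      \<exists>D. continuous_on ({a..b} \<inter> \<gamma> -` fst c) D \<and>
         (\<forall>t\<in>{a..b} \<inter> \<gamma> -` fst c. (snd c \<circ> \<gamma> has_vector_derivative D t) (at t within {a..b}))"
    using assms unfolding piecewise_C1_curve_def by metis
  have "(snd c \<circ> \<gamma> has_vector_derivative vector_derivative (snd c \<circ> \<gamma>) (at t)) (at t) \<and>
      isCont (\<lambda>t. vector_derivative (snd c \<circ> \<gamma>) (at t)) t"
    if c: "c \<in> A" and t: "t \<in> ({0<..<1} - P) \<inter> \<gamma> -` fst c" for c t
  proof -
    obtain e where "e > 0" and e: "cball t e \<subseteq> {0<..<1} - P"
      using open_Ioo_minus_finite[OF P] t open_contains_cball by blast
    define a b where "a = t - e" and "b = t + e"
    have ab: "a < b" "t \<in> {a<..<b}" "{a..b} \<subseteq> {0<..<1} - P"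
      using \<open>e > 0\<close> e by (auto simp: a_def b_def cball_eq_atLeastAtMost)
    have "a \<in> {a..b}" "b \<in> {a..b}" using ab(1) by auto
    then have "a \<in> {0<..<1}" "b \<in> {0<..<1}" using ab(3) by blast+
    moreover have "{a<..<b} \<subseteq> {a..b}" by auto
    ultimately have ab01: "0 \<le> a" "b \<le> 1" "{a<..<b} \<inter> P = {}" using ab(3) by auto
    obtain D where contD: "continuous_on ({a..b} \<inter> \<gamma> -` fst c) D" and
      D: "\<And>t. t \<in> {a..b} \<inter> \<gamma> -` fst c \<Longrightarrow> (snd c \<circ> \<gamma> has_vector_derivative D t) (at t within {a..b})"
      using D[OF ab01(1) ab(1) ab01(2,3) c] by blast
    let ?W = "{a<..<b} \<inter> \<gamma> -` fst c"
    have der: "(snd c \<circ> \<gamma> has_vector_derivative D s) (at s)" if "s \<in> ?W" for s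
      using D[of s] that by (auto simp: at_within_Icc_at)
    have "continuous_on {a<..<b} \<gamma>" using cont by (rule continuous_on_subset) (use ab01 in auto)
    then have "open ?W"
      using continuous_on_open_vimage[of "{a<..<b}" \<gamma>] open_chart_domain[OF c] by (metis inf_commute open_greaterThanLessThan)
    moreover have "continuous_on ?W (\<lambda>t. vector_derivative (snd c \<circ> \<gamma>) (at t))"
    proof (rule continuous_on_eq)
      show "continuous_on ?W D" by (rule continuous_on_subset[OF contD]) auto
    qed (simp add: vector_derivative_at[OF der])
    ultimately have "isCont (\<lambda>t. vector_derivative (snd c \<circ> \<gamma>) (at t)) t"
      using ab t continuous_on_eq_continuous_at by blast
    then show ?thesis using der[of t] ab t vector_derivative_at[OF der, of t] by auto
  qed
  then have "C1_except P \<gamma>"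
    unfolding C1_except_def using P cont by (auto intro!: continuous_at_imp_continuous_on)
  then show ?thesis using that by blast
qed

text \<open>Continuity keeps the curve in the domain of \<open>c\<close> near \<open>t\<close>, so
  the coordinates in any other chart are differentiated through the transition map. Hence one
  differentiable coordinate representation determines the whole family.\<close>

lemma velocity_coord_vec:
  assumes c: "c \<in> A" "\<gamma> t \<in> fst c" and \<gamma>: "isCont \<gamma> t"
    and D: "(snd c \<circ> \<gamma> has_vector_derivative D) (at t)"
  shows "velocity A \<gamma> t = coord_vec A c (\<gamma> t) D"
proof
  fix d
  show "velocity A \<gamma> t d = coord_vec A c (\<gamma> t) D d"
  proof (cases "d \<in> charts_at A (\<gamma> t)")
    case True
    then have d: "d \<in> A" "\<gamma> t \<in> fst d" by (auto simp: charts_at_iff)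
    have "((snd d \<circ> chart_inv c) \<circ> (snd c \<circ> \<gamma>) has_vector_derivative
        transition_derivative c d (\<gamma> t) D) (at t)"
      by (rule vector_derivative_diff_chain_within[OF D])
        (rule has_derivative_at_withinI, subst comp_apply,
          rule transition_has_derivative[OF c(1) d(1) c(2) d(2)])
    moreover have "\<forall>\<^sub>F s in at t. \<gamma> s \<in> fst c"
      using topological_tendstoD[OF \<gamma>[unfolded isCont_def] open_chart_domain[OF c(1)] c(2)] .
    then have "\<forall>\<^sub>F s in at t. ((snd d \<circ> chart_inv c) \<circ> (snd c \<circ> \<gamma>)) s = (snd d \<circ> \<gamma>) s"
      by eventually_elim (use c in auto)
    ultimately have "(snd d \<circ> \<gamma> has_vector_derivative transition_derivative c d (\<gamma> t) D) (at t)"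
      unfolding has_vector_derivative_def
      by (rule has_derivative_transform_eventually) (use c in auto)
    then show ?thesis
      using True by (simp add: velocity_def coord_vec_def vector_derivative_at)
  next
    case False
    then show ?thesis by (simp add: velocity_def coord_vec_def)
  qed
qed

end

section \<open>The Riemannian norm in coordinates and the speed of curves\<close>

locale riemannian = atlas A for A :: "('m::t2_space, 'e::euclidean_space) chart set" +
  fixes h :: "'m \<Rightarrow> ('m, 'e) tvec \<Rightarrow> ('m, 'e) tvec \<Rightarrow> real"
  assumes metric: "riemannian_metric A h"
begin

abbreviation speed :: "(real \<Rightarrow> 'm) \<Rightarrow> real \<Rightarrow> real" where
  "speed \<gamma> t \<equiv> tnorm h (\<gamma> t) (velocity A \<gamma> t)"

text \<open>The Riemannian norm transported to the image of a chart. Its arguments are plain vectors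
  of the model space, so compactness of the unit sphere becomes available.\<close>

definition cnorm :: "('m, 'e) chart \<Rightarrow> 'e \<Rightarrow> 'e \<Rightarrow> real" where
  "cnorm c q u = tnorm h (chart_inv c q) (coord_vec A c (chart_inv c q) u)"

lemma tnorm_coord_vec:
  "c \<in> A \<Longrightarrow> x \<in> fst c \<Longrightarrow> tnorm h x (coord_vec A c x u) = cnorm c (snd c x) u"
  by (simp add: cnorm_def)

lemma metric_bilinear:
  assumes "u \<in> tangent_space A x" "v \<in> tangent_space A x" "w \<in> tangent_space A x"
  shows "h x u v = h x v u" "h x (u + v) w = h x u w + h x v w" "h x (a *\<^sub>R u) w = a * h x u w"
proof -
  have "\<forall>x. \<forall>u\<in>tangent_space A x. \<forall>v\<in>tangent_space A x. \<forall>w\<in>tangent_space A x. \<forall>a.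
      h x u v = h x v u \<and> h x (u + v) w = h x u w + h x v w \<and> h x (a *\<^sub>R u) w = a * h x u w"
    using metric unfolding riemannian_metric_def by (rule conjunct1)
  then show "h x u v = h x v u" "h x (u + v) w = h x u w + h x v w" "h x (a *\<^sub>R u) w = a * h x u w"
    using assms by blast+
qed

lemma metric_linear_left:
  assumes "c \<in> A" "x \<in> fst c"
  shows "linear (\<lambda>u. h x (coord_vec A c x u) (coord_vec A c x w))"
proof (rule linearI)
  note cv = coord_vec_in_tangent_space[OF assms]
  fix u v :: 'e and a :: real
  show "h x (coord_vec A c x (u + v)) (coord_vec A c x w) =
      h x (coord_vec A c x u) (coord_vec A c x w) + h x (coord_vec A c x v) (coord_vec A c x w)"
    using metric_bilinear(2)[OF cv cv cv] linear_add[OF linear_coord_vec[OF assms]] by simp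
  show "h x (coord_vec A c x (a *\<^sub>R u)) (coord_vec A c x w) =
      a *\<^sub>R h x (coord_vec A c x u) (coord_vec A c x w)"
    using metric_bilinear(3)[OF cv cv cv] linear_scale[OF linear_coord_vec[OF assms]] by simp
qed

lemma metric_sym:
  assumes "c \<in> A" "x \<in> fst c"
  shows "h x (coord_vec A c x u) (coord_vec A c x w) = h x (coord_vec A c x w) (coord_vec A c x u)"
  using metric_bilinear(1) coord_vec_in_tangent_space[OF assms] by blast

lemma cnorm_scale:
  assumes "c \<in> A" "q \<in> snd c ` fst c"
  shows "cnorm c q (a *\<^sub>R u) = \<bar>a\<bar> * cnorm c q u"
proof -
  let ?x = "chart_inv c q"
  have x: "?x \<in> fst c" using assms chart_inv_in by blast
  have "h ?x (coord_vec A c ?x (a *\<^sub>R u)) (coord_vec A c ?x (a *\<^sub>R u)) =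
      a * (a * h ?x (coord_vec A c ?x u) (coord_vec A c ?x u))"
    using linear_scale[OF metric_linear_left[OF assms(1) x], of a u u]
      linear_scale[OF metric_linear_left[OF assms(1) x], of a u "a *\<^sub>R u"]
      metric_sym[OF assms(1) x, of "a *\<^sub>R u" u] by simp
  also have "\<dots> = a\<^sup>2 * h ?x (coord_vec A c ?x u) (coord_vec A c ?x u)"
    by (simp add: power2_eq_square)
  finally show ?thesis by (simp add: cnorm_def tnorm_def real_sqrt_mult)
qed

lemma cnorm_pos:
  assumes "c \<in> A" "q \<in> snd c ` fst c" "u \<noteq> 0"
  shows "cnorm c q u > 0"
proof -
  let ?x = "chart_inv c q"
  have x: "?x \<in> fst c" using assms chart_inv_in by blast
  have "coord_vec A c ?x u \<noteq> 0"
    using coord_vec_apply[OF assms(1) x, of u] assms(3) by (auto simp: zero_fun_def)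
  then have "h ?x (coord_vec A c ?x u) (coord_vec A c ?x u) > 0"
    using metric coord_vec_in_tangent_space[OF assms(1) x, of u] unfolding riemannian_metric_def by blast
  then show ?thesis by (simp add: cnorm_def tnorm_def)
qed

lemma cnorm_zero:
  assumes "c \<in> A" "q \<in> snd c ` fst c"
  shows "cnorm c q 0 = 0"
  using cnorm_scale[OF assms, of 0 0] by simp

text \<open>The metric is given as smooth in the base point for fixed coordinate vectors. Linearity
  in \<open>u\<close> gives joint continuity in \<open>(q, u)\<close>; with that pair as the new
  parameter, linearity in \<open>w\<close> gives continuity in all three, and restriction to the
  diagonal \<open>w = u\<close> gives the norm.\<close>

lemma continuous_on_cnorm:
  assumes "c \<in> A"
  shows "continuous_on ((snd c ` fst c) \<times> UNIV) (\<lambda>(q, u). cnorm c q u)"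
proof -
  let ?V = "snd c ` fst c"
  let ?H = "\<lambda>q u w. h (chart_inv c q) (coord_vec A c (chart_inv c q) u) (coord_vec A c (chart_inv c q) w)"
  have in_c: "chart_inv c q \<in> fst c" if "q \<in> ?V" for q using that assms chart_inv_in by blast
  have 1: "continuous_on ?V (\<lambda>q. ?H q u w)" for u w
    using metric assms Cr_on_continuous unfolding riemannian_metric_def by blast
  have 2: "continuous_on (?V \<times> UNIV) (\<lambda>(q, u). ?H q u w)" for w
    using 1 in_c by (intro continuous_on_linear_family metric_linear_left assms)
  have 3: "continuous_on ((?V \<times> UNIV) \<times> UNIV) (\<lambda>(p, w). ?H (fst p) (snd p) w)"
  proof (rule continuous_on_linear_family)
    show "continuous_on (?V \<times> UNIV) (\<lambda>p. ?H (fst p) (snd p) w)" for w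
      using 2[of w] by (simp add: case_prod_unfold)
    fix p :: "'e \<times> 'e" assume "p \<in> ?V \<times> UNIV"
    then have x: "chart_inv c (fst p) \<in> fst c" using in_c by auto
    show "linear (?H (fst p) (snd p))"
      using metric_linear_left[OF assms x, of "snd p"] metric_sym[OF assms x, of "snd p"] by simp
  qed
  have "continuous_on (?V \<times> (UNIV::'e set)) (\<lambda>p. (p, snd p))"
    by (intro continuous_on_Pair continuous_on_id continuous_on_snd)
  then have "continuous_on (?V \<times> UNIV) (\<lambda>p. (\<lambda>(p, w). ?H (fst p) (snd p) w) (p, snd p))"
    by (rule continuous_on_compose2[OF 3]) auto
  then show ?thesis
    unfolding cnorm_def tnorm_def by (auto simp: case_prod_unfold intro!: continuous_intros)
qed

lemma speed_eq:
  assumes "C1_except P \<gamma>" "t \<in> {0<..<1} - P" "c \<in> A" "\<gamma> t \<in> fst c"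
  shows "speed \<gamma> t = cnorm c (snd c (\<gamma> t)) (vector_derivative (snd c \<circ> \<gamma>) (at t))"
proof -
  have "continuous_on {0<..<1} \<gamma>"
    using C1_exceptD(2)[OF assms(1)] by (rule continuous_on_subset) auto
  then have "isCont \<gamma> t" using assms(2) by (simp add: continuous_on_eq_continuous_at)
  then show ?thesis
    using velocity_coord_vec[OF assms(3,4) _ C1_exceptD(3)[OF assms(1,3,2,4)]] tnorm_coord_vec[OF assms(3,4)]
    by simp
qed

lemma continuous_on_speed:
  assumes "C1_except P \<gamma>"
  shows "continuous_on ({0<..<1} - P) (speed \<gamma>)"
proof (rule continuous_at_imp_continuous_on, clarify)
  fix t assume t: "t \<in> {0<..<1}" "t \<notin> P"
  obtain c where c: "c \<in> A" "\<gamma> t \<in> fst c" by (rule chart_around)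
  let ?W = "({0<..<1} - P) \<inter> \<gamma> -` fst c"
  have op: "open ?W"
    using C1_exceptD(1,2)[OF assms] open_chart_domain[OF c(1)] open_curve_vimage by blast
  have "continuous_on ?W \<gamma>"
    using C1_exceptD(2)[OF assms] by (rule continuous_on_subset) auto
  then have "continuous_on ?W (\<lambda>t. snd c (\<gamma> t))"
    by (rule continuous_on_compose2[OF continuous_on_chart[OF c(1)]]) auto
  then have "continuous_on ?W (\<lambda>t. (snd c (\<gamma> t), vector_derivative (snd c \<circ> \<gamma>) (at t)))"
    using C1_exceptD(4)[OF assms c(1)] by (intro continuous_on_Pair)
  then have "continuous_on ?W (\<lambda>t. (\<lambda>(q, u). cnorm c q u) (snd c (\<gamma> t), vector_derivative (snd c \<circ> \<gamma>) (at t)))"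
    by (rule continuous_on_compose2[OF continuous_on_cnorm[OF c(1)]]) auto
  then have "continuous_on ?W (\<lambda>t. cnorm c (snd c (\<gamma> t)) (vector_derivative (snd c \<circ> \<gamma>) (at t)))"
    by simp
  then have "continuous_on ?W (speed \<gamma>)"
    by (rule continuous_on_eq) (use speed_eq[OF assms] c in auto)
  then show "isCont (speed \<gamma>) t"
    using op t c continuous_on_eq_continuous_at by blast
qed

text \<open>\<open>velocity\<close> uses two-sided derivatives, so at 0 and 1 it depends on values
  outside the interval, and at break points it is a default value. These finitely many times form a
  null set and are removed.\<close>

lemma curve_length_eq:
  assumes "C1_except P \<gamma>"
  shows "curve_length A h \<gamma> = (\<integral>\<^sup>+t\<in>{0<..<1} - P. ennreal (speed \<gamma> t) \<partial>lborel)"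
proof -
  have "P \<union> {0, 1} \<in> null_sets lborel"
    using C1_exceptD(1)[OF assms] by (intro finite_imp_null_set_lborel) auto
  then have "AE t in lborel. t \<notin> P \<union> {0, 1}" by (rule AE_not_in)
  then have "AE t in lborel. ennreal (speed \<gamma> t) * indicator {0..1} t =
      ennreal (speed \<gamma> t) * indicator ({0<..<1} - P) t"
    by (rule eventually_mono) (auto simp: indicator_def)
  then show ?thesis
    unfolding curve_length_def by (rule nn_integral_cong_AE)
qed

text \<open>The speed is cut off to the set where it is known to be continuous; the curve is
  unrestricted outside the unit interval, so nothing is claimed about its speed there.\<close>

lemma speed_borel:
  assumes "C1_except P \<gamma>"
  shows "(\<lambda>t. ennreal (speed \<gamma> t) * indicator ({0<..<1} - P) t) \<in> borel_measurable borel"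
proof -
  have "(\<lambda>t. indicator ({0<..<1} - P) t *\<^sub>R speed \<gamma> t) \<in> borel_measurable borel"
    using open_Ioo_minus_finite[OF C1_exceptD(1)[OF assms]] continuous_on_speed[OF assms]
    by (intro borel_measurable_continuous_on_indicator) auto
  then have "(\<lambda>t. ennreal (indicator ({0<..<1} - P) t *\<^sub>R speed \<gamma> t)) \<in> borel_measurable borel"
    by measurable
  then show ?thesis
    by (rule measurable_cong[THEN iffD1, rotated]) (auto simp: indicator_def)
qed

end

section \<open>Length and displacement of curves\<close>

context atlas
begin

lemma continuous_on_transition_derivative:
  assumes "c \<in> A" "e \<in> A"
  shows "continuous_on (snd c ` (fst c \<inter> fst e) \<times> UNIV)
    (\<lambda>(q, u). frechet_derivative (snd e \<circ> chart_inv c) (at q) u)"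
proof (rule continuous_on_linear_family)
  note smooth = smooth_transition[OF assms]
  show "continuous_on (snd c ` (fst c \<inter> fst e)) (\<lambda>q. frechet_derivative (snd e \<circ> chart_inv c) (at q) v)" for v
    by (rule Cr_on_C1(2)[OF smooth]) simp
  show "linear (frechet_derivative (snd e \<circ> chart_inv c) (at q))" if "q \<in> snd c ` (fst c \<inter> fst e)" for q
    by (rule frechet_derivative_linear, rule Cr_on_C1(1)[OF smooth _ that]) simp
qed

text \<open>A piecewise C1 curve is required to be C1 in every chart. For a piece inside the domain
  of one chart it is enough to check that chart, since transition maps are C1.\<close>

lemma C1_curve_other_chart:
  assumes c: "c \<in> A" and e: "e \<in> A" and \<gamma>: "\<And>t. t \<in> I \<Longrightarrow> \<gamma> t \<in> fst c"
    and w: "\<And>t. t \<in> I \<Longrightarrow> (snd c \<circ> \<gamma> has_vector_derivative w t) (at t within I)"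
    and contw: "continuous_on I w"
  shows "\<exists>D. continuous_on (I \<inter> \<gamma> -` fst e) D \<and>
    (\<forall>t\<in>I \<inter> \<gamma> -` fst e. (snd e \<circ> \<gamma> has_vector_derivative D t) (at t within I))"
proof (intro exI conjI ballI)
  let ?D = "\<lambda>t. transition_derivative c e (\<gamma> t) (w t)"
  let ?T = "I \<inter> \<gamma> -` fst e"
  have contc: "continuous_on I (snd c \<circ> \<gamma>)"
    unfolding continuous_on_eq_continuous_within using w has_vector_derivative_continuous by blast
  have "continuous_on ?T (\<lambda>t. (snd c (\<gamma> t), w t))"
    using continuous_on_subset[OF contc, of ?T] continuous_on_subset[OF contw, of ?T]
    by (intro continuous_on_Pair) (simp_all add: comp_def)
  then have "continuous_on ?T (\<lambda>t. (\<lambda>(q, u). frechet_derivative (snd e \<circ> chart_inv c) (at q) u) (snd c (\<gamma> t), w t))"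
    by (rule continuous_on_compose2[OF continuous_on_transition_derivative[OF c e]]) (use \<gamma> in auto)
  then show "continuous_on ?T ?D" by simp
  fix t assume t: "t \<in> ?T"
  have "((snd e \<circ> chart_inv c) \<circ> (snd c \<circ> \<gamma>) has_vector_derivative ?D t) (at t within I)"
    by (rule vector_derivative_diff_chain_within[OF w])
      (use t in simp, rule has_derivative_at_withinI, subst comp_apply,
        rule transition_has_derivative, use c e t \<gamma> in auto)
  then show "(snd e \<circ> \<gamma> has_vector_derivative ?D t) (at t within I)"
    by (rule has_vector_derivative_transform[rotated 2]) (use t c \<gamma> in auto)
qed

end

text \<open>The times outside \<open>B\<close> form a closed nonempty set, so their infimum belongs
  to it.\<close>

lemma first_exit:
  fixes \<phi> :: "real \<Rightarrow> 'a::topological_space"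
  assumes cont: "continuous_on {0..1} \<phi>" and "open B" "\<phi> 0 \<in> B" "\<phi> 1 \<notin> B"
  obtains s where "0 < s" "s \<le> 1" "\<phi> s \<notin> B" "\<And>r. 0 \<le> r \<Longrightarrow> r < s \<Longrightarrow> \<phi> r \<in> B"
proof -
  define Z where "Z = {0..1} \<inter> \<phi> -` (- B)"
  have "closed Z"
    unfolding Z_def using cont \<open>open B\<close> continuous_on_closed_vimage[of "{0..1}" \<phi>]
    by (metis Int_commute closed_Compl closed_atLeastAtMost)
  moreover have Z1: "1 \<in> Z" using assms by (simp add: Z_def)
  moreover have bdd: "bdd_below Z" by (rule bdd_belowI[of _ 0]) (simp add: Z_def)
  ultimately have inZ: "Inf Z \<in> Z" using closed_contains_Inf by blast
  show ?thesis
  proof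
    show "\<phi> (Inf Z) \<notin> B" "Inf Z \<le> 1" using inZ by (auto simp: Z_def)
    moreover have "0 \<le> Inf Z" using inZ by (simp add: Z_def)
    moreover have "Inf Z \<noteq> 0" using inZ \<open>\<phi> 0 \<in> B\<close> unfolding Z_def by force
    ultimately show "0 < Inf Z" by simp
    fix r assume "0 \<le> r" "r < Inf Z"
    moreover have "r \<le> 1" using calculation \<open>Inf Z \<le> 1\<close> by simp
    ultimately show "\<phi> r \<in> B" using cInf_lower[OF _ bdd, of r] by (force simp: Z_def)
  qed
qed

context riemannian
begin

text \<open>Half the minimum and twice the maximum of the norm on the Euclidean unit sphere at
  \<open>x\<close> are strict bounds there; they persist nearby, and homogeneity extends them to all
  vectors.\<close>

lemma cnorm_bounds:
  assumes c: "c \<in> A" "x \<in> fst c"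
  obtains U m K where "open U" "snd c x \<in> U" "U \<subseteq> snd c ` fst c" "m > 0" "K > 0"
    "\<And>q u. q \<in> U \<Longrightarrow> m * norm u \<le> cnorm c q u" "\<And>q u. q \<in> U \<Longrightarrow> cnorm c q u \<le> K * norm u"
proof -
  let ?S = "sphere (0::'e) 1" and ?q = "snd c x" and ?V = "snd c ` fst c"
  have q: "?q \<in> ?V" using c by simp
  have "continuous_on ?S (\<lambda>u. (?q, u))"
    by (intro continuous_on_Pair continuous_on_id continuous_on_const)
  then have cont: "continuous_on ?S (\<lambda>u. (\<lambda>(q, u). cnorm c q u) (?q, u))"
    by (rule continuous_on_compose2[OF continuous_on_cnorm[OF c(1)]]) (use c in auto)
  have ne: "?S \<noteq> {}" by simp
  obtain u0 where u0: "u0 \<in> ?S" "\<And>u. u \<in> ?S \<Longrightarrow> cnorm c ?q u0 \<le> cnorm c ?q u"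
    using continuous_attains_inf[OF compact_sphere ne cont] by auto
  obtain u1 where u1: "u1 \<in> ?S" "\<And>u. u \<in> ?S \<Longrightarrow> cnorm c ?q u \<le> cnorm c ?q u1"
    using continuous_attains_sup[OF compact_sphere ne cont] by auto
  define m where "m = cnorm c ?q u0 / 2"
  define K where "K = 2 * cnorm c ?q u1"
  have "cnorm c ?q u0 > 0" "cnorm c ?q u1 > 0"
    by (rule cnorm_pos[OF c(1) q]; use u0(1) u1(1) in force)+
  then have mK: "m > 0" "K > 0" by (simp_all add: m_def K_def)
  \<comment> \<open>The minimum turns the two strict bounds into positivity of one continuous
    function.\<close>
  have "continuous_on (?V \<times> UNIV) (\<lambda>p. min ((\<lambda>(q, u). cnorm c q u) p - m) (K - (\<lambda>(q, u). cnorm c q u) p))"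
    by (intro continuous_intros continuous_on_cnorm c)
  then have cont': "continuous_on (?V \<times> UNIV) (\<lambda>(q, u). min (cnorm c q u - m) (K - cnorm c q u))"
    by (simp add: case_prod_unfold)
  have "min (cnorm c ?q u - m) (K - cnorm c ?q u) > 0" if "u \<in> ?S" for u
    using u0(2)[OF that] u1(2)[OF that] \<open>cnorm c ?q u0 > 0\<close> \<open>cnorm c ?q u1 > 0\<close> by (simp add: m_def K_def)
  then obtain U where U: "open U" "?q \<in> U" "U \<subseteq> ?V"
    "\<And>q u. q \<in> U \<Longrightarrow> u \<in> ?S \<Longrightarrow> min (cnorm c q u - m) (K - cnorm c q u) > 0"
    using eventually_pos_on_compact[OF cont' open_chart_image[OF c(1)] q compact_sphere, of 0 1] by metis
  have "m * norm u \<le> cnorm c q u \<and> cnorm c q u \<le> K * norm u" if "q \<in> U" for q u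
  proof (cases "u = 0")
    case True
    then show ?thesis using cnorm_zero[OF c(1)] that U(3) by auto
  next
    case False
    define v where "v = u /\<^sub>R norm u"
    have "v \<in> ?S" "u = norm u *\<^sub>R v" using False by (simp_all add: v_def)
    then have "cnorm c q u = norm u * cnorm c q v"
      using cnorm_scale[OF c(1), of q "norm u" v] that U(3) by auto
    moreover have "m \<le> cnorm c q v" "cnorm c q v \<le> K" using U(4)[OF that \<open>v \<in> ?S\<close>] by auto
    ultimately show ?thesis
      using mult_left_mono[of m "cnorm c q v" "norm u"] mult_left_mono[of "cnorm c q v" K "norm u"]
      by (simp add: mult.commute)
  qed
  then show ?thesis using that[OF U(1-3) mK] by blast
qed

text \<open>The coordinate displacement is at most the integral of the coordinate speed, and
  \<open>m\<close> times the coordinate speed is at most the Riemannian speed. The factor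
  \<open>m\<close> is put into the curve itself, so that it need not be moved through the
  integral.\<close>

lemma chart_displacement_le_length:
  assumes P: "C1_except P \<gamma>" and c: "c \<in> A" and ab: "0 \<le> a" "a \<le> b" "b \<le> 1" and "m \<ge> 0"
    and in_c: "\<And>t. t \<in> {a..b} \<Longrightarrow> \<gamma> t \<in> fst c"
    and lb: "\<And>t u. t \<in> {a..b} \<Longrightarrow> m * norm u \<le> cnorm c (snd c (\<gamma> t)) u"
  shows "ennreal (m * norm (snd c (\<gamma> b) - snd c (\<gamma> a))) \<le> curve_length A h \<gamma>"
proof -
  let ?D = "\<lambda>t. vector_derivative (snd c \<circ> \<gamma>) (at t)"
  have sub: "{a<..<b} - P \<subseteq> {0<..<1} - P" using ab by auto
  have cont\<gamma>: "continuous_on {a..b} \<gamma>"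
    using C1_exceptD(2)[OF P] by (rule continuous_on_subset) (use ab in auto)
  have "continuous_on {a..b} (\<lambda>t. snd c (\<gamma> t))"
    by (rule continuous_on_compose2[OF continuous_on_chart[OF c] cont\<gamma>]) (use in_c in auto)
  then have cont: "continuous_on {a..b} (\<lambda>t. m *\<^sub>R (snd c \<circ> \<gamma>) t)"
    by (intro continuous_on_scaleR continuous_on_const) (simp add: comp_def)
  have der: "((\<lambda>t. m *\<^sub>R (snd c \<circ> \<gamma>) t) has_vector_derivative m *\<^sub>R ?D t) (at t)"
    if "t \<in> {a<..<b} - P" for t
    by (rule bounded_linear.has_vector_derivative[OF bounded_linear_scaleR_right],
        rule C1_exceptD(3)[OF P c]) (use that sub in_c in auto)
  have contD: "continuous_on ({a<..<b} - P) (\<lambda>t. m *\<^sub>R ?D t)"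
    by (intro continuous_on_scaleR continuous_on_const continuous_on_subset[OF C1_exceptD(4)[OF P c]])
      (use sub in_c in auto)
  have "ennreal (m * norm (snd c (\<gamma> b) - snd c (\<gamma> a))) =
      ennreal (norm (m *\<^sub>R (snd c \<circ> \<gamma>) b - m *\<^sub>R (snd c \<circ> \<gamma>) a))"
    using \<open>m \<ge> 0\<close> by (simp flip: scaleR_diff_right)
  also have "\<dots> \<le> (\<integral>\<^sup>+t\<in>{a<..<b} - P. ennreal (norm (m *\<^sub>R ?D t)) \<partial>lborel)"
    by (rule norm_diff_le_nn_integral[OF ab(2) cont C1_exceptD(1)[OF P] der contD])
  also have "\<dots> \<le> (\<integral>\<^sup>+t\<in>{0<..<1} - P. ennreal (speed \<gamma> t) \<partial>lborel)"
  proof (rule nn_integral_mono)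
    fix t
    show "ennreal (norm (m *\<^sub>R ?D t)) * indicator ({a<..<b} - P) t \<le>
        ennreal (speed \<gamma> t) * indicator ({0<..<1} - P) t"
    proof (cases "t \<in> {a<..<b} - P")
      case True
      then have "norm (m *\<^sub>R ?D t) \<le> speed \<gamma> t"
        using speed_eq[OF P _ c, of t] in_c[of t] lb[of t "?D t"] sub \<open>m \<ge> 0\<close> by auto
      then show ?thesis using True sub by (auto simp: indicator_def intro: ennreal_leI)
    qed simp
  qed
  finally show ?thesis by (simp add: curve_length_eq[OF P])
qed

text \<open>A curve that meets the coordinate ball of radius \<open>s\<close> and leaves the one of
  radius \<open>2 * s\<close> moves at least \<open>s\<close> in coordinates, which costs length at
  least \<open>m * s\<close>. The reference time \<open>t0\<close> may be any time of the curve, so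
  that curves can be controlled from either end.\<close>

lemma short_curves_stay:
  assumes "open V" "p \<in> V"
  obtains V' \<delta> where "open V'" "p \<in> V'" "V' \<subseteq> V" "\<delta> > 0"
    "\<And>\<gamma> t0 t. piecewise_C1_curve A \<gamma> \<Longrightarrow> t0 \<in> {0..1} \<Longrightarrow> \<gamma> t0 \<in> V' \<Longrightarrow>
       curve_length A h \<gamma> < ennreal \<delta> \<Longrightarrow> t \<in> {0..1} \<Longrightarrow> \<gamma> t \<in> V"
proof -
  obtain c where c: "c \<in> A" "p \<in> fst c" by (rule chart_around)
  obtain U m K where U: "open U" "snd c p \<in> U" "U \<subseteq> snd c ` fst c" and "m > 0"
    and lb: "\<And>q u. q \<in> U \<Longrightarrow> m * norm u \<le> cnorm c q u"
    using cnorm_bounds[OF c] by metis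
  have "open (snd c ` (fst c \<inter> V) \<inter> U)"
    by (intro open_Int open_image_chart U open_chart_domain c assms) auto
  moreover have "snd c p \<in> snd c ` (fst c \<inter> V) \<inter> U" using U c assms by auto
  ultimately obtain e where "e > 0" and e: "cball (snd c p) e \<subseteq> snd c ` (fst c \<inter> V) \<inter> U"
    using open_contains_cball by blast
  define s where "s = e / 2"
  have "s > 0" using \<open>e > 0\<close> by (simp add: s_def)
  have es: "e = 2 * s" by (simp add: s_def)
  define B where "B r = fst c \<inter> snd c -` ball (snd c p) r" for r
  \<comment> \<open>The image of a closed ball is compact, hence closed in the manifold. It
    therefore contains the exit point as a limit, which keeps that point inside the chart
    domain.\<close>
  define Q where "Q = chart_inv c ` cball (snd c p) e"
  have opB: "open (B r)" for r unfolding B_def by (intro open_vimage_chart c) simp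
  have "continuous_on (cball (snd c p) e) (chart_inv c)"
    using continuous_on_chart_inv[OF c(1)] by (rule continuous_on_subset) (use e in auto)
  then have "closed Q" unfolding Q_def by (intro compact_imp_closed compact_continuous_image) auto
  have Q: "x \<in> fst c \<and> x \<in> V \<and> snd c x \<in> U" if "x \<in> Q" for x
  proof -
    obtain q where "q \<in> cball (snd c p) e" "x = chart_inv c q" using \<open>x \<in> Q\<close> by (auto simp: Q_def)
    then have "q \<in> snd c ` (fst c \<inter> V)" "q \<in> U" using e by blast+
    then show ?thesis using \<open>x = chart_inv c q\<close> c by auto
  qed
  have BQ: "B e \<subseteq> Q"
  proof
    fix x assume "x \<in> B e"
    then have "x = chart_inv c (snd c x)" "snd c x \<in> cball (snd c p) e" using c by (auto simp: B_def)
    then show "x \<in> Q" unfolding Q_def by blast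
  qed
  have BsBe: "B s \<subseteq> B e" using \<open>s > 0\<close> by (auto simp: B_def es)
  show ?thesis
  proof (rule that[of "B s" "m * s"])
    show "open (B s)" by (rule opB)
    show "p \<in> B s" using c \<open>s > 0\<close> by (simp add: B_def)
    show "B s \<subseteq> V" using BsBe BQ Q by blast
    show "m * s > 0" using \<open>m > 0\<close> \<open>s > 0\<close> by simp
    fix \<gamma> and t0 t1 :: real
    assume \<gamma>: "piecewise_C1_curve A \<gamma>" and t0: "t0 \<in> {0..1}" "\<gamma> t0 \<in> B s"
      and len: "curve_length A h \<gamma> < ennreal (m * s)" and t1: "t1 \<in> {0..1}"
    obtain P where P: "C1_except P \<gamma>" using piecewise_C1_curve_C1_except[OF \<gamma>] .
    show "\<gamma> t1 \<in> V"
    proof (rule ccontr)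
      assume "\<gamma> t1 \<notin> V"
      \<comment> \<open>Runs from \<open>t0\<close> to \<open>t1\<close> in either direction, so
        that the exit closest to \<open>t0\<close> becomes a first exit.\<close>
      define \<tau> where "\<tau> r = t0 + r * (t1 - t0)" for r
      have \<tau>01: "\<tau> r \<in> {0..1}" if "r \<in> {0..1}" for r
      proof -
        have "\<tau> r = (1 - r) *\<^sub>R t0 + r *\<^sub>R t1" by (simp add: \<tau>_def algebra_simps)
        then show ?thesis using convexD_alt[OF convex_real_interval(5)[of 0 1] t0(1) t1, of r] that by simp
      qed
      have cont: "continuous_on {0..1} (\<gamma> \<circ> \<tau>)"
        by (rule continuous_on_compose, unfold \<tau>_def, intro continuous_intros,
            rule continuous_on_subset[OF C1_exceptD(2)[OF P]]) (use \<tau>01 in \<open>auto simp: \<tau>_def\<close>)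
      have "(\<gamma> \<circ> \<tau>) 0 \<in> B e" using t0 BsBe by (auto simp: \<tau>_def)
      moreover have "(\<gamma> \<circ> \<tau>) 1 \<notin> B e" using \<open>\<gamma> t1 \<notin> V\<close> BQ Q by (auto simp: \<tau>_def)
      ultimately obtain r where r: "0 < r" "r \<le> 1" "(\<gamma> \<circ> \<tau>) r \<notin> B e"
        "\<And>r'. 0 \<le> r' \<Longrightarrow> r' < r \<Longrightarrow> (\<gamma> \<circ> \<tau>) r' \<in> B e"
        using first_exit[OF cont opB] by metis
      have "(\<gamma> \<circ> \<tau>) ` closure {0..<r} \<subseteq> Q"
        using r BQ by (intro image_closure_subset continuous_on_subset[OF cont] \<open>closed Q\<close>) auto
      then have inQ: "(\<gamma> \<circ> \<tau>) r' \<in> Q" if "r' \<in> {0..r}" for r'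
        using that r(1) by auto
      define a b where "a = min t0 (\<tau> r)" and "b = max t0 (\<tau> r)"
      have ab: "0 \<le> a" "a \<le> b" "b \<le> 1" using t0 \<tau>01[of r] r by (auto simp: a_def b_def)
      have \<gamma>Q: "\<gamma> t \<in> Q" if "t \<in> {a..b}" for t
      proof -
        have "t0 \<noteq> t1" using r t0 BsBe by (auto simp: \<tau>_def)
        define r' where "r' = (t - t0) / (t1 - t0)"
        have t: "t = \<tau> r'" using \<open>t0 \<noteq> t1\<close> by (simp add: r'_def \<tau>_def)
        have "r' \<in> {0..r}"
        proof (cases "t0 < t1")
          case True
          then have "t0 \<le> t" "t - t0 \<le> r * (t1 - t0)" using that r(1) by (auto simp: a_def b_def \<tau>_def max_def min_def split: if_splits)
          then show ?thesis using True by (simp add: r'_def field_simps)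
        next
          case False
          then have "t1 - t0 < 0" using \<open>t0 \<noteq> t1\<close> by simp
          moreover have "r * (t1 - t0) \<le> 0" using calculation r(1) by (simp add: mult_nonneg_nonpos)
          ultimately have "t \<le> t0" "t - t0 \<ge> r * (t1 - t0)" using that by (auto simp: a_def b_def \<tau>_def max_def min_def split: if_splits)
          then show ?thesis using \<open>t1 - t0 < 0\<close>
            by (simp add: r'_def neg_divide_le_eq zero_le_divide_iff)
        qed
        then show ?thesis using inQ t by (metis comp_apply)
      qed
      have "ennreal (m * norm (snd c (\<gamma> b) - snd c (\<gamma> a))) \<le> curve_length A h \<gamma>"
        using \<open>m > 0\<close> Q[OF \<gamma>Q] lb by (intro chart_displacement_le_length[OF P c(1) ab]) auto
      moreover have "norm (snd c (\<gamma> b) - snd c (\<gamma> a)) = dist (snd c (\<gamma> (\<tau> r))) (snd c (\<gamma> t0))"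
        unfolding a_def b_def by (cases "t0 \<le> \<tau> r") (auto simp: dist_norm norm_minus_commute max_def min_def)
      moreover have "dist (snd c p) (snd c (\<gamma> t0)) < s" using t0 by (simp add: B_def)
      moreover have "dist (snd c p) (snd c (\<gamma> (\<tau> r))) \<ge> e"
        using r(3) Q[OF inQ[of r]] r(1) by (simp add: B_def)
      \<comment> \<open>The exit point has coordinate distance at least \<open>e = 2 * s\<close>
        from the centre and the starting point less than \<open>s\<close>, so they are at least
        \<open>s\<close> apart.\<close>
      ultimately have "ennreal (m * dist (snd c (\<gamma> (\<tau> r))) (snd c (\<gamma> t0))) < ennreal (m * s)"
        "dist (snd c (\<gamma> (\<tau> r))) (snd c (\<gamma> t0)) \<ge> s"
        using len dist_triangle[of "snd c p" "snd c (\<gamma> (\<tau> r))" "snd c (\<gamma> t0)"]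
        by (auto simp: es dist_commute)
      then show False using \<open>m > 0\<close> \<open>s > 0\<close> by (simp add: ennreal_less_iff)
    qed
  qed
qed

lemma riemannian_dist_le: "piecewise_C1_curve A \<gamma> \<Longrightarrow> riemannian_dist A h (\<gamma> 0) (\<gamma> 1) \<le> curve_length A h \<gamma>"
  unfolding riemannian_dist_def by (rule INF_lower) simp

lemma riemannian_dist_lessE:
  assumes "riemannian_dist A h x y < l"
  obtains \<gamma> where "piecewise_C1_curve A \<gamma>" "\<gamma> 0 = x" "\<gamma> 1 = y" "curve_length A h \<gamma> < l"
  using assms unfolding riemannian_dist_def by (auto simp: INF_less_iff)

text \<open>Short curves through \<open>x\<close> stay in the complement of \<open>y\<close>, which
  is open.\<close>

lemma riemannian_dist_pos:
  assumes "x \<noteq> y"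
  shows "riemannian_dist A h x y > 0"
proof -
  have "open (- {y})" "x \<in> - {y}" using assms by auto
  then obtain V' \<delta> where V: "x \<in> V'" "\<delta> > 0" and
    stay: "\<And>\<gamma> t0 t. piecewise_C1_curve A \<gamma> \<Longrightarrow> t0 \<in> {0..1} \<Longrightarrow> \<gamma> t0 \<in> V' \<Longrightarrow>
       curve_length A h \<gamma> < ennreal \<delta> \<Longrightarrow> t \<in> {0..1} \<Longrightarrow> \<gamma> t \<in> - {y}"
    using short_curves_stay by metis
  have "\<not> riemannian_dist A h x y < ennreal \<delta>"
    using stay[of _ 0 1] V(1) by (auto elim!: riemannian_dist_lessE)
  then show ?thesis using \<open>\<delta> > 0\<close> by (metis ennreal_less_zero_iff less_le_trans not_less)
qed

text \<open>Points in a small coordinate ball are joined by the straight segment in coordinates,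
  whose length is controlled by the upper bound on the norm. This links the manifold topology with
  the distance.\<close>

lemma locally_small_dist:
  assumes "\<delta> > 0"
  obtains V where "open V" "p \<in> V" "\<And>x y. x \<in> V \<Longrightarrow> y \<in> V \<Longrightarrow> riemannian_dist A h x y < ennreal \<delta>"
proof -
  obtain c where c: "c \<in> A" "p \<in> fst c" by (rule chart_around)
  obtain U m K where U: "open U" "snd c p \<in> U" "U \<subseteq> snd c ` fst c" and "K > 0"
    and ub: "\<And>q u. q \<in> U \<Longrightarrow> cnorm c q u \<le> K * norm u"
    using cnorm_bounds[OF c] by metis
  obtain e where "e > 0" and e: "ball (snd c p) e \<subseteq> U" using U open_contains_ball by blast
  \<comment> \<open>A segment in the ball has Euclidean length at most \<open>2 * s\<close>; the 3
    makes \<open>K * (2 * s)\<close> strictly less than \<delta>.\<close>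
  define s where "s = min e (\<delta> / (3 * K))"
  have s: "s > 0" "ball (snd c p) s \<subseteq> U" "K * (2 * s) < \<delta>"
  proof -
    have "K * (2 * s) \<le> K * (2 * (\<delta> / (3 * K)))" using \<open>K > 0\<close> by (intro mult_left_mono) (simp_all add: s_def)
    also have "\<dots> < \<delta>" using \<open>K > 0\<close> \<open>\<delta> > 0\<close> by (simp add: field_simps)
    finally show "K * (2 * s) < \<delta>" .
  qed (use \<open>e > 0\<close> \<open>K > 0\<close> \<open>\<delta> > 0\<close> e in \<open>auto simp: s_def\<close>)
  show ?thesis
  proof (rule that[of "fst c \<inter> snd c -` ball (snd c p) s"])
    show "open (fst c \<inter> snd c -` ball (snd c p) s)" by (intro open_vimage_chart c) simp
    show "p \<in> fst c \<inter> snd c -` ball (snd c p) s" using c s by simp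
    fix x y assume x: "x \<in> fst c \<inter> snd c -` ball (snd c p) s" and y: "y \<in> fst c \<inter> snd c -` ball (snd c p) s"
    define v where "v = snd c y - snd c x"
    define l where "l t = snd c x + t *\<^sub>R v" for t :: real
    define \<gamma> where "\<gamma> t = chart_inv c (l t)" for t
    have ball: "l t \<in> ball (snd c p) s" if "t \<in> {0..1}" for t
    proof -
      have "l t = (1 - t) *\<^sub>R snd c x + t *\<^sub>R snd c y" by (simp add: l_def v_def algebra_simps)
      then show ?thesis using convexD_alt[OF convex_ball, of "snd c x" "snd c p" s "snd c y" t] x y that by auto
    qed
    then have lU: "l t \<in> U" if "t \<in> {0..1}" for t using s(2) that by blast
    have lc: "snd c (\<gamma> t) = l t" "\<gamma> t \<in> fst c" if "t \<in> {0..1}" for t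
      using lU[OF that] U(3) c by (auto simp: \<gamma>_def chart_chart_inv)
    have der: "(snd c \<circ> \<gamma> has_vector_derivative v) (at t within {a..b})"
      if "0 \<le> a" "b \<le> 1" "t \<in> {a..b}" for a b t
    proof -
      have "(l has_vector_derivative v) (at t within {a..b})"
        unfolding l_def by (auto intro!: derivative_eq_intros)
      then show ?thesis
        by (rule has_vector_derivative_transform[rotated 2]) (use that lc in auto)
    qed
    have "continuous_on {0..1} \<gamma>"
      unfolding \<gamma>_def
      by (rule continuous_on_compose2[OF continuous_on_chart_inv[OF c(1)]])
        (use lU U(3) in \<open>auto simp: l_def intro!: continuous_intros\<close>)
    then have "piecewise_C1_curve A \<gamma>"
      unfolding piecewise_C1_curve_def
    proof (intro conjI exI[of _ "{}"] allI impI ballI)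
      fix a b :: real and d assume ab: "0 \<le> a \<and> a < b \<and> b \<le> 1 \<and> {a<..<b} \<inter> {} = {}" and d: "d \<in> A"
      show "\<exists>D. continuous_on ({a..b} \<inter> \<gamma> -` fst d) D \<and>
          (\<forall>t\<in>{a..b} \<inter> \<gamma> -` fst d. (snd d \<circ> \<gamma> has_vector_derivative D t) (at t within {a..b}))"
        using der ab lc by (intro C1_curve_other_chart[OF c(1) d, of _ _ "\<lambda>t. v"]) auto
    qed auto
    then obtain P where P: "C1_except P \<gamma>" using piecewise_C1_curve_C1_except by blast
    have "norm v \<le> 2 * s"
      using x y dist_triangle2[of "snd c x" "snd c y" "snd c p"]
      by (simp add: v_def dist_norm[symmetric] dist_commute)
    have "speed \<gamma> t \<le> K * (2 * s)" if "t \<in> {0<..<1} - P" for t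
    proof -
      have t: "t \<in> {0..1}" using that by auto
      have "speed \<gamma> t = cnorm c (l t) (vector_derivative (snd c \<circ> \<gamma>) (at t))"
        using speed_eq[OF P that c(1)] lc[OF t] by simp
      also have "vector_derivative (snd c \<circ> \<gamma>) (at t) = v"
        using der[of 0 1 t] that by (intro vector_derivative_at) (auto simp: at_within_Icc_at)
      also have "cnorm c (l t) v \<le> K * norm v" using ub lU[OF t] by blast
      also have "\<dots> \<le> K * (2 * s)" using \<open>norm v \<le> 2 * s\<close> \<open>K > 0\<close> by simp
      finally show ?thesis .
    qed
    then have "curve_length A h \<gamma> \<le> (\<integral>\<^sup>+t\<in>{0..1::real}. ennreal (K * (2 * s)) \<partial>lborel)"
      unfolding curve_length_eq[OF P]
      by (intro nn_integral_mono) (auto simp: indicator_def intro!: ennreal_leI)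
    also have "\<dots> = ennreal (K * (2 * s))"
      by (subst nn_integral_cmult_indicator) auto
    also have "\<dots> < ennreal \<delta>" using s \<open>K > 0\<close> by (simp add: ennreal_less_iff)
    finally have "curve_length A h \<gamma> < ennreal \<delta>" .
    moreover have "\<gamma> 0 = x" "\<gamma> 1 = y" using x y c by (auto simp: \<gamma>_def l_def v_def)
    ultimately show "riemannian_dist A h x y < ennreal \<delta>"
      using riemannian_dist_le[OF \<open>piecewise_C1_curve A \<gamma>\<close>] by (metis le_less_trans)
  qed
qed

text \<open>The chain rule for an affine change of time. Agreement with the reparametrised curve is
  asked only on an open set of times, since a concatenation agrees with each of its parts only on
  one half.\<close>

lemma speed_affine:
  assumes P: "C1_except P g" and "\<alpha> > 0" "open I" "t \<in> I"
    and eq: "\<And>s. s \<in> I \<Longrightarrow> \<gamma> s = g (\<alpha> * s + \<beta>)" and t: "\<alpha> * t + \<beta> \<in> {0<..<1} - P"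
  shows "speed \<gamma> t = \<alpha> * speed g (\<alpha> * t + \<beta>)"
proof -
  let ?a = "\<lambda>s. \<alpha> * s + \<beta>"
  obtain c where c: "c \<in> A" "g (?a t) \<in> fst c" by (rule chart_around)
  let ?D = "vector_derivative (snd c \<circ> g) (at (?a t))"
  have D: "(snd c \<circ> g has_vector_derivative ?D) (at (?a t))" by (rule C1_exceptD(3)[OF P c(1) t c(2)])
  have "(?a has_vector_derivative \<alpha>) (at t)" by (auto intro!: derivative_eq_intros)
  then have "((snd c \<circ> g) \<circ> ?a has_vector_derivative \<alpha> *\<^sub>R ?D) (at t)"
    by (rule vector_diff_chain_at) (use D in simp)
  then have D': "(snd c \<circ> \<gamma> has_vector_derivative \<alpha> *\<^sub>R ?D) (at t)"
    by (rule has_vector_derivative_transform_within_open[OF _ \<open>open I\<close> \<open>t \<in> I\<close>]) (simp add: eq)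
  have "continuous_on {0<..<1} g" using C1_exceptD(2)[OF P] by (rule continuous_on_subset) auto
  then have contg: "isCont g (?a t)" using t by (simp add: continuous_on_eq_continuous_at)
  have "isCont (\<lambda>s. g (?a s)) t"
    by (rule isCont_o2[where f = ?a and g = g]) (use contg in \<open>auto intro!: continuous_intros\<close>)
  moreover have "\<forall>\<^sub>F s in nhds t. \<gamma> s = g (?a s)"
    unfolding eventually_nhds using \<open>open I\<close> \<open>t \<in> I\<close> eq by (intro exI[of _ I]) simp
  ultimately have cont\<gamma>: "isCont \<gamma> t" by (rule isCont_cong[THEN iffD2, rotated])
  have \<gamma>t: "\<gamma> t = g (?a t)" using eq[OF \<open>t \<in> I\<close>] .
  have "speed \<gamma> t = cnorm c (snd c (\<gamma> t)) (\<alpha> *\<^sub>R ?D)"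
    using velocity_coord_vec[OF c(1) _ cont\<gamma> D'] c \<gamma>t tnorm_coord_vec[OF c] by simp
  also have "\<dots> = \<alpha> * cnorm c (snd c (g (?a t))) ?D"
    using cnorm_scale[OF c(1), of "snd c (g (?a t))"] c \<open>\<alpha> > 0\<close> \<gamma>t by simp
  also have "\<dots> = \<alpha> * speed g (?a t)" using speed_eq[OF P t c] by simp
  finally show ?thesis .
qed

end

section \<open>Concatenation of curves and the triangle inequality\<close>

context atlas
begin

text \<open>The inner condition of \<open>piecewise_C1_curve\<close>, isolated so that joining and
  lifting can be treated interval by interval.\<close>

definition C1_piece :: "(real \<Rightarrow> 'm) \<Rightarrow> real \<Rightarrow> real \<Rightarrow> bool" where
  "C1_piece \<gamma> a b \<longleftrightarrow> (\<forall>c\<in>A. \<exists>D. continuous_on ({a..b} \<inter> \<gamma> -` fst c) D \<and>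
    (\<forall>t\<in>{a..b} \<inter> \<gamma> -` fst c. (snd c \<circ> \<gamma> has_vector_derivative D t) (at t within {a..b})))"

lemma piecewise_C1_curve_iff:
  "piecewise_C1_curve A \<gamma> \<longleftrightarrow> continuous_on {0..1} \<gamma> \<and> (\<exists>P. finite P \<and>
     (\<forall>a b. 0 \<le> a \<and> a < b \<and> b \<le> 1 \<and> {a<..<b} \<inter> P = {} \<longrightarrow> C1_piece \<gamma> a b))"
  unfolding piecewise_C1_curve_def C1_piece_def ..

lemma C1_piece_affine:
  assumes g: "C1_piece g (\<alpha> * a + \<beta>) (\<alpha> * b + \<beta>)"
    and "\<alpha> > 0" and eq: "\<And>s. s \<in> {a..b} \<Longrightarrow> \<gamma> s = g (\<alpha> * s + \<beta>)"
  shows "C1_piece \<gamma> a b"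
  unfolding C1_piece_def
proof
  fix c assume "c \<in> A"
  let ?a = "\<lambda>s. \<alpha> * s + \<beta>"
  obtain D where D: "continuous_on ({?a a..?a b} \<inter> g -` fst c) D"
      "\<forall>t\<in>{?a a..?a b} \<inter> g -` fst c.
         (snd c \<circ> g has_vector_derivative D t) (at t within {?a a..?a b})"
    using bspec[OF g[unfolded C1_piece_def] \<open>c \<in> A\<close>] by (elim exE conjE)
  have im: "?a ` {a..b} \<subseteq> {?a a..?a b}" using \<open>\<alpha> > 0\<close> by auto
  have im': "?a ` ({a..b} \<inter> \<gamma> -` fst c) \<subseteq> {?a a..?a b} \<inter> g -` fst c"
    using im eq by auto
  show "\<exists>D. continuous_on ({a..b} \<inter> \<gamma> -` fst c) D \<and>
    (\<forall>t\<in>{a..b} \<inter> \<gamma> -` fst c. (snd c \<circ> \<gamma> has_vector_derivative D t) (at t within {a..b}))"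
  proof (intro exI conjI ballI)
    have "continuous_on ({a..b} \<inter> \<gamma> -` fst c) (\<lambda>t. D (?a t))"
      by (rule continuous_on_compose2[OF D(1)]) (use im' in \<open>auto intro!: continuous_intros\<close>)
    then show "continuous_on ({a..b} \<inter> \<gamma> -` fst c) (\<lambda>t. \<alpha> *\<^sub>R D (?a t))"
      by (intro continuous_on_scaleR continuous_on_const)
    fix t assume t: "t \<in> {a..b} \<inter> \<gamma> -` fst c"
    have "?a t \<in> {?a a..?a b} \<inter> g -` fst c" using t im' by blast
    then have "(snd c \<circ> g has_vector_derivative D (?a t)) (at (?a t) within {?a a..?a b})"
      using D(2) by blast
    then have Dg: "(snd c \<circ> g has_vector_derivative D (?a t)) (at (?a t) within ?a ` {a..b})"
      by (rule has_vector_derivative_within_subset[OF _ im])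
    have "(?a has_vector_derivative \<alpha>) (at t within {a..b})"
      by (auto intro!: derivative_eq_intros)
    then have "((snd c \<circ> g) \<circ> ?a has_vector_derivative \<alpha> *\<^sub>R D (?a t)) (at t within {a..b})"
      by (rule vector_diff_chain_within[OF _ Dg])
    then show "(snd c \<circ> \<gamma> has_vector_derivative \<alpha> *\<^sub>R D (?a t)) (at t within {a..b})"
      by (rule has_vector_derivative_transform[rotated 2]) (use t eq in auto)
  qed
qed

text \<open>The break points are those of both curves, rescaled to their halves, together with 1/2.
  An interval without break points in its interior then lies in one half, where the join is an
  affine reparametrisation of one curve.\<close>

lemma piecewise_C1_curve_join:
  assumes g1: "piecewise_C1_curve A g1" and g2: "piecewise_C1_curve A g2" and eq: "g1 1 = g2 0"
  shows "piecewise_C1_curve A (g1 +++ g2)"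
proof -
  obtain P1 where P1: "continuous_on {0..1} g1" "finite P1" and
    D1: "\<forall>a b. 0 \<le> a \<and> a < b \<and> b \<le> 1 \<and> {a<..<b} \<inter> P1 = {} \<longrightarrow> C1_piece g1 a b"
    using g1 unfolding piecewise_C1_curve_iff by blast
  obtain P2 where P2: "continuous_on {0..1} g2" "finite P2" and
    D2: "\<forall>a b. 0 \<le> a \<and> a < b \<and> b \<le> 1 \<and> {a<..<b} \<inter> P2 = {} \<longrightarrow> C1_piece g2 a b"
    using g2 unfolding piecewise_C1_curve_iff by blast
  define P where "P = {1/2} \<union> (\<lambda>t. t / 2) ` P1 \<union> (\<lambda>t. (t + 1) / 2) ` P2"
  have "continuous_on {0..1} (g1 +++ g2)"
    using path_join_imp[of g1 g2] P1(1) P2(1) eq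
    by (simp add: path_def pathfinish_def pathstart_def)
  moreover have "finite P" using P1(2) P2(2) by (simp add: P_def)
  moreover have "C1_piece (g1 +++ g2) a b"
    if ab: "0 \<le> a \<and> a < b \<and> b \<le> 1 \<and> {a<..<b} \<inter> P = {}" for a b
  proof -
    have notP: "t \<notin> P" if "a < t" "t < b" for t
      using ab that by auto
    moreover have "1/2 \<in> P" by (simp add: P_def)
    ultimately have "\<not> (a < 1/2 \<and> 1/2 < b)" by blast
    then consider "b \<le> 1/2" | "a \<ge> 1/2" by linarith
    then show ?thesis
    proof cases
      case 1
      have "t \<notin> P1" if "2 * a + 0 < t" "t < 2 * b + 0" for t
        using notP[of "t / 2"] that by (auto simp: P_def)
      then have "C1_piece g1 (2 * a + 0) (2 * b + 0)"
        using ab 1 by (intro D1[rule_format]) auto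
      then show ?thesis
      proof (rule C1_piece_affine)
        show "(g1 +++ g2) s = g1 (2 * s + 0)" if "s \<in> {a..b}" for s
          using 1 that by (simp add: joinpaths_def)
      qed simp
    next
      case 2
      have "t \<notin> P2" if "2 * a + -1 < t" "t < 2 * b + -1" for t
        using notP[of "(t + 1) / 2"] that by (auto simp: P_def)
      then have "C1_piece g2 (2 * a + -1) (2 * b + -1)"
        using ab 2 by (intro D2[rule_format]) auto
      then show ?thesis
      proof (rule C1_piece_affine)
        show "(g1 +++ g2) s = g2 (2 * s + -1)" if "s \<in> {a..b}" for s
        \<comment> \<open>At 1/2 the join takes its value from \<open>g1\<close>, so the matching of
          the end points is used here.\<close>
        proof (cases "s = 1/2")
          case True
          show ?thesis unfolding True by (simp add: joinpaths_def eq)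
        next
          case False
          then show ?thesis using 2 that by (simp add: joinpaths_def)
        qed
      qed simp
    qed
  qed
  ultimately show ?thesis unfolding piecewise_C1_curve_iff by blast
qed

end

context riemannian
begin

text \<open>On each half the doubled speed cancels the factor 1/2 of the substitution in the
  integral. The null set \<open>N\<close> collects the end points, the junction and the rescaled
  exceptional times.\<close>

lemma curve_length_join:
  assumes g1: "piecewise_C1_curve A g1" and g2: "piecewise_C1_curve A g2"
  shows "curve_length A h (g1 +++ g2) \<le> curve_length A h g1 + curve_length A h g2"
proof -
  obtain P1 where P1: "C1_except P1 g1" using piecewise_C1_curve_C1_except[OF g1] .
  obtain P2 where P2: "C1_except P2 g2" using piecewise_C1_curve_C1_except[OF g2] .
  define G1 where "G1 t = ennreal (speed g1 t) * indicator ({0<..<1} - P1) t" for t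
  define G2 where "G2 t = ennreal (speed g2 t) * indicator ({0<..<1} - P2) t" for t
  have G1[measurable]: "G1 \<in> borel_measurable borel" unfolding G1_def by (rule speed_borel[OF P1])
  have G2[measurable]: "G2 \<in> borel_measurable borel" unfolding G2_def by (rule speed_borel[OF P2])
  define N where "N = {0, 1, 1/2} \<union> (\<lambda>t. t / 2) ` P1 \<union> (\<lambda>t. (t + 1) / 2) ` P2"
  have "finite N" using C1_exceptD(1)[OF P1] C1_exceptD(1)[OF P2] by (simp add: N_def)
  then have AE: "AE t in lborel. t \<notin> N" by (intro AE_not_in finite_imp_null_set_lborel)
  have le: "ennreal (speed (g1 +++ g2) t) * indicator {0..1} t \<le> 2 * G1 (0 + 2 * t) + 2 * G2 (-1 + 2 * t)"
    if "t \<notin> N" for t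
  proof (cases "t \<in> {0..1}")
    case True
    then have t: "0 < t" "t < 1" "t \<noteq> 1/2" using that by (auto simp: N_def less_le)
    have tP: "2 * t \<notin> P1" "2 * t - 1 \<notin> P2"
    proof -
      show "2 * t \<notin> P1"
        using that imageI[of "2 * t" P1 "\<lambda>t. t / 2"] by (auto simp: N_def)
      show "2 * t - 1 \<notin> P2"
        using that imageI[of "2 * t - 1" P2 "\<lambda>t. (t + 1) / 2"] by (auto simp: N_def)
    qed
    show ?thesis
    proof (cases "t < 1/2")
      case True
      have "speed (g1 +++ g2) t = 2 * speed g1 (2 * t + 0)"
      proof (rule speed_affine[OF P1])
        show "open {..<1/2::real}" by simp
        show "(g1 +++ g2) s = g1 (2 * s + 0)" if "s \<in> {..<1/2}" for s
          using that by (simp add: joinpaths_def)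
      qed (use True t tP in simp_all)
      then have "ennreal (speed (g1 +++ g2) t) = 2 * G1 (0 + 2 * t)"
        using True t tP by (simp add: G1_def ennreal_mult')
      then show ?thesis using t by simp
    next
      case False
      have "speed (g1 +++ g2) t = 2 * speed g2 (2 * t + -1)"
      proof (rule speed_affine[OF P2])
        show "open {1/2::real<..}" by simp
        show "(g1 +++ g2) s = g2 (2 * s + -1)" if "s \<in> {1/2<..}" for s
          using that by (simp add: joinpaths_def)
      qed (use False t tP in simp_all)
      then have "ennreal (speed (g1 +++ g2) t) = 2 * G2 (-1 + 2 * t)"
        using False t tP by (simp add: G2_def ennreal_mult')
      then show ?thesis using t by simp
    qed
  qed simp
  have "curve_length A h (g1 +++ g2) \<le> (\<integral>\<^sup>+t. 2 * G1 (0 + 2 * t) + 2 * G2 (-1 + 2 * t) \<partial>lborel)"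
    unfolding curve_length_def
    by (rule nn_integral_mono_AE) (rule eventually_mono[OF AE le])
  also have "\<dots> = 2 * (\<integral>\<^sup>+t. G1 (0 + 2 * t) \<partial>lborel) + 2 * (\<integral>\<^sup>+t. G2 (-1 + 2 * t) \<partial>lborel)"
    by (subst nn_integral_add, measurable, subst nn_integral_cmult, measurable,
        subst nn_integral_cmult, measurable)
  also have "\<dots> = (\<integral>\<^sup>+t. G1 t \<partial>lborel) + (\<integral>\<^sup>+t. G2 t \<partial>lborel)"
    by (subst nn_integral_real_affine[OF G1, of 2 0], simp,
        subst nn_integral_real_affine[OF G2, of 2 "-1"]) simp_all
  also have "\<dots> = curve_length A h g1 + curve_length A h g2"
    by (simp add: curve_length_eq[OF P1] curve_length_eq[OF P2] G1_def G2_def)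
  finally show ?thesis .
qed

text \<open>Strict bounds by reals let one choose curves of length below the bounds and join them,
  without any approximation of the infima.\<close>

lemma riemannian_dist_triangle_less:
  assumes "riemannian_dist A h x y < ennreal a" "riemannian_dist A h y z < ennreal b"
  shows "riemannian_dist A h x z < ennreal (a + b)"
proof -
  obtain g1 where g1: "piecewise_C1_curve A g1" "g1 0 = x" "g1 1 = y" "curve_length A h g1 < ennreal a"
    using riemannian_dist_lessE[OF assms(1)] .
  obtain g2 where g2: "piecewise_C1_curve A g2" "g2 0 = y" "g2 1 = z" "curve_length A h g2 < ennreal b"
    using riemannian_dist_lessE[OF assms(2)] .
  have "0 < ennreal a" "0 < ennreal b"
    using le_less_trans[OF zero_le g1(4)] le_less_trans[OF zero_le g2(4)] by blast+
  then have pos: "0 < a" "0 < b" by (simp_all add: ennreal_less_zero_iff)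
  obtain l1 l2 where l: "curve_length A h g1 = ennreal l1" "0 \<le> l1" "curve_length A h g2 = ennreal l2" "0 \<le> l2"
    using g1(4) g2(4) by (cases "curve_length A h g1"; cases "curve_length A h g2") auto
  have "riemannian_dist A h x z \<le> curve_length A h (g1 +++ g2)"
    using riemannian_dist_le[OF piecewise_C1_curve_join[OF g1(1) g2(1)]] g1 g2
    by (simp add: joinpaths_def)
  also have "\<dots> \<le> ennreal l1 + ennreal l2"
    using curve_length_join[OF g1(1) g2(1)] l by simp
  also have "\<dots> < ennreal (a + b)"
    using g1(4) g2(4) l pos by (simp add: ennreal_less_iff flip: ennreal_plus)
  finally show ?thesis .
qed

end

section \<open>Lifting curves through local inverses\<close>

locale riemannian_map = riemannian A h
  for A :: "('m::t2_space, 'e::euclidean_space) chart set" and h +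
  fixes f :: "'m \<Rightarrow> 'm" and r :: enat
  assumes f: "Cr_map A r f" and r: "1 \<le> r"
begin

lemma continuous_f: "continuous_on UNIV f"
  using f by (simp add: Cr_map_def)

lemma open_vimage_f: "open V \<Longrightarrow> open (f -` V)"
  using continuous_f by (simp add: continuous_on_open_vimage)

text \<open>A domain on which \<open>f\<close> has a single-valued inverse, with one chart at each
  side so that all derivatives become maps of Euclidean space. The inequality says that the inverse
  contracts Riemannian lengths by the factor \<mu>.\<close>

definition expanding_branch :: "real \<Rightarrow> ('m, 'e) chart \<Rightarrow> ('m, 'e) chart \<Rightarrow> 'm set \<Rightarrow> bool" where
  "expanding_branch \<mu> c d W \<longleftrightarrow> c \<in> A \<and> d \<in> A \<and> open W \<and> W \<subseteq> fst c \<and> f ` W \<subseteq> fst d \<and> inj_on f W \<and>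
     (\<forall>y\<in>W. \<forall>u. \<mu> * cnorm c (snd c y) u \<le> cnorm d (snd d (f y)) (map_derivative f c d (snd c y) u))"

lemma expanding_branchD:
  assumes "expanding_branch \<mu> c d W"
  shows "c \<in> A" "d \<in> A" "open W" "W \<subseteq> fst c" "f ` W \<subseteq> fst d" "inj_on f W"
    "\<And>y u. y \<in> W \<Longrightarrow> \<mu> * cnorm c (snd c y) u \<le> cnorm d (snd d (f y)) (map_derivative f c d (snd c y) u)"
  using assms unfolding expanding_branch_def by blast+

lemma expanding_branch_subset:
  assumes "expanding_branch \<mu> c d W" "open W'" "W' \<subseteq> W"
  shows "expanding_branch \<mu> c d W'"
  unfolding expanding_branch_def
proof (intro conjI ballI allI)
  note W = expanding_branchD[OF assms(1)]
  show "W' \<subseteq> fst c" "f ` W' \<subseteq> fst d" using W(4,5) assms(3) by blast+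
  show "inj_on f W'" using W(6) assms(3) by (rule inj_on_subset)
  show "\<mu> * cnorm c (snd c y) u \<le> cnorm d (snd d (f y)) (map_derivative f c d (snd c y) u)"
    if "y \<in> W'" for y u using W(7) assms(3) that by blast
qed (rule expanding_branchD[OF assms(1)] assms(2))+

lemma local_map_on_branch:
  assumes "expanding_branch \<mu> c d W"
  shows "open (snd c ` W)" "snd c ` W \<subseteq> snd c ` (fst c \<inter> f -` fst d)"
    "continuous_on (snd c ` W) (snd d \<circ> f \<circ> chart_inv c)" "inj_on (snd d \<circ> f \<circ> chart_inv c) (snd c ` W)"
proof -
  note W = expanding_branchD[OF assms]
  show "open (snd c ` W)" by (rule open_image_chart[OF W(1,3,4)])
  show sub: "snd c ` W \<subseteq> snd c ` (fst c \<inter> f -` fst d)" using W(4,5) by (intro image_mono) blast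
  show "continuous_on (snd c ` W) (snd d \<circ> f \<circ> chart_inv c)"
    by (rule continuous_on_subset[OF Cr_map_local(2)[OF f r W(1,2)] sub])
  show "inj_on (snd d \<circ> f \<circ> chart_inv c) (snd c ` W)"
  proof (rule inj_onI)
    fix q q' assume "q \<in> snd c ` W" "q' \<in> snd c ` W"
      and eq: "(snd d \<circ> f \<circ> chart_inv c) q = (snd d \<circ> f \<circ> chart_inv c) q'"
    then obtain y y' where y: "y \<in> W" "q = snd c y" and y': "y' \<in> W" "q' = snd c y'" by blast
    have "y \<in> fst c" "y' \<in> fst c" "f y \<in> fst d" "f y' \<in> fst d" using y y' W(4,5) by blast+
    then have "snd d (f y) = snd d (f y')" using eq y y' W(1) by simp
    then have "f y = f y'" using chart_inv_chart[OF W(2)] \<open>f y \<in> fst d\<close> \<open>f y' \<in> fst d\<close> by metis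
    then show "q = q'" using W(6) y y' by (simp add: inj_on_eq_iff)
  qed
qed

text \<open>Invariance of domain, applied to the local representative of \<open>f\<close> between
  the two charts.\<close>

lemma open_branch_image:
  assumes "expanding_branch \<mu> c d W"
  shows "open (f ` W)"
proof -
  note W = expanding_branchD[OF assms]
  let ?F = "snd d \<circ> f \<circ> chart_inv c"
  have "f ` W = fst d \<inter> snd d -` (?F ` snd c ` W)"
  proof (intro equalityI subsetI)
    fix z assume "z \<in> f ` W"
    then obtain y where y: "y \<in> W" "z = f y" by blast
    then have "snd d z = ?F (snd c y)" using W(1,4) by (simp add: subset_iff)
    then show "z \<in> fst d \<inter> snd d -` (?F ` snd c ` W)" using y W(5) by blast
  next
    fix z assume z: "z \<in> fst d \<inter> snd d -` (?F ` snd c ` W)"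
    then obtain y where y: "y \<in> W" "snd d z = ?F (snd c y)" by blast
    then have "snd d z = snd d (f y)" using W(1,4) by (simp add: subset_iff)
    moreover have "f y \<in> fst d" using y W(5) by blast
    ultimately have "z = f y" using chart_inv_chart[OF W(2)] z by (metis IntD1)
    then show "z \<in> f ` W" using y by blast
  qed
  moreover have "open (?F ` snd c ` W)"
    using local_map_on_branch[OF assms] by (intro invariance_of_domain)
  ultimately show ?thesis using open_vimage_chart[OF W(2)] by simp
qed

text \<open>Preimages under the inverse are images under \<open>f\<close> of smaller open sets,
  which are expanding branches themselves and so have open images.\<close>

lemma continuous_on_branch_inverse:
  assumes "expanding_branch \<mu> c d W"
  shows "continuous_on (f ` W) (inv_into W f)"
proof -
  note W = expanding_branchD[OF assms]
  have "open (inv_into W f -` B \<inter> f ` W)" if "open B" for B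
  proof -
    have "inv_into W f -` B \<inter> f ` W = f ` (W \<inter> B)" using W(6) by auto
    moreover have "expanding_branch \<mu> c d (W \<inter> B)"
      using assms W(3) that by (intro expanding_branch_subset[OF assms]) auto
    ultimately show ?thesis using open_branch_image by metis
  qed
  then show ?thesis by (simp add: continuous_on_open_vimage[OF open_branch_image[OF assms]])
qed

context
  fixes \<mu> :: real and c d W \<gamma> \<tau>
  assumes W: "expanding_branch \<mu> c d W" and \<mu>: "\<mu> > 0"
    and \<tau>: "continuous_on {0..1::real} \<tau>" "\<And>t. t \<in> {0..1} \<Longrightarrow> \<tau> t \<in> W" "\<And>t. t \<in> {0..1} \<Longrightarrow> f (\<tau> t) = \<gamma> t"
begin

text \<open>Expansion with \<mu> > 0 makes the local derivative of \<open>f\<close> injective at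
  every point of \<open>W\<close>. So the coordinates of the continuous lift \<tau> inherit
  derivatives from \<gamma>, and these depend continuously on time.\<close>

lemma C1_piece_lift:
  assumes \<gamma>: "C1_piece \<gamma> a b" and ab: "0 \<le> a" "b \<le> 1"
  shows "C1_piece \<tau> a b"
proof -
  note W = expanding_branchD[OF W] local_map_on_branch[OF W]
  let ?F = "snd d \<circ> f \<circ> chart_inv c" and ?F' = "map_derivative f c d"
  have sub: "t \<in> {0..1}" if "t \<in> {a..b}" for t using that ab by simp
  have \<tau>c: "\<tau> t \<in> fst c" if "t \<in> {a..b}" for t using \<tau>(2)[OF sub[OF that]] W(4) by blast
  have \<gamma>d: "\<gamma> t \<in> fst d" if "t \<in> {a..b}" for t
    using \<tau>(2,3)[OF sub[OF that]] W(5) by (metis image_eqI subsetD)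
  have "{a..b} \<inter> \<gamma> -` fst d = {a..b}" using \<gamma>d by blast
  then obtain D where D: "continuous_on {a..b} D"
    "\<forall>t\<in>{a..b}. (snd d \<circ> \<gamma> has_vector_derivative D t) (at t within {a..b})"
    using bspec[OF \<gamma>[unfolded C1_piece_def] W(2)] by (elim exE conjE) simp
  have F\<tau>: "(?F \<circ> (snd c \<circ> \<tau>)) t = (snd d \<circ> \<gamma>) t" if "t \<in> {a..b}" for t
    using \<tau>c[OF that] \<tau>(3)[OF sub[OF that]] W(1) by simp
  have cont: "continuous_on {a..b} (snd c \<circ> \<tau>)"
    by (rule continuous_on_compose[OF continuous_on_subset[OF \<tau>(1)]
          continuous_on_subset[OF continuous_on_chart[OF W(1)]]]) (use sub \<tau>c in auto)
  have in_W: "(snd c \<circ> \<tau>) t \<in> snd c ` W" if "t \<in> {a..b}" for t using \<tau>(2)[OF sub[OF that]] by simp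
  have inj: "u = 0" if q: "q \<in> snd c ` W" and Fu: "?F' q u = 0" for q u
  proof (rule ccontr)
    assume "u \<noteq> 0"
    obtain y where y: "y \<in> W" "q = snd c y" using q by blast
    have "y \<in> fst c" "f y \<in> fst d" using y W(4,5) by blast+
    have "\<mu> * cnorm c q u \<le> 0"
      using W(7)[OF y(1), of u] y(2) Fu cnorm_zero[OF W(2)] \<open>f y \<in> fst d\<close> by simp
    moreover have "cnorm c q u > 0" using cnorm_pos[OF W(1) _ \<open>u \<noteq> 0\<close>] y \<open>y \<in> fst c\<close> by simp
    ultimately show False using \<mu> by (simp add: mult_le_0_iff)
  qed
  have "\<exists>w. ?F' ((snd c \<circ> \<tau>) t) w = D t \<and> (snd c \<circ> \<tau> has_vector_derivative w) (at t within {a..b})"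
    if t: "t \<in> {a..b}" for t
  proof -
    have D': "(?F \<circ> (snd c \<circ> \<tau>) has_vector_derivative D t) (at t within {a..b})"
      by (rule has_vector_derivative_transform[OF t F\<tau> bspec[OF D(2) t]])
    have der: "(?F has_derivative ?F' ((snd c \<circ> \<tau>) t)) (at ((snd c \<circ> \<tau>) t))"
      by (rule Cr_map_local(3)[OF f r W(1,2)], rule subsetD[OF W(9)], rule in_W[OF t])
    have ctw: "continuous (at t within {a..b}) (snd c \<circ> \<tau>)"
      using cont t continuous_on_eq_continuous_within by blast
    show ?thesis
      by (rule lift_has_vector_derivative[OF W(8,10,11) der inj[OF in_W[OF t]] ctw in_W[OF t] t D']) blast+
  qed
  then obtain w where w: "\<And>t. t \<in> {a..b} \<Longrightarrow> ?F' ((snd c \<circ> \<tau>) t) (w t) = D t"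
    "\<And>t. t \<in> {a..b} \<Longrightarrow> (snd c \<circ> \<tau> has_vector_derivative w t) (at t within {a..b})"
    by metis
  have "continuous_on {a..b} w"
  proof (rule lift_derivative_continuous[where L = ?F' and \<tau> = "snd c \<circ> \<tau>" and D = D,
        OF W(8) cont _ _ _ inj w(1) D(1)])
    show "(snd c \<circ> \<tau>) ` {a..b} \<subseteq> snd c ` W" using in_W by blast
    show "continuous_on (snd c ` W) (\<lambda>x. ?F' x v)" for v
      by (rule continuous_on_subset[OF Cr_map_local(5)[OF f r W(1,2)] W(9)])
    show "linear (?F' q)" if "q \<in> snd c ` W" for q
      by (rule Cr_map_local(4)[OF f r W(1,2) subsetD[OF W(9) that]])
  qed
  then show ?thesis
    unfolding C1_piece_def by (intro ballI C1_curve_other_chart[OF W(1) _ \<tau>c w(2)])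
qed

text \<open>By the chain rule the velocity of \<gamma> is the image under the derivative of
  \<open>f\<close> of the velocity of \<tau>, and that derivative expands by \<mu>.\<close>

lemma speed_lift:
  assumes P: "C1_except P \<gamma>" and P': "C1_except P' \<tau>" and t: "t \<in> {0<..<1}" "t \<notin> P" "t \<notin> P'"
  shows "\<mu> * speed \<tau> t \<le> speed \<gamma> t"
proof -
  note W = expanding_branchD[OF W] local_map_on_branch[OF W]
  let ?F = "snd d \<circ> f \<circ> chart_inv c" and ?F' = "map_derivative f c d"
  let ?w = "vector_derivative (snd c \<circ> \<tau>) (at t)"
  have tP: "t \<in> {0<..<1} - P" "t \<in> {0<..<1} - P'" using t by auto
  have in01: "s \<in> {0..1}" if "s \<in> {0<..<1}" for s :: real using that by simp
  have \<tau>c: "\<tau> s \<in> fst c" if "s \<in> {0<..<1}" for s using \<tau>(2)[OF in01[OF that]] W(4) by blast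
  have \<gamma>d: "\<gamma> t \<in> fst d" using \<tau>(2,3)[OF in01[OF t(1)]] W(5) by (metis image_eqI subsetD)
  have "(?F has_derivative ?F' ((snd c \<circ> \<tau>) t)) (at ((snd c \<circ> \<tau>) t))"
    by (rule Cr_map_local(3)[OF f r W(1,2)], rule subsetD[OF W(9)])
      (use \<tau>(2)[OF in01[OF t(1)]] in simp)
  then have "(?F \<circ> (snd c \<circ> \<tau>) has_vector_derivative ?F' ((snd c \<circ> \<tau>) t) ?w) (at t)"
    by (rule vector_derivative_diff_chain_within[OF C1_exceptD(3)[OF P' W(1) tP(2) \<tau>c[OF t(1)]]
          has_derivative_at_withinI])
  then have "(snd d \<circ> \<gamma> has_vector_derivative ?F' ((snd c \<circ> \<tau>) t) ?w) (at t)"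
    by (rule has_vector_derivative_transform_within_open[OF _ open_greaterThanLessThan t(1)])
      (use \<tau>c \<tau>(3) in01 W(1) in simp)
  then have "vector_derivative (snd d \<circ> \<gamma>) (at t) = ?F' (snd c (\<tau> t)) ?w"
    by (simp add: vector_derivative_at)
  then have "speed \<gamma> t = cnorm d (snd d (f (\<tau> t))) (?F' (snd c (\<tau> t)) ?w)"
    using speed_eq[OF P tP(1) W(2) \<gamma>d] \<tau>(3)[OF in01[OF t(1)]] by simp
  moreover have "speed \<tau> t = cnorm c (snd c (\<tau> t)) ?w"
    by (rule speed_eq[OF P' tP(2) W(1) \<tau>c[OF t(1)]])
  ultimately show ?thesis using W(7)[OF \<tau>(2)[OF in01[OF t(1)]]] by simp
qed

text \<open>The break points of \<gamma> serve for \<tau> as well. In the length estimate the two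
  curves come with exceptional sets of their own, so the speeds are compared off the union.\<close>

lemma piecewise_C1_curve_lift:
  assumes "piecewise_C1_curve A \<gamma>"
  shows "piecewise_C1_curve A \<tau>" "ennreal \<mu> * curve_length A h \<tau> \<le> curve_length A h \<gamma>"
proof -
  show p: "piecewise_C1_curve A \<tau>"
  proof -
    obtain P where "finite P" and
      P: "\<forall>a b. 0 \<le> a \<and> a < b \<and> b \<le> 1 \<and> {a<..<b} \<inter> P = {} \<longrightarrow> C1_piece \<gamma> a b"
      using assms unfolding piecewise_C1_curve_iff by blast
    have "C1_piece \<tau> a b" if ab: "0 \<le> a \<and> a < b \<and> b \<le> 1 \<and> {a<..<b} \<inter> P = {}" for a b
      by (rule C1_piece_lift[OF P[rule_format, OF ab]]) (use ab in simp_all)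
    then show ?thesis
      unfolding piecewise_C1_curve_iff using \<tau>(1) \<open>finite P\<close> by (intro conjI exI[of _ P]) simp_all
  qed
  obtain P where P: "C1_except P \<gamma>" using piecewise_C1_curve_C1_except[OF assms] .
  obtain P' where P': "C1_except P' \<tau>" using piecewise_C1_curve_C1_except[OF p] .
  have "AE t in lborel. t \<notin> P \<union> P'"
    using C1_exceptD(1)[OF P] C1_exceptD(1)[OF P'] by (intro AE_not_in finite_imp_null_set_lborel) simp
  then have AE: "AE t in lborel. ennreal \<mu> * (ennreal (speed \<tau> t) * indicator ({0<..<1} - P') t) \<le>
      ennreal (speed \<gamma> t) * indicator ({0<..<1} - P) t"
  proof (rule eventually_mono)
    fix t assume "t \<notin> P \<union> P'"
    then show "ennreal \<mu> * (ennreal (speed \<tau> t) * indicator ({0<..<1} - P') t) \<le>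
      ennreal (speed \<gamma> t) * indicator ({0<..<1} - P) t"
      using speed_lift[OF P P', of t] \<mu> ennreal_leI[of "\<mu> * speed \<tau> t" "speed \<gamma> t"]
      by (cases "t \<in> {0<..<1}") (simp_all add: ennreal_mult')
  qed
  have "ennreal \<mu> * curve_length A h \<tau> =
      (\<integral>\<^sup>+t. ennreal \<mu> * (ennreal (speed \<tau> t) * indicator ({0<..<1} - P') t) \<partial>lborel)"
    unfolding curve_length_eq[OF P'] by (rule nn_integral_cmult[symmetric]) (simp add: speed_borel[OF P'])
  also have "\<dots> \<le> curve_length A h \<gamma>"
    unfolding curve_length_eq[OF P] by (rule nn_integral_mono_AE[OF AE])
  finally show "ennreal \<mu> * curve_length A h \<tau> \<le> curve_length A h \<gamma>" .
qed

end

text \<open>The curve lies entirely in the image of the branch, so its lift is the composition with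
  the inverse of the branch.\<close>

lemma lift_curve:
  assumes W: "expanding_branch \<mu> c d W" and \<mu>: "\<mu> > 0" and \<gamma>: "piecewise_C1_curve A \<gamma>"
    and im: "\<And>t. t \<in> {0..1} \<Longrightarrow> \<gamma> t \<in> f ` W"
  obtains \<tau> where "piecewise_C1_curve A \<tau>" "\<And>t. t \<in> {0..1} \<Longrightarrow> \<tau> t \<in> W"
    "\<And>t. t \<in> {0..1} \<Longrightarrow> f (\<tau> t) = \<gamma> t" "ennreal \<mu> * curve_length A h \<tau> \<le> curve_length A h \<gamma>"
proof -
  let ?\<tau> = "\<lambda>t. inv_into W f (\<gamma> t)"
  have cont: "continuous_on {0..1} ?\<tau>"
    by (rule continuous_on_compose2[OF continuous_on_branch_inverse[OF W]])
      (use \<gamma> im in \<open>auto simp: piecewise_C1_curve_def\<close>)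
  have in_W: "?\<tau> t \<in> W" if "t \<in> {0..1}" for t using im[OF that] by (rule inv_into_into)
  have f\<tau>: "f (?\<tau> t) = \<gamma> t" if "t \<in> {0..1}" for t using im[OF that] by (rule f_inv_into_f)
  show ?thesis
    by (rule that[OF piecewise_C1_curve_lift(1)[OF W \<mu> cont in_W f\<tau> \<gamma>] in_W f\<tau>
          piecewise_C1_curve_lift(2)[OF W \<mu> cont in_W f\<tau> \<gamma>]])
qed

text \<open>Expansion is known only at the point \<open>x\<close>, with rate \<open>l\<close>. The
  gap between \<mu> and \<open>l\<close> gives a strict inequality on the unit sphere at
  \<open>x\<close>, which spreads to nearby points; expansion at \<open>x\<close> also makes the
  derivative injective, which gives local injectivity of \<open>f\<close>.\<close>

lemma expanding_branch_exists:
  assumes exp: "\<And>v. v \<in> tangent_space A x \<Longrightarrow> l * tnorm h x v \<le> tnorm h (f x) (tangent_map A f x v)"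
    and \<mu>: "0 < \<mu>" "\<mu> < l" and V: "open V" "x \<in> V"
  obtains c d W where "expanding_branch \<mu> c d W" "x \<in> W" "W \<subseteq> V"
proof -
  obtain c where c: "c \<in> A" "x \<in> fst c" by (rule chart_around)
  obtain d where d: "d \<in> A" "f x \<in> fst d" by (rule chart_around)
  let ?S = "snd c ` (fst c \<inter> f -` fst d)" and ?F = "snd d \<circ> f \<circ> chart_inv c" and ?F' = "map_derivative f c d"
  let ?q = "snd c x"
  note loc = Cr_map_local[OF f r c(1) d(1)]
  have q: "?q \<in> ?S" using c d by simp
  have ge: "l * cnorm c ?q u \<le> cnorm d (?F ?q) (?F' ?q u)" for u
    using exp[OF coord_vec_in_tangent_space[OF c, of u]] tangent_map_coord_vec[OF f r c d, of u]
      tnorm_coord_vec[OF c] tnorm_coord_vec[OF d] c by simp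
  have cont1: "continuous_on (?S \<times> UNIV) (\<lambda>p. cnorm c (fst p) (snd p))"
    using continuous_on_subset[OF continuous_on_cnorm[OF c(1)], of "?S \<times> UNIV"]
    by (simp add: case_prod_unfold image_mono Sigma_mono)
  have "continuous_on (?S \<times> UNIV) (\<lambda>p. ?F' (fst p) (snd p))"
    using continuous_on_linear_family[of ?S ?F'] loc(4,5) by (simp add: case_prod_unfold)
  moreover have "continuous_on (?S \<times> (UNIV::'e set)) (\<lambda>p. ?F (fst p))"
    by (rule continuous_on_compose2[OF loc(2)]) (auto intro: continuous_on_fst continuous_on_id)
  ultimately have "continuous_on (?S \<times> UNIV) (\<lambda>p. (?F (fst p), ?F' (fst p) (snd p)))"
    by (intro continuous_on_Pair)
  then have cont2: "continuous_on (?S \<times> UNIV) (\<lambda>p. (\<lambda>(q, u). cnorm d q u) (?F (fst p), ?F' (fst p) (snd p)))"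
    by (rule continuous_on_compose2[OF continuous_on_cnorm[OF d(1)]]) (use c in auto)
  have cont: "continuous_on (?S \<times> UNIV) (\<lambda>(q, u). cnorm d (?F q) (?F' q u) - \<mu> * cnorm c q u)"
    using continuous_on_diff[OF cont2 continuous_on_mult_left[OF cont1, of \<mu>]] by (simp add: case_prod_unfold)
  have pos: "cnorm d (?F ?q) (?F' ?q u) - \<mu> * cnorm c ?q u > 0" if "u \<in> sphere 0 1" for u
  proof -
    have "cnorm c ?q u > 0" using that c by (intro cnorm_pos) auto
    then have "\<mu> * cnorm c ?q u < l * cnorm c ?q u" using \<mu> by simp
    then show ?thesis using ge[of u] by simp
  qed
  obtain U where U: "open U" "?q \<in> U" "U \<subseteq> ?S"
    "\<And>q u. q \<in> U \<Longrightarrow> u \<in> sphere 0 1 \<Longrightarrow> cnorm d (?F q) (?F' q u) - \<mu> * cnorm c q u > 0"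
    using eventually_pos_on_compact[OF cont loc(1) q compact_sphere pos] by metis
  have inj0: "u = 0" if "?F' ?q u = 0" for u
  proof (rule ccontr)
    assume "u \<noteq> 0"
    then have "cnorm c ?q u > 0" using c by (intro cnorm_pos) auto
    moreover have "?F ?q \<in> snd d ` fst d" using c d by simp
    ultimately show False using ge[of u] that cnorm_zero[OF d(1)] \<mu> by (simp add: mult_le_0_iff)
  qed
  obtain e where e: "e > 0" "ball ?q e \<subseteq> ?S" "inj_on ?F (ball ?q e)"
    using locally_injective_C1[OF loc(1) q loc(3) loc(5) inj0] by blast
  define W where "W = (fst c \<inter> snd c -` (U \<inter> ball ?q e)) \<inter> V"
  have "open W"
    unfolding W_def using U(1) V(1) by (intro open_Int open_vimage_chart c) simp_all
  moreover have "x \<in> W" using c V(2) U(2) e(1) by (simp add: W_def)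
  moreover have Wc: "W \<subseteq> fst c" "W \<subseteq> V" by (auto simp: W_def)
  moreover have Wd: "f y \<in> fst d" if "y \<in> W" for y
  proof -
    have "snd c y \<in> ?S" "y \<in> fst c" using that U(3) by (auto simp: W_def)
    then obtain y' where "y' \<in> fst c" "f y' \<in> fst d" "snd c y = snd c y'" by blast
    then have "y = y'" using chart_inv_chart[OF c(1)] \<open>y \<in> fst c\<close> by metis
    then show ?thesis using \<open>f y' \<in> fst d\<close> by simp
  qed
  moreover have "inj_on f W"
  proof (rule inj_onI)
    fix y y' assume y: "y \<in> W" and y': "y' \<in> W" and eq: "f y = f y'"
    have "?F (snd c y) = ?F (snd c y')" using y y' Wc(1) eq c(1) by (simp add: subset_iff)
    then have "snd c y = snd c y'" by (rule inj_onD[OF e(3)]) (use y y' in \<open>simp_all add: W_def\<close>)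
    then show "y = y'" using chart_inv_chart[OF c(1)] y y' Wc(1) by (metis subsetD)
  qed
  moreover have "\<mu> * cnorm c (snd c y) u \<le> cnorm d (snd d (f y)) (?F' (snd c y) u)" if "y \<in> W" for y u
  proof -
    have y: "y \<in> fst c" "snd c y \<in> U" using that by (auto simp: W_def)
    have Fy: "?F (snd c y) = snd d (f y)" using y c by simp
    show ?thesis
    proof (cases "u = 0")
      case True
      have "?F' (snd c y) 0 = 0" using loc(4)[of "snd c y"] U(3) y(2) linear_0 by blast
      then show ?thesis using True cnorm_zero[OF c(1), of "snd c y"] cnorm_zero[OF d(1), of "snd d (f y)"] y Wd[OF that] by simp
    next
      case False
      define v where "v = u /\<^sub>R norm u"
      have v: "v \<in> sphere 0 1" "u = norm u *\<^sub>R v" using False by (simp_all add: v_def)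
      have "linear (?F' (snd c y))" using loc(4)[of "snd c y"] U(3) y(2) by blast
      then have "?F' (snd c y) u = norm u *\<^sub>R ?F' (snd c y) v" using v(2) linear_scale by metis
      then have "cnorm d (snd d (f y)) (?F' (snd c y) u) = norm u * cnorm d (snd d (f y)) (?F' (snd c y) v)"
        using cnorm_scale[OF d(1), of "snd d (f y)" "norm u"] Wd[OF that] by simp
      moreover have "cnorm c (snd c y) u = norm u * cnorm c (snd c y) v"
        using cnorm_scale[OF c(1), of "snd c y" "norm u" v] v(2) y by simp
      moreover have "\<mu> * cnorm c (snd c y) v \<le> cnorm d (snd d (f y)) (?F' (snd c y) v)"
        using U(4)[OF y(2) v(1)] Fy by simp
      ultimately show ?thesis
        using mult_left_mono[of "\<mu> * cnorm c (snd c y) v" _ "norm u"] by (simp add: mult.left_commute)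
    qed
  qed
  ultimately show ?thesis
    using that[of c d W] c(1) d(1) unfolding expanding_branch_def by blast
qed

end

section \<open>Expanding invariant sets\<close>

text \<open>In topological charts of \<open>S\<close> at \<open>x\<close> and at \<open>f x\<close>,
  of the same dimension \<open>k\<close>, the map becomes an injective continuous map on an open
  subset of Euclidean space, so its image is open. The set \<open>Q\<close> is open in the ambient
  manifold and cuts out that image in \<open>S\<close>.\<close>

lemma submanifold_image_neighbourhood:
  assumes S: "topological_submanifold k S" and cont: "continuous_on S f" and fS: "f ` S \<subseteq> S"
    and W: "open W" "inj_on f (W \<inter> S)" and x: "x \<in> W \<inter> S"
  obtains Q where "open Q" "f x \<in> Q" "Q \<inter> S \<subseteq> f ` (W \<inter> S)"
proof -
  let ?E = "Euclidean_space k"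
  obtain U V where U: "x \<in> U" "openin (top_of_set S) U" "openin ?E V"
    "top_of_set U homeomorphic_space subtopology ?E V"
    using S x unfolding topological_submanifold_def by blast
  obtain U2 V2 where U2: "f x \<in> U2" "openin (top_of_set S) U2" "openin ?E V2"
    "top_of_set U2 homeomorphic_space subtopology ?E V2"
    using S x fS unfolding topological_submanifold_def by blast
  obtain p p' where p: "homeomorphic_maps (top_of_set U) (subtopology ?E V) p p'"
    using U(4) unfolding homeomorphic_space_def by blast
  obtain q q' where q: "homeomorphic_maps (top_of_set U2) (subtopology ?E V2) q q'"
    using U2(4) unfolding homeomorphic_space_def by blast
  have subS: "U \<subseteq> S" "U2 \<subseteq> S" using U(2) U2(2) openin_imp_subset by blast+
  obtain Q2 where Q2: "open Q2" "U2 = S \<inter> Q2" using U2(2) by (auto simp: openin_open)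
  \<comment> \<open>Small enough for three things: the chart at \<open>x\<close>, injectivity of
    \<open>f\<close>, and having its image in the chart at \<open>f x\<close>.\<close>
  define U1 where "U1 = U \<inter> W \<inter> f -` U2"
  have "U1 = (U \<inter> f -` Q2) \<inter> (U \<inter> W)" using Q2 subS fS by (auto simp: U1_def)
  moreover have "openin (top_of_set U) (U \<inter> f -` Q2)"
    by (rule continuous_openin_preimage_gen[OF continuous_on_subset[OF cont subS(1)] Q2(1)])
  ultimately have opU1: "openin (top_of_set U) U1"
    using W(1) by (simp add: openin_Int openin_open_Int)
  have p_open: "homeomorphic_map (top_of_set U) (subtopology ?E V) p"
    using p homeomorphic_maps_map by blast
  define V1 where "V1 = p ` U1"
  have "openin (subtopology ?E V) V1"
    unfolding V1_def using iffD1[OF homeomorphic_map_openness_eq[OF p_open] opU1] by (rule conjunct2)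
  then have opV1: "openin ?E V1" "V1 \<subseteq> V"
    by (simp_all add: openin_open_subtopology[OF U(3)])
  have topV: "topspace (subtopology ?E V) = V" "topspace (subtopology ?E V2) = V2"
    using openin_subset[OF U(3)] openin_subset[OF U2(3)] by auto
  have p'p: "p' (p y) = y" if "y \<in> U" for y using p that by (auto simp: homeomorphic_maps_def)
  have q'q: "q' (q z) = z" if "z \<in> U2" for z using q that by (auto simp: homeomorphic_maps_def)
  have "(\<lambda>y. p' (p y)) ` U1 = (\<lambda>y. y) ` U1"
    by (rule image_cong) (simp_all add: U1_def p'p)
  then have p'V1: "p' ` V1 = U1" by (simp add: V1_def image_image)
  let ?\<theta> = "q \<circ> (f \<circ> p')"
  have "continuous_map (subtopology ?E V) (top_of_set U) p'"
    using p unfolding homeomorphic_maps_def by blast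
  then have "continuous_map (subtopology (subtopology ?E V) V1) (top_of_set U) p'"
    by (rule continuous_map_from_subtopology)
  then have "continuous_map (subtopology ?E V1) (top_of_set U) p'"
    using opV1(2) by (simp add: subtopology_subtopology inf.absorb2)
  then have c1: "continuous_map (subtopology ?E V1) (top_of_set U1) p'"
    using p'V1 openin_imp_subset[OF opU1] by (auto simp: continuous_map_in_subtopology)
  have c2: "continuous_map (top_of_set U1) (top_of_set U2) f"
    using continuous_on_subset[OF cont, of U1] subS(1) by (auto simp: U1_def continuous_map_in_subtopology)
  have c3: "continuous_map (top_of_set U2) ?E q"
    using q by (simp add: homeomorphic_maps_def continuous_map_in_subtopology)
  have cont\<theta>: "continuous_map (subtopology ?E V1) ?E ?\<theta>"
    by (rule continuous_map_compose[OF continuous_map_compose[OF c1 c2] c3])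
  have inj\<theta>: "inj_on ?\<theta> V1"
  proof (rule comp_inj_on[OF comp_inj_on])
    show "inj_on p' V1"
    proof (rule inj_on_inverseI)
      show "p (p' v) = v" if v: "v \<in> V1" for v
      proof -
        obtain y where "y \<in> U1" "v = p y" using v by (auto simp: V1_def)
        then show ?thesis using p'p[of y] by (simp add: U1_def)
      qed
    qed
    have "U1 \<subseteq> W \<inter> S" using subS(1) by (auto simp: U1_def)
    then show "inj_on f (p' ` V1)" unfolding p'V1 using W(2) inj_on_subset by blast
    have "inj_on q U2" by (rule inj_on_inverseI[where g = q'], rule q'q)
    moreover have "(f \<circ> p') ` V1 \<subseteq> U2"
      unfolding image_comp[symmetric] p'V1 by (auto simp: U1_def)
    ultimately show "inj_on q ((f \<circ> p') ` V1)" by (rule inj_on_subset)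
  qed
  have "openin ?E (?\<theta> ` V1)"
    by (rule invariance_of_domain_Euclidean_space[OF opV1(1) cont\<theta> inj\<theta>])
  then have op: "openin ?E (q ` f ` U1)" by (simp only: image_comp[symmetric] p'V1)
  have fU1: "f ` U1 \<subseteq> U2" unfolding U1_def by blast
  \<comment> \<open>Invariance of domain gives openness in coordinates. As \<open>q\<close> is
    injective on \<open>U2\<close>, the image of \<open>U1\<close> is the preimage of that open set
    under \<open>q\<close>, hence open in \<open>U2\<close> and then in \<open>S\<close>.\<close>
  have "f ` U1 = {z \<in> topspace (top_of_set U2). q z \<in> q ` f ` U1}"
  proof (rule equalityI; rule subsetI)
    fix z assume "z \<in> f ` U1"
    then show "z \<in> {z \<in> topspace (top_of_set U2). q z \<in> q ` f ` U1}"
      using fU1 by (intro CollectI conjI imageI) auto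
  next
    fix z assume "z \<in> {z \<in> topspace (top_of_set U2). q z \<in> q ` f ` U1}"
    then have z: "z \<in> U2" and qz: "q z \<in> q ` (f ` U1)" unfolding topspace_euclidean_subtopology by blast+
    obtain w where w: "w \<in> f ` U1" "q z = q w" using qz by (rule imageE)
    have "z = q' (q z)" using q'q[OF z] by (rule sym)
    also have "\<dots> = q' (q w)" by (rule arg_cong[OF w(2)])
    also have "\<dots> = w" by (rule q'q[OF subsetD[OF fU1 w(1)]])
    finally show "z \<in> f ` U1" using w(1) by (rule ssubst)
  qed
  also have "openin (top_of_set U2) \<dots>"
    by (rule openin_continuous_map_preimage[OF c3 op])
  finally have "openin (top_of_set U2) (f ` U1)" .
  then have "openin (top_of_set S) (f ` U1)" using U2(2) by (rule openin_trans)
  then obtain Q where Q: "open Q" "f ` U1 = S \<inter> Q" unfolding openin_open by blast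
  show ?thesis
  proof (rule that[OF Q(1)])
    have "x \<in> U1" using x U(1) U2(1) by (simp add: U1_def)
    then show "f x \<in> Q" using Q(2) by blast
    have "U1 \<subseteq> W \<inter> S" using subS(1) by (auto simp: U1_def)
    then show "Q \<inter> S \<subseteq> f ` (W \<inter> S)" using Q(2) by blast
  qed
qed

text \<open>Here \<open>l\<close> is the infinitesimal rate on \<Lambda> itself and \<mu> a smaller
  rate that is kept on neighbourhoods of the points of \<Lambda>.\<close>

locale expanding_set = riemannian_map A h f r
  for A :: "('m::{t2_space,second_countable_topology}, 'e::euclidean_space) chart set" and h f r +
  fixes \<Lambda> :: "'m set" and \<mu> l :: real
  assumes compact_set: "compact \<Lambda>" and invariant: "f ` \<Lambda> = \<Lambda>"
    and \<mu>: "1 < \<mu>" "\<mu> < l"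
    and expansion: "\<And>x v. x \<in> \<Lambda> \<Longrightarrow> v \<in> tangent_space A x \<Longrightarrow>
       l * tnorm h x v \<le> tnorm h (f x) (tangent_map A f x v)"
begin

section \<open>Lifting of short curves, uniformly near the invariant set\<close>

text \<open>The metric content of an expanding branch, with charts and derivatives hidden, so that
  compactness can make \<delta> uniform while \<open>W\<close> still depends on \<open>y\<close>.
  The time \<open>s\<close> is arbitrary: a lift can be anchored at the start of a curve or at its
  end.\<close>

definition lifting_nbhd :: "real \<Rightarrow> 'm \<Rightarrow> 'm set \<Rightarrow> bool" where
  "lifting_nbhd \<delta> y W \<longleftrightarrow> open W \<and> y \<in> W \<and> inj_on f W \<and>
     (\<forall>\<gamma>. \<forall>s\<in>{0..1}. \<forall>t\<in>{0..1}. piecewise_C1_curve A \<gamma> \<and> \<gamma> s = y \<and> curve_length A h \<gamma> < ennreal \<delta> \<longrightarrow> \<gamma> t \<in> W) \<and>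
     (\<forall>\<gamma>. \<forall>s\<in>{0..1}. piecewise_C1_curve A \<gamma> \<and> \<gamma> s = f y \<and> curve_length A h \<gamma> < ennreal \<delta> \<longrightarrow>
        (\<exists>\<tau>. piecewise_C1_curve A \<tau> \<and> (\<forall>t\<in>{0..1}. \<tau> t \<in> W \<and> f (\<tau> t) = \<gamma> t) \<and>
           ennreal \<mu> * curve_length A h \<tau> \<le> curve_length A h \<gamma>))"

lemma lifting_nbhd_mono:
  assumes "lifting_nbhd \<delta> y W" "\<delta>' \<le> \<delta>"
  shows "lifting_nbhd \<delta>' y W"
proof -
  have "L < ennreal \<delta>" if "L < ennreal \<delta>'" for L
    using that ennreal_leI[OF assms(2)] by (rule less_le_trans)
  then show ?thesis using assms(1) unfolding lifting_nbhd_def by blast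
qed

lemma lifting_nbhdD:
  assumes "lifting_nbhd \<delta> y W"
  shows "open W" "y \<in> W" "inj_on f W"
    and "\<And>\<gamma> s t. piecewise_C1_curve A \<gamma> \<Longrightarrow> s \<in> {0..1} \<Longrightarrow> \<gamma> s = y \<Longrightarrow>
      curve_length A h \<gamma> < ennreal \<delta> \<Longrightarrow> t \<in> {0..1} \<Longrightarrow> \<gamma> t \<in> W"
  using assms unfolding lifting_nbhd_def by blast+

text \<open>Injectivity on \<open>W\<close> anchors the lift at \<open>y\<close> at time
  \<open>s\<close>. The length bound is also given as a strict bound by a real number, the form in
  which distances to \<Lambda> are compared.\<close>

lemma lifting_nbhd_lift:
  assumes W: "lifting_nbhd \<delta> y W" and \<gamma>: "piecewise_C1_curve A \<gamma>" "s \<in> {0..1}" "\<gamma> s = f y"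
    "curve_length A h \<gamma> < ennreal a" "a \<le> \<delta>"
  obtains \<tau> where "piecewise_C1_curve A \<tau>" "\<tau> s = y" "\<And>t. t \<in> {0..1} \<Longrightarrow> \<tau> t \<in> W"
    "\<And>t. t \<in> {0..1} \<Longrightarrow> f (\<tau> t) = \<gamma> t" "ennreal \<mu> * curve_length A h \<tau> \<le> curve_length A h \<gamma>"
    "curve_length A h \<tau> < ennreal (a / \<mu>)"
proof -
  have "curve_length A h \<gamma> < ennreal \<delta>" using \<gamma>(4) ennreal_leI[OF \<gamma>(5)] by (rule less_le_trans)
  then obtain \<tau> where \<tau>: "piecewise_C1_curve A \<tau>" "\<forall>t\<in>{0..1}. \<tau> t \<in> W \<and> f (\<tau> t) = \<gamma> t"
    "ennreal \<mu> * curve_length A h \<tau> \<le> curve_length A h \<gamma>"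
    using W \<gamma>(1-3) unfolding lifting_nbhd_def by blast
  have "\<tau> s = y"
    using inj_onD[OF lifting_nbhdD(3)[OF W], of "\<tau> s" y] \<tau>(2) \<gamma>(2,3) lifting_nbhdD(2)[OF W] by simp
  moreover have "curve_length A h \<tau> < ennreal (a / \<mu>)"
  proof (rule ccontr)
    assume "\<not> ?thesis"
    then have "ennreal \<mu> * ennreal (a / \<mu>) \<le> ennreal \<mu> * curve_length A h \<tau>"
      by (intro mult_left_mono) simp_all
    moreover have "ennreal \<mu> * ennreal (a / \<mu>) = ennreal a"
      using \<mu>(1) by (simp flip: ennreal_mult')
    ultimately show False using \<tau>(3) \<gamma>(4) by (metis leD order_trans)
  qed
  ultimately show ?thesis using that \<tau> by blast
qed

text \<open>Short curves through points near \<open>x\<close> stay in a branch \<open>W\<close>, and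
  short curves through points near \<open>f x\<close> stay in the open set \<open>f(W)\<close>. The
  neighbourhood \<open>N\<close> asks for both, and \<delta> is the smaller of the two
  lengths.\<close>

lemma local_lifting:
  assumes x: "x \<in> \<Lambda>" and V: "open V" "x \<in> V"
  shows "\<exists>N \<delta>. open N \<and> x \<in> N \<and> \<delta> > 0 \<and> (\<forall>y\<in>N. \<exists>W\<subseteq>V. lifting_nbhd \<delta> y W)"
proof -
  obtain c d W where W: "expanding_branch \<mu> c d W" "x \<in> W" "W \<subseteq> V"
    by (rule expanding_branch_exists[OF expansion[OF x] _ \<mu>(2) V]) (use \<mu>(1) in simp_all)
  have opW: "open W" "inj_on f W" using expanding_branchD[OF W(1)] by blast+
  obtain N1 \<delta>1 where N1: "open N1" "x \<in> N1" "N1 \<subseteq> W" "\<delta>1 > 0" and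
    stay1: "\<And>\<gamma> t0 t. piecewise_C1_curve A \<gamma> \<Longrightarrow> t0 \<in> {0..1} \<Longrightarrow> \<gamma> t0 \<in> N1 \<Longrightarrow>
       curve_length A h \<gamma> < ennreal \<delta>1 \<Longrightarrow> t \<in> {0..1} \<Longrightarrow> \<gamma> t \<in> W"
    using short_curves_stay[OF opW(1) W(2)] by metis
  obtain N2 \<delta>2 where N2: "open N2" "f x \<in> N2" "\<delta>2 > 0" and
    stay2: "\<And>\<gamma> t0 t. piecewise_C1_curve A \<gamma> \<Longrightarrow> t0 \<in> {0..1} \<Longrightarrow> \<gamma> t0 \<in> N2 \<Longrightarrow>
       curve_length A h \<gamma> < ennreal \<delta>2 \<Longrightarrow> t \<in> {0..1} \<Longrightarrow> \<gamma> t \<in> f ` W"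
    using short_curves_stay[OF open_branch_image[OF W(1)] imageI[OF W(2)]] by metis
  define \<delta> where "\<delta> = min \<delta>1 \<delta>2"
  have \<delta>: "L < ennreal \<delta>1" "L < ennreal \<delta>2" if "L < ennreal \<delta>" for L
    using that less_le_trans[of L "ennreal \<delta>"] by (simp_all add: \<delta>_def ennreal_leI)
  have "lifting_nbhd \<delta> y W" if y: "y \<in> N1 \<inter> f -` N2" for y
    unfolding lifting_nbhd_def
  proof (intro conjI allI ballI impI opW)
    show "y \<in> W" using y N1(3) by blast
    show "\<gamma> t \<in> W" if "s \<in> {0..1}" "t \<in> {0..1}"
      "piecewise_C1_curve A \<gamma> \<and> \<gamma> s = y \<and> curve_length A h \<gamma> < ennreal \<delta>" for \<gamma> s t
      using stay1[of \<gamma> s t] that y \<delta>(1) by simp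
    show "\<exists>\<tau>. piecewise_C1_curve A \<tau> \<and> (\<forall>t\<in>{0..1}. \<tau> t \<in> W \<and> f (\<tau> t) = \<gamma> t) \<and>
           ennreal \<mu> * curve_length A h \<tau> \<le> curve_length A h \<gamma>"
      if s: "s \<in> {0..1}" and \<gamma>: "piecewise_C1_curve A \<gamma> \<and> \<gamma> s = f y \<and> curve_length A h \<gamma> < ennreal \<delta>" for \<gamma> s
    proof -
      have im: "\<gamma> t \<in> f ` W" if "t \<in> {0..1}" for t
        using stay2[of \<gamma> s t] that s y \<gamma> \<delta>(2) by simp
      have "\<mu> > 0" using \<mu>(1) by simp
      show ?thesis
        by (rule lift_curve[OF W(1) \<open>\<mu> > 0\<close> conjunct1[OF \<gamma>] im]) (assumption, blast)
    qed
  qed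
  moreover have "open (N1 \<inter> f -` N2)" using N1(1) N2(1) open_vimage_f by blast
  ultimately show ?thesis
    using N1 N2 W(3) by (intro exI[of _ "N1 \<inter> f -` N2"] exI[of _ \<delta>]) (auto simp: \<delta>_def)
qed

lemma uniform_lifting:
  assumes V: "open V" "\<Lambda> \<subseteq> V"
  obtains N \<delta> where "open N" "\<Lambda> \<subseteq> N" "\<delta> > 0" "\<And>y. y \<in> N \<Longrightarrow> \<exists>W\<subseteq>V. lifting_nbhd \<delta> y W"
proof -
  define good where "good x N d \<longleftrightarrow>
    open N \<and> x \<in> N \<and> d > 0 \<and> (\<forall>y\<in>N. \<exists>W\<subseteq>V. lifting_nbhd d y W)" for x N d
  have "\<exists>N d. good x N d" if "x \<in> \<Lambda>" for x
    unfolding good_def by (rule local_lifting[OF that V(1) subsetD[OF V(2) that]])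
  then obtain N \<delta> where good: "\<And>x. x \<in> \<Lambda> \<Longrightarrow> good x (N x) (\<delta> x)" by metis
  have N: "open (N x)" "x \<in> N x" "\<delta> x > 0" "\<And>y. y \<in> N x \<Longrightarrow> \<exists>W\<subseteq>V. lifting_nbhd (\<delta> x) y W"
    if "x \<in> \<Lambda>" for x
    using good[OF that] unfolding good_def by blast+
  obtain C where C: "C \<subseteq> \<Lambda>" "finite C" "\<Lambda> \<subseteq> (\<Union>x\<in>C. N x)"
  proof (rule compactE_image[OF compact_set, of \<Lambda> N])
    show "\<Lambda> \<subseteq> (\<Union>x\<in>\<Lambda>. N x)" using N(2) by blast
  qed (use N(1) in auto)
  \<comment> \<open>The extra 1 keeps the minimum meaningful when the finite cover is empty.\<close>
  define e where "e = Min (insert 1 (\<delta> ` C))"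
  have e: "e \<le> \<delta> x" if "x \<in> C" for x unfolding e_def using C(2) that by (intro Min_le) auto
  show ?thesis
  proof (rule that[of "\<Union>x\<in>C. N x" e])
    show "open (\<Union>x\<in>C. N x)" by (intro open_UN ballI N(1)) (use C(1) in blast)
    show "\<Lambda> \<subseteq> (\<Union>x\<in>C. N x)" by (rule C(3))
    show "e > 0" unfolding e_def using C N(3) by (subst Min_gr_iff) auto
    fix y assume "y \<in> (\<Union>x\<in>C. N x)"
    then obtain x where x: "x \<in> C" "y \<in> N x" by blast
    have "x \<in> \<Lambda>" using x(1) C(1) by blast
    then show "\<exists>W\<subseteq>V. lifting_nbhd e y W"
      using N(4)[OF _ x(2)] lifting_nbhd_mono[OF _ e[OF x(1)]] by blast
  qed
qed

text \<open>A curve between the images is either shorter than \<delta>, and then lifts to a curve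
  from \<open>x\<close> to \<open>y\<close>, or has length at least \<delta>, which exceeds \<mu>
  times the distance once that distance is below \<delta>/\<mu>. This is the origin of the radius
  \<delta>/\<mu>.\<close>

lemma metrically_expanding: "metrically_expanding_on (riemannian_dist A h) f \<Lambda>"
proof -
  let ?\<rho> = "riemannian_dist A h"
  obtain N \<delta> where N: "\<Lambda> \<subseteq> N" "\<delta> > 0" "\<And>y. y \<in> N \<Longrightarrow> \<exists>W\<subseteq>UNIV. lifting_nbhd \<delta> y W"
    using uniform_lifting[OF open_UNIV subset_UNIV] by metis
  \<comment> \<open>Taking the infimum over curves gives only a weak inequality with rate \<mu>. Any
    rate strictly between 1 and \<mu> makes it strict, because the distance is positive and
    finite.\<close>
  define \<nu> where "\<nu> = (1 + \<mu>) / 2"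
  have \<nu>: "1 < \<nu>" "\<nu> < \<mu>" using \<mu>(1) by (simp_all add: \<nu>_def)
  have "?\<rho> (f x) (f y) > ennreal \<nu> * ?\<rho> x y"
    if x: "x \<in> \<Lambda>" and y: "y \<in> \<Lambda>" and xy: "x \<noteq> y" "?\<rho> x y < ennreal (\<delta> / \<mu>)" for x y
  proof -
    obtain W where W: "lifting_nbhd \<delta> x W" using N(1,3) x by blast
    have \<delta>\<mu>: "\<delta> / \<mu> \<le> \<delta>" using N(2) \<mu>(1) by (simp add: divide_le_eq)
    have "?\<rho> x y < ennreal \<delta>" using xy(2) ennreal_leI[OF \<delta>\<mu>] by (rule less_le_trans)
    then obtain \<gamma> where "piecewise_C1_curve A \<gamma>" "\<gamma> 0 = x" "\<gamma> 1 = y" "curve_length A h \<gamma> < ennreal \<delta>"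
      by (rule riemannian_dist_lessE)
    \<comment> \<open>Both \<open>y\<close> and the end point of a lift lie in \<open>W\<close>, so
      injectivity identifies them.\<close>
    then have yW: "y \<in> W" using lifting_nbhdD(4)[OF W, of \<gamma> 0 1] by simp
    have "ennreal \<mu> * ?\<rho> x y \<le> curve_length A h \<gamma>"
      if \<gamma>: "piecewise_C1_curve A \<gamma>" "\<gamma> 0 = f x" "\<gamma> 1 = f y" for \<gamma>
    proof (cases "curve_length A h \<gamma> < ennreal \<delta>")
      case True
      obtain \<tau> where \<tau>: "piecewise_C1_curve A \<tau>" "\<tau> 0 = x" "\<And>t. t \<in> {0..1} \<Longrightarrow> \<tau> t \<in> W"
        "\<And>t. t \<in> {0..1} \<Longrightarrow> f (\<tau> t) = \<gamma> t" "ennreal \<mu> * curve_length A h \<tau> \<le> curve_length A h \<gamma>"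
        using lifting_nbhd_lift[OF W \<gamma>(1) _ \<gamma>(2) True order_refl] by (metis atLeastAtMost_iff order_refl zero_le_one)
      have "\<tau> 1 = y"
        using inj_onD[OF lifting_nbhdD(3)[OF W], of "\<tau> 1" y] \<tau>(3,4)[of 1] \<gamma>(3) yW by simp
      then have "?\<rho> x y \<le> curve_length A h \<tau>" using riemannian_dist_le[OF \<tau>(1)] \<tau>(2) by simp
      then have "ennreal \<mu> * ?\<rho> x y \<le> ennreal \<mu> * curve_length A h \<tau>" by (rule mult_left_mono) simp
      then show ?thesis using \<tau>(5) by (rule order_trans)
    next
      case False
      have "ennreal \<mu> * ?\<rho> x y \<le> ennreal \<mu> * ennreal (\<delta> / \<mu>)"
        using xy(2) by (intro mult_left_mono) simp_all
      also have "\<dots> = ennreal \<delta>" using \<mu>(1) by (simp flip: ennreal_mult')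
      finally show ?thesis using False by (metis leI order_trans)
    qed
    then have le: "ennreal \<mu> * ?\<rho> x y \<le> ?\<rho> (f x) (f y)"
      unfolding riemannian_dist_def[of A h "f x" "f y"] by (intro INF_greatest) simp
    have "?\<rho> x y > 0" by (rule riemannian_dist_pos[OF xy(1)])
    moreover have "?\<rho> x y < \<infinity>" using xy(2) by (rule less_trans) simp
    ultimately obtain a where "?\<rho> x y = ennreal a" "a > 0"
      by (cases "?\<rho> x y") (auto simp: ennreal_less_zero_iff)
    then have "ennreal \<nu> * ?\<rho> x y < ennreal \<mu> * ?\<rho> x y"
      using \<nu> by (simp add: ennreal_less_iff flip: ennreal_mult')
    then show ?thesis using le by (rule less_le_trans)
  qed
  then show ?thesis
    unfolding metrically_expanding_on_def
    by (intro exI[of _ "\<delta> / \<mu>"] exI[of _ \<nu>]) (use \<nu>(1) N(2) \<mu>(1) in simp)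
qed

section \<open>The repelling neighbourhood\<close>

text \<open>Distance to \<Lambda> below \<open>s\<close>, expressed through a witness in place of an
  infimum over \<Lambda>.\<close>

definition near :: "real \<Rightarrow> 'm \<Rightarrow> bool" where
  "near s y \<longleftrightarrow> (\<exists>z\<in>\<Lambda>. riemannian_dist A h z y < ennreal s)"

lemma near_mono: "near s y \<Longrightarrow> s \<le> s' \<Longrightarrow> near s' y"
  unfolding near_def using less_le_trans ennreal_leI by blast

lemma near_extend:
  assumes "near s y" "riemannian_dist A h y y' < ennreal e"
  shows "near (s + e) y'"
  using assms riemannian_dist_triangle_less unfolding near_def by blast

lemma near_self:
  assumes "z \<in> \<Lambda>" "s > 0"
  shows "near s z"
proof -
  obtain V where "z \<in> V" "\<And>x y. x \<in> V \<Longrightarrow> y \<in> V \<Longrightarrow> riemannian_dist A h x y < ennreal s"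
    using locally_small_dist[OF assms(2), of z] by metis
  then show ?thesis using assms(1) unfolding near_def by blast
qed

text \<open>The complement of \<Lambda> is open, so a sufficiently short curve ending at a point
  outside \<Lambda> cannot have started in \<Lambda>.\<close>

lemma near_all_imp_mem:
  assumes "\<And>s. s > 0 \<Longrightarrow> near s y"
  shows "y \<in> \<Lambda>"
proof (rule ccontr)
  assume "y \<notin> \<Lambda>"
  have "open (- \<Lambda>)" using compact_imp_closed[OF compact_set] by (simp add: open_Compl)
  then obtain V \<delta> where V: "y \<in> V" "\<delta> > 0" and
    stay: "\<And>\<gamma> t0 t. piecewise_C1_curve A \<gamma> \<Longrightarrow> t0 \<in> {0..1} \<Longrightarrow> \<gamma> t0 \<in> V \<Longrightarrow>
       curve_length A h \<gamma> < ennreal \<delta> \<Longrightarrow> t \<in> {0..1} \<Longrightarrow> \<gamma> t \<in> - \<Lambda>"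
    using short_curves_stay[of "- \<Lambda>" y] \<open>y \<notin> \<Lambda>\<close> by (metis ComplI)
  obtain z where z: "z \<in> \<Lambda>" "riemannian_dist A h z y < ennreal \<delta>"
    using assms[OF V(2)] by (auto simp: near_def)
  obtain \<gamma> where "piecewise_C1_curve A \<gamma>" "\<gamma> 0 = z" "\<gamma> 1 = y" "curve_length A h \<gamma> < ennreal \<delta>"
    using riemannian_dist_lessE[OF z(2)] .
  then show False using stay[of \<gamma> 1 0] V(1) z(1) by simp
qed

text \<open>Where a submanifold is mapped to itself injectively, invariance of domain makes the
  restriction open, so near the submanifold no other point can be mapped into it.\<close>

lemma submanifold_locally_backward_invariant:
  assumes "topological_submanifold k \<Lambda>"
  obtains V where "open V" "\<Lambda> \<subseteq> V" "\<And>y. y \<in> V \<Longrightarrow> f y \<in> \<Lambda> \<Longrightarrow> y \<in> \<Lambda>"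
proof -
  have "\<exists>V. open V \<and> x \<in> V \<and> (\<forall>y\<in>V. f y \<in> \<Lambda> \<longrightarrow> y \<in> \<Lambda>)" if x: "x \<in> \<Lambda>" for x
  proof -
    obtain W where W: "open W" "x \<in> W" "inj_on f W"
      using local_lifting[OF x open_UNIV UNIV_I] lifting_nbhdD by meson
    have "inj_on f (W \<inter> \<Lambda>)" using W(3) by (rule inj_on_subset) simp
    then obtain Q where Q: "open Q" "f x \<in> Q" "Q \<inter> \<Lambda> \<subseteq> f ` (W \<inter> \<Lambda>)"
      using submanifold_image_neighbourhood[OF assms continuous_on_subset[OF continuous_f] _ W(1)] W(2) x invariant
      by (metis IntI order_refl subset_UNIV)
    have "y \<in> \<Lambda>" if "y \<in> W \<inter> f -` Q" "f y \<in> \<Lambda>" for y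
    proof -
      \<comment> \<open>Both \<open>y\<close> and \<open>y'\<close> lie in \<open>W\<close>, where
        \<open>f\<close> is injective, so the point \<open>y\<close> coincides with the one that
        belongs to \<Lambda>.\<close>
      obtain y' where "y' \<in> W" "y' \<in> \<Lambda>" "f y = f y'" using Q(3) \<open>f y \<in> \<Lambda>\<close> \<open>y \<in> W \<inter> f -` Q\<close> by blast
      then show ?thesis using inj_onD[OF W(3), of y y'] \<open>y \<in> W \<inter> f -` Q\<close> by simp
    qed
    then show ?thesis
      using W Q open_vimage_f[OF Q(1)] by (intro exI[of _ "W \<inter> f -` Q"]) (simp add: open_Int)
  qed
  note local = this
  \<comment> \<open>The union of all open sets with the property inherits it, so no cover has to be
    selected.\<close>
  define V where "V = \<Union> {V. open V \<and> (\<forall>y\<in>V. f y \<in> \<Lambda> \<longrightarrow> y \<in> \<Lambda>)}"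
  show ?thesis
  proof (rule that[of V])
    show "open V" unfolding V_def by (rule open_Union) simp
    show "\<Lambda> \<subseteq> V" unfolding V_def using local by blast
    show "y \<in> \<Lambda>" if "y \<in> V" "f y \<in> \<Lambda>" for y using that unfolding V_def by blast
  qed
qed

text \<open>\<open>U\<close> is a sublevel set of the distance to \<Lambda>. Lifting from the start
  of a curve reaches from \<Lambda> to a preimage of a given point; lifting from its end bounds the
  distance of a given preimage.\<close>

lemma repelling_neighbourhood:
  assumes "topological_submanifold k \<Lambda>"
  obtains U where "open U" "\<Lambda> \<subseteq> U" "closure U \<subseteq> f ` U" "(\<Inter>k. (f ^^ k) -` U) = \<Lambda>"
proof -
  obtain V where V: "open V" "\<Lambda> \<subseteq> V" "\<And>y. y \<in> V \<Longrightarrow> f y \<in> \<Lambda> \<Longrightarrow> y \<in> \<Lambda>"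
    using submanifold_locally_backward_invariant[OF assms] by metis
  obtain N \<delta> where N: "open N" "\<Lambda> \<subseteq> N" "\<delta> > 0" "\<And>y. y \<in> N \<Longrightarrow> \<exists>W\<subseteq>V. lifting_nbhd \<delta> y W"
    using uniform_lifting[OF V(1,2)] by metis
  \<comment> \<open>Used only to confine short curves that start in \<Lambda> to \<open>N\<close>,
    where lifting into \<open>V\<close> is available.\<close>
  obtain N' \<delta>' where N': "\<Lambda> \<subseteq> N'" "\<delta>' > 0" "\<And>y. y \<in> N' \<Longrightarrow> \<exists>W\<subseteq>N. lifting_nbhd \<delta>' y W"
    using uniform_lifting[OF N(1,2)] by metis
  \<comment> \<open>Divided by \<mu> so that even curves of length \<mu> s, needed for the closure
    of \<open>U\<close>, are short enough to lift.\<close>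
  define s where "s = min \<delta> \<delta>' / \<mu>"
  have \<mu>s: "\<mu> * s = min \<delta> \<delta>'" using \<mu>(1) by (simp add: s_def)
  have "s > 0" using N(3) N'(2) \<mu>(1) by (simp add: s_def)
  then have "s < \<mu> * s" using \<mu>(1) by simp
  with \<open>s > 0\<close> \<mu>s have s: "s > 0" "\<mu> * s \<le> \<delta>" "\<mu> * s \<le> \<delta>'" "s < \<mu> * s"
    by linarith+
  define U where "U = {y. near s y}"
  have UN: "y \<in> N" if y: "y \<in> U" for y
  proof -
    obtain z where z: "z \<in> \<Lambda>" "riemannian_dist A h z y < ennreal s" using y by (auto simp: U_def near_def)
    obtain \<gamma> where \<gamma>: "piecewise_C1_curve A \<gamma>" "\<gamma> 0 = z" "\<gamma> 1 = y" "curve_length A h \<gamma> < ennreal s"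
      using riemannian_dist_lessE[OF z(2)] .
    have "curve_length A h \<gamma> < ennreal \<delta>'"
      using \<gamma>(4) by (rule less_le_trans) (use s in \<open>intro ennreal_leI; linarith\<close>)
    moreover obtain W where "W \<subseteq> N" "lifting_nbhd \<delta>' z W" using N'(1,3) z(1) by blast
    ultimately show ?thesis using lifting_nbhdD(4)[of \<delta>' z W \<gamma> 0 1] \<gamma> by auto
  qed
  \<comment> \<open>The lift is anchored at its end point \<open>y\<close> and stays in
    \<open>V\<close>. Its starting point is mapped to \<open>z\<close> in \<Lambda>, and therefore
    lies in \<Lambda> by the choice of \<open>V\<close>.\<close>
  have pull_back: "near (a / \<mu>) y" if y: "y \<in> N" and fy: "near a (f y)" and a: "a \<le> \<delta>" for a y
  proof -
    obtain z where z: "z \<in> \<Lambda>" "riemannian_dist A h z (f y) < ennreal a" using fy by (auto simp: near_def)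
    obtain \<gamma> where \<gamma>: "piecewise_C1_curve A \<gamma>" "\<gamma> 0 = z" "\<gamma> 1 = f y" "curve_length A h \<gamma> < ennreal a"
      using riemannian_dist_lessE[OF z(2)] .
    obtain W where W: "W \<subseteq> V" "lifting_nbhd \<delta> y W" using N(4)[OF y] by blast
    have one: "(1::real) \<in> {0..1}" by simp
    obtain \<tau> where \<tau>: "piecewise_C1_curve A \<tau>" "\<tau> 1 = y" "\<And>t. t \<in> {0..1} \<Longrightarrow> \<tau> t \<in> W"
      "\<And>t. t \<in> {0..1} \<Longrightarrow> f (\<tau> t) = \<gamma> t" "curve_length A h \<tau> < ennreal (a / \<mu>)"
      using lifting_nbhd_lift[OF W(2) \<gamma>(1) one \<gamma>(3,4) a] by blast
    have "\<tau> 0 \<in> V" "f (\<tau> 0) = z" using \<tau>(3,4)[of 0] W(1) \<gamma>(2) by auto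
    then have "\<tau> 0 \<in> \<Lambda>" using V(3) z(1) by blast
    moreover have "riemannian_dist A h (\<tau> 0) y < ennreal (a / \<mu>)"
      using le_less_trans[OF riemannian_dist_le[OF \<tau>(1)] \<tau>(5)] \<tau>(2) by simp
    ultimately show ?thesis unfolding near_def by blast
  qed
  \<comment> \<open>The induction moves along the orbit: the bound for \<open>f y\<close> with
    exponent \<open>m\<close>, pulled back once, is the bound for \<open>y\<close> with exponent
    \<open>m + 1\<close>. That all iterates lie in \<open>U\<close> supplies the condition
    \<open>y \<in> N\<close> at each stage.\<close>
  have iter: "near (s / \<mu> ^ m) y" if "\<And>k. (f ^^ k) y \<in> U" for m y
    using that
  proof (induction m arbitrary: y)
    case 0
    from "0.prems"[of 0] show ?case by (simp add: U_def)
  next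
    case (Suc m)
    have "(f ^^ k) (f y) \<in> U" for k using Suc.prems[of "Suc k"] by (simp add: funpow_swap1)
    then have fy: "near (s / \<mu> ^ m) (f y)" by (rule Suc.IH)
    have "s / \<mu> ^ m \<le> s / 1"
      using s(1) \<mu>(1) by (intro divide_left_mono) (simp_all add: one_le_power)
    then have "s / \<mu> ^ m \<le> \<delta>" using s by linarith
    then have "near (s / \<mu> ^ m / \<mu>) y"
      using pull_back[OF UN fy] Suc.prems[of 0] by simp
    then show ?case by (simp add: mult.commute)
  qed
  show ?thesis
  proof (rule that[of U])
    show "open U"
    proof (subst open_subopen, rule ballI)
      fix y assume "y \<in> U"
      then obtain z where z: "z \<in> \<Lambda>" "riemannian_dist A h z y < ennreal s" by (auto simp: U_def near_def)
      then obtain a where a: "riemannian_dist A h z y = ennreal a" "0 \<le> a" "a < s"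
        by (cases "riemannian_dist A h z y") (auto simp: ennreal_less_iff)
      \<comment> \<open>The slack \<open>s - a\<close> is split in two: one half makes the bound at
        \<open>y\<close> strict, the other pays for the move to a nearby point.\<close>
      define e where "e = (s - a) / 2"
      have e: "e > 0" "a + e + e = s" using a by (simp_all add: e_def)
      obtain O' where O': "open O'" "y \<in> O'" "\<And>x y. x \<in> O' \<Longrightarrow> y \<in> O' \<Longrightarrow> riemannian_dist A h x y < ennreal e"
        using locally_small_dist[OF e(1)] by metis
      have "riemannian_dist A h z y < ennreal (a + e)"
        unfolding a(1) using a(2) e(1) by (subst ennreal_less_iff) simp_all
      then have "near (a + e) y" unfolding near_def using z(1) by blast
      then have "O' \<subseteq> U" using near_extend[of "a + e" y _ e] O'(2,3) e(2) by (auto simp: U_def)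
      then show "\<exists>T. open T \<and> y \<in> T \<and> T \<subseteq> U" using O' by blast
    qed
    show "\<Lambda> \<subseteq> U" using near_self s(1) by (auto simp: U_def)
    show "closure U \<subseteq> f ` U"
    proof
      fix y assume y: "y \<in> closure U"
      \<comment> \<open>The room between \<open>s\<close> and \<mu> s absorbs the passage from
        \<open>U\<close> to its closure.\<close>
      define e where "e = \<mu> * s - s"
      have "e > 0" using s(4) by (simp add: e_def)
      obtain O' where O': "open O'" "y \<in> O'" "\<And>x y. x \<in> O' \<Longrightarrow> y \<in> O' \<Longrightarrow> riemannian_dist A h x y < ennreal e"
        using locally_small_dist[OF \<open>e > 0\<close>] by metis
      obtain y' where "y' \<in> O'" "y' \<in> U"
        using y O'(1,2) open_Int_closure_eq_empty[of O' U] by blast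
      have "near (s + e) y"
      proof (rule near_extend)
        show "near s y'" using \<open>y' \<in> U\<close> by (simp add: U_def)
        show "riemannian_dist A h y' y < ennreal e" by (rule O'(3)[OF \<open>y' \<in> O'\<close> O'(2)])
      qed
      moreover have "s + e = \<mu> * s" by (simp add: e_def)
      ultimately have "near (\<mu> * s) y" by (simp only:)
      then obtain z where z: "z \<in> \<Lambda>" "riemannian_dist A h z y < ennreal (\<mu> * s)"
        unfolding near_def by blast
      obtain \<gamma> where \<gamma>: "piecewise_C1_curve A \<gamma>" "\<gamma> 0 = z" "\<gamma> 1 = y" "curve_length A h \<gamma> < ennreal (\<mu> * s)"
        using riemannian_dist_lessE[OF z(2)] .
      \<comment> \<open>Invariance supplies a preimage in \<Lambda> at which the lift starts. The
        lift has length below \<open>s\<close>, so its end point is a preimage of \<open>y\<close>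
        in \<open>U\<close>.\<close>
      have "z \<in> f ` \<Lambda>" using z(1) by (simp only: invariant)
      then obtain x where x: "x \<in> \<Lambda>" "f x = z" by blast
      obtain W where W: "lifting_nbhd \<delta> x W" using N(2,4) x(1) by blast
      have zero: "(0::real) \<in> {0..1}" by simp
      have \<gamma>0: "\<gamma> 0 = f x" using \<gamma>(2) x(2) by simp
      obtain \<tau> where \<tau>: "piecewise_C1_curve A \<tau>" "\<tau> 0 = x" "\<And>t. t \<in> {0..1} \<Longrightarrow> f (\<tau> t) = \<gamma> t"
        "curve_length A h \<tau> < ennreal (\<mu> * s / \<mu>)"
        using lifting_nbhd_lift[OF W \<gamma>(1) zero \<gamma>0 \<gamma>(4) s(2)] by blast
      have "riemannian_dist A h x (\<tau> 1) < ennreal s"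
        using le_less_trans[OF riemannian_dist_le[OF \<tau>(1)] \<tau>(4)] \<tau>(2) \<mu>(1) by simp
      then have "\<tau> 1 \<in> U" using x(1) by (auto simp: U_def near_def)
      moreover have "f (\<tau> 1) = y" using \<tau>(3)[of 1] \<gamma>(3) by simp
      ultimately show "y \<in> f ` U" by blast
    qed
    show "(\<Inter>k. (f ^^ k) -` U) = \<Lambda>"
    proof (intro equalityI subsetI)
      fix y assume "y \<in> (\<Inter>k. (f ^^ k) -` U)"
      then have y: "\<And>k. (f ^^ k) y \<in> U" by blast
      show "y \<in> \<Lambda>"
      proof (rule near_all_imp_mem)
        fix e :: real assume "e > 0"
        obtain m where "s / e < \<mu> ^ m" using real_arch_pow[OF \<mu>(1)] by blast
        then have "s / \<mu> ^ m \<le> e"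
          using \<open>e > 0\<close> \<mu>(1) by (simp add: field_simps)
        then show "near e y" using near_mono[OF iter[OF y]] by blast
      qed
    next
      fix y assume y: "y \<in> \<Lambda>"
      have f\<Lambda>: "f z \<in> \<Lambda>" if "z \<in> \<Lambda>" for z using imageI[OF that, of f] by (simp only: invariant)
      have "(f ^^ k) y \<in> \<Lambda>" for k by (induction k) (simp_all add: y f\<Lambda>)
      then show "y \<in> (\<Inter>k. (f ^^ k) -` U)" using near_self s(1) by (auto simp: U_def)
    qed
  qed
qed

end

section \<open>From the hyperbolic structure to expansion of all tangent vectors\<close>

text \<open>Splittings are given along two-sided orbits, so each point of \<Lambda> has to be placed
  on one. The future is determined by \<open>f\<close>; a past inside \<Lambda> is chosen by a right
  inverse of \<open>f\<close> on \<Lambda>.\<close>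

lemma orbit_through:
  assumes "f ` \<Lambda> = \<Lambda>" "x \<in> \<Lambda>"
  obtains \<xi> where "\<xi> \<in> orbits_in f \<Lambda>" "\<xi> 0 = x"
proof -
  define g where "g = inv_into \<Lambda> f"
  have g: "g y \<in> \<Lambda>" "f (g y) = y" if "y \<in> \<Lambda>" for y
    using that assms(1) by (simp_all add: g_def inv_into_into f_inv_into_f)
  have gn: "(g ^^ n) x \<in> \<Lambda>" for n by (induction n) (simp_all add: g assms(2))
  have fn: "(f ^^ n) x \<in> \<Lambda>" for n by (induction n) (use assms in auto)
  define \<xi> where "\<xi> i = (if i \<ge> 0 then (f ^^ nat i) x else (g ^^ nat (- i)) x)" for i
  have "f (\<xi> i) = \<xi> (i + 1)" for i
  proof (cases "i \<ge> 0")
    case True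
    then show ?thesis by (simp add: \<xi>_def nat_add_distrib)
  next
    case False
    then obtain n where n: "nat (- i) = Suc n" by (metis gr0_implies_Suc neg_0_less_iff_less not_le zero_less_nat_eq)
    then have i: "i = - int n - 1" by linarith
    have "\<xi> i = g ((g ^^ n) x)" using False n by (simp add: \<xi>_def)
    then have "f (\<xi> i) = (g ^^ n) x" using g(2)[OF gn] by simp
    also have "\<dots> = \<xi> (i + 1)"
    \<comment> \<open>For \<open>n = 0\<close> the next index is 0, where the definition of \<xi>
      switches to its forward branch.\<close>
    proof (cases "n = 0")
      case True
      then show ?thesis by (simp add: \<xi>_def i)
    next
      case False
      then have "\<not> i + 1 \<ge> 0" "nat (- (i + 1)) = n" using i by simp_all
      then show ?thesis by (simp only: \<xi>_def if_False)
    qed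
    finally show ?thesis .
  qed
  then have "\<xi> \<in> orbits_in f \<Lambda>" using fn gn by (simp add: orbits_in_def orbits_def \<xi>_def)
  moreover have "\<xi> 0 = x" by (simp add: \<xi>_def)
  ultimately show ?thesis using that by blast
qed

text \<open>The value 0 of \<open>dim\<close> alone does not make a subspace trivial, as
  infinite-dimensional spaces get this value too. Continuity provides a frame with as many members
  as the dimension, hence an empty one.\<close>

lemma continuous_subspace_field_dim_0:
  assumes "continuous_subspace_field A X E" "\<xi> \<in> X" "dim (E \<xi>) = 0"
  shows "E \<xi> = {0}"
proof -
  obtain W e and k :: nat where "\<xi> \<in> W"
    "\<forall>\<eta>\<in>W. E \<eta> = span ((\<lambda>j. e j \<eta>) ` {..<k}) \<and> dim (E \<eta>) = k"
    using bspec[OF assms(1)[unfolded continuous_subspace_field_def] assms(2)] by (elim exE conjE) (rule that)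
  then have "E \<xi> = span ((\<lambda>j. e j \<xi>) ` {..<k})" "dim (E \<xi>) = k" by blast+
  then have "E \<xi> = span ((\<lambda>j. e j \<xi>) ` {..<0})" using assms(3) by metis
  then show ?thesis by simp
qed

text \<open>The type and the adapted metric constrain whatever splittings exist; existence comes
  from hyperbolicity of the larger set \<Omega>, since an orbit in \<Lambda> is also one in
  \<Omega>. With a trivial stable part the unstable space is the whole tangent space.\<close>

lemma type_n_0_expansion:
  assumes hyp: "hyperbolic_set A g f \<Omega>" and sub: "\<Lambda> \<subseteq> \<Omega>" and inv: "f ` \<Lambda> = \<Lambda>"
    and type: "has_type A g f \<Lambda> (n, 0)" and adapted: "adapted_metric A g f \<Lambda> h"
  obtains \<kappa> where "0 < \<kappa>" "\<kappa> < 1"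
    "\<And>x v. x \<in> \<Lambda> \<Longrightarrow> v \<in> tangent_space A x \<Longrightarrow> (1 / \<kappa>) * tnorm h x v \<le> tnorm h (f x) (tangent_map A f x v)"
proof -
  obtain \<kappa> where \<kappa>: "0 < \<kappa>" "\<kappa> < 1" and
    ad: "\<And>\<xi> Es Eu i v. \<xi> \<in> orbits_in f \<Lambda> \<Longrightarrow> hyperbolic_splitting A g f \<xi> Es Eu \<Longrightarrow> v \<in> Eu (shift i \<xi>) \<Longrightarrow>
      (1 / \<kappa>) * tnorm h (\<xi> i) v \<le> tnorm h (\<xi> (i + 1)) (tangent_map A f (\<xi> i) v)"
    using adapted unfolding adapted_metric_def by blast
  have "(1 / \<kappa>) * tnorm h x v \<le> tnorm h (f x) (tangent_map A f x v)"
    if x: "x \<in> \<Lambda>" and v: "v \<in> tangent_space A x" for x v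
  proof -
    obtain \<xi> where \<xi>: "\<xi> \<in> orbits_in f \<Lambda>" "\<xi> 0 = x" using orbit_through[OF inv x] .
    have "\<xi> \<in> orbits_in f \<Omega>" using \<xi>(1) sub by (auto simp: orbits_in_def)
    then obtain C \<theta> Es Eu where "C > 0" "0 < \<theta>" "\<theta> < 1"
      and split: "hyperbolic_splitting_const A g f C \<theta> \<xi> Es Eu"
      using hyp unfolding hyperbolic_set_def by blast
    then have hs: "hyperbolic_splitting A g f \<xi> Es Eu" unfolding hyperbolic_splitting_def by blast
    have sh: "shift 0 \<xi> = \<xi>" by (simp add: shift_def)
    have "dim (Es \<xi>) = 0" using type \<xi>(1) hs unfolding has_type_def by blast
    moreover have "continuous_subspace_field A (range (\<lambda>i. shift i \<xi>)) Es"
      using split unfolding hyperbolic_splitting_const_def by blast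
    moreover have "\<xi> \<in> range (\<lambda>i. shift i \<xi>)" using sh by (metis rangeI)
    ultimately have Es: "Es \<xi> = {0}" using continuous_subspace_field_dim_0 by blast
    have "{u + v | u v. u \<in> Es (shift 0 \<xi>) \<and> v \<in> Eu (shift 0 \<xi>)} = tangent_space A (\<xi> 0)"
      using split unfolding hyperbolic_splitting_const_def by blast
    then have "v \<in> Eu (shift 0 \<xi>)" using v \<xi>(2) Es sh by auto
    then show ?thesis
      using ad[OF \<xi>(1) hs, of v 0] \<xi> by (auto simp: orbits_in_def orbits_def)
  qed
  then show ?thesis using that \<kappa> by blast
qed

theorem theorem2:
  fixes A :: "('m::{t2_space,second_countable_topology}, 'e::euclidean_space) chart set"
    and g h :: "'m \<Rightarrow> ('m, 'e) tvec \<Rightarrow> ('m, 'e) tvec \<Rightarrow> real"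
    and r :: enat and f :: "'m \<Rightarrow> 'm" and \<Lambda> :: "'m set"
  assumes "smooth_closed_manifold A"
    and "riemannian_metric A g"
    and "A_endomorphism A g r f"
    and "basic_set f \<Lambda>"
    and "topological_submanifold (DIM('e) - 1) \<Lambda>"
    and "has_type A g f \<Lambda> (DIM('e), 0)"
    and "adapted_metric A g f \<Lambda> h"
  shows "repeller f \<Lambda> \<and> metrically_expanding_on (riemannian_dist A h) f \<Lambda>"
proof -
  have A: "smooth_atlas A" "compact (UNIV :: 'm set)"
    using assms(1) by (simp_all add: smooth_closed_manifold_def)
  have f: "Cr_map A r f" "1 \<le> r" "hyperbolic_set A g f (nonwandering_set f)"
    using assms(3) by (simp_all add: A_endomorphism_def endomorphism_def)
  have \<Lambda>: "\<Lambda> \<subseteq> nonwandering_set f" "closed \<Lambda>" "f ` \<Lambda> = \<Lambda>"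
    using assms(4) unfolding basic_set_def spectral_decomposition_def by blast+
  have "compact \<Lambda>" using compact_Int_closed[OF A(2) \<Lambda>(2)] by simp
  obtain \<kappa> where \<kappa>: "0 < \<kappa>" "\<kappa> < 1"
    "\<And>x v. x \<in> \<Lambda> \<Longrightarrow> v \<in> tangent_space A x \<Longrightarrow> (1 / \<kappa>) * tnorm h x v \<le> tnorm h (f x) (tangent_map A f x v)"
    using type_n_0_expansion[OF f(3) \<Lambda>(1,3) assms(6,7)] by blast
  have "1 < 1 / \<kappa>" using \<kappa> by simp
  \<comment> \<open>Strictly below 1/\<kappa>, so that the expansion known on \<Lambda> persists at
    this rate near \<Lambda>.\<close>
  then obtain \<mu> where \<mu>: "1 < \<mu>" "\<mu> < 1 / \<kappa>" using dense by blast
  have "riemannian_metric A h" using assms(7) by (simp add: adapted_metric_def)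
  interpret expanding_set A h f r \<Lambda> \<mu> "1 / \<kappa>"
    by unfold_locales (fact A f(1,2) \<Lambda>(3) \<open>compact \<Lambda>\<close> \<mu> \<kappa>(3) \<open>riemannian_metric A h\<close>)+
  obtain U where "open U" "\<Lambda> \<subseteq> U" "closure U \<subseteq> f ` U" "(\<Inter>k. (f ^^ k) -` U) = \<Lambda>"
    using repelling_neighbourhood[OF assms(5)] .
  then have "repeller f \<Lambda>" unfolding repeller_def using assms(4) by blast
  then show ?thesis using metrically_expanding by blast
qed

end
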